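(* Let $p\ge q\ge 1$ be integers, $n=p+q$, and let $\mathbf m=(m_1,\dots,m_n)$ be a Hessenberg vector of length $n$. The following conditions are equivalent. (1) $\mathrm{Hess}(\mathsf x_{p,q},\mathbf m)$ is irreducible. (2) There is a Hessenberg vector $(\ell_1,\dots,\ell_q)$ of length $q$ such that $m_i=\ell_i+p$ for $1\le i\le q$ and $m_i=n$ for $q<i\le n$. (3) $\mathrm{Hess}(\mathsf x_{p,q},\mathbf m)$ is the closure of one of the $K$-orbits $\mathcal O_{\gamma_w}$ on $\mathcal B$ with $w\in \mathbf S_q$ a $231$-free permutation. Moreover the orbits $\mathcal O_{\gamma_w}$, $w\in\mathbf S_q$ $231$-free, are pairwise distinct, and there are exactly $\frac{1}{q+1}\binom{2q}{q}$ of them.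
   Context: Notation: $[k]=\{1,\dots,k\}$; $\mathbf S_q$ is the symmetric group on $[q]$. A permutation $w\in\mathbf S_q$ is $231$-free (avoids $231$) if there are no $i<j<k$ with $w(k)<w(i)<w(j)$. A Hessenberg vector of length $k$ is a weakly increasing sequence $(m_1,\dots,m_k)$ of integers with $i\le m_i\le k$ for all $i\in[k]$. $G=GL_n(\mathbb C)$, $B\le G$ is the group of upper triangular matrices, and $\mathcal B=G/B$ is identified with the variety of full flags $V_\bullet=(0<V_1<\dots<V_n=\mathbb C^n)$, $\dim V_i=i$ ($gB$ corresponds to the flag with $V_i$ spanned by the first $i$ columns of $g$). For an $n\times n$ complex matrix $\mathsf x$ and a Hessenberg vector $\mathbf m$ of length $n$, $\mathrm{Hess}(\mathsf x,\mathbf m)=\{V_\bullet\in\mathcal B : \mathsf x V_i\le V_{m_i}\text{ for all } i\in[n]\}$. $\mathsf x_{p,q}=\mathrm{diag}(\lambda_1,\dots,\lambda_1,\lambda_2,\dots,\lambda_2)$ ($p$ copies of $\lambda_1$, $q$ copies of $\lambda_2$) with $\lambda_1\ne\lambda_2$ in $\mathbb C$. $K\cong GL_p(\mathbb C)\times GL_q(\mathbb C)$ is the centralizer of $\mathsf x_{p,q}$ in $G$ (block diagonal matrices with blocks of sizes $p,q$), acting on $\mathcal B$ by left multiplication. For $w\in\mathbf S_q$, $\mathcal O_{\gamma_w}$ denotes the $K$-orbit of the flag $V_\bullet$ with $V_i=\mathrm{span}(v_1,\dots,v_i)$, where, with $e_1,\dots,e_n$ the standard basis of $\mathbb C^n$: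 $v_i=e_i+e_{p+w^{-1}(i)}$ for $1\le i\le q$; $v_i=e_i$ for $q<i\le p$; $v_{p+j}=e_{w(j)}-e_{p+j}$ for $1\le j\le q$. *)

theory Defs
  imports
    "HOL-Analysis.Abstract_Topology"
    "HOL-Combinatorics.Permutations"
    "Jordan_Normal_Form.DL_Rank"
begin

definition avoids_231 :: "nat \<Rightarrow> (nat \<Rightarrow> nat) \<Rightarrow> bool" where
  "avoids_231 q w \<longleftrightarrow>
     \<not> (\<exists>i j k. 1 \<le> i \<and> i < j \<and> j < k \<and> k \<le> q \<and> w k < w i \<and> w i < w j)"

text \<open>Only the values of m on \<open>{1..k}\<close> are relevant.\<close>

definition hessenberg_vector :: "nat \<Rightarrow> (nat \<Rightarrow> nat) \<Rightarrow> bool" where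
  "hessenberg_vector k m \<longleftrightarrow> mono_on {1..k} m \<and> (\<forall>i\<in>{1..k}. i \<le> m i \<and> m i \<le> k)"


text \<open>Matrices and vectors are indexed from 0, flags, permutations and Hessenberg vectors from 1;
  so the basis vector \<open>e\<^sub>i\<close> is \<^term>\<open>unit_vec n (i - 1)\<close>.\<close>

abbreviation cspace :: "nat \<Rightarrow> (complex, complex vec) module" where
  "cspace n \<equiv> module_vec TYPE(complex) n"

abbreviation cspan :: "nat \<Rightarrow> complex vec set \<Rightarrow> complex vec set" where
  "cspan n \<equiv> LinearCombinations.module.span class_ring (cspace n)"

definition GL :: "nat \<Rightarrow> complex mat set" where
  "GL n = {g \<in> carrier_mat n n. invertible_mat g}"

text \<open>A full flag is represented by the extensional function sending \<open>i \<in> {1..n}\<close> to its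
  \<open>i\<close>-dimensional member. In particular \<open>V n\<close> is the whole space.\<close>

definition flags :: "nat \<Rightarrow> (nat \<Rightarrow> complex vec set) set" where
  "flags n = {V \<in> extensional {1..n}.
     (\<forall>i\<in>{1..n}. VectorSpace.subspace class_ring (V i) (cspace n) \<and>
        vectorspace.dim class_ring ((cspace n)\<lparr>carrier := V i\<rparr>) = i) \<and>
     (\<forall>i\<in>{1..<n}. V i \<subseteq> V (Suc i))}"

definition flag_of_vectors :: "nat \<Rightarrow> (nat \<Rightarrow> complex vec) \<Rightarrow> nat \<Rightarrow> complex vec set" where
  "flag_of_vectors n v = (\<lambda>i\<in>{1..n}. cspan n (v ` {1..i}))"

definition flag_of_mat :: "nat \<Rightarrow> complex mat \<Rightarrow> nat \<Rightarrow> complex vec set" where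
  "flag_of_mat n g = flag_of_vectors n (\<lambda>j. col g (j - 1))"

definition act_flag :: "nat \<Rightarrow> complex mat \<Rightarrow> (nat \<Rightarrow> complex vec set) \<Rightarrow> nat \<Rightarrow> complex vec set" where
  "act_flag n g V = (\<lambda>i\<in>{1..n}. (\<lambda>u. g *\<^sub>v u) ` V i)"


inductive_set mat_polys :: "nat \<Rightarrow> (complex mat \<Rightarrow> complex) set" for n :: nat where
  const: "(\<lambda>_. c) \<in> mat_polys n"
| entry: "i < n \<Longrightarrow> j < n \<Longrightarrow> (\<lambda>g. g $$ (i, j)) \<in> mat_polys n"
| add: "f \<in> mat_polys n \<Longrightarrow> h \<in> mat_polys n \<Longrightarrow> (\<lambda>g. f g + h g) \<in> mat_polys n"
| mult: "f \<in> mat_polys n \<Longrightarrow> h \<in> mat_polys n \<Longrightarrow> (\<lambda>g. f g * h g) \<in> mat_polys n"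

text \<open>The Zariski topology on \<open>GL\<^sub>n\<close>. Adjoining the inverse of the determinant to
  the polynomial functions would give the same closed sets.\<close>

definition zariski_GL :: "nat \<Rightarrow> complex mat topology" where
  "zariski_GL n =
     topology (\<lambda>U. \<exists>F \<subseteq> mat_polys n. U = GL n - {g \<in> GL n. \<forall>f\<in>F. f g = 0})"

text \<open>The flag variety is \<open>G / B\<close> via \<^const>\<open>flag_of_mat\<close>, whose fibres over the flags are the left
  cosets of \<open>B\<close>. Its Zariski topology is the quotient topology, as the projection
  \<open>G \<rightarrow> G / B\<close> is an open surjective morphism.\<close>

definition zariski_flags :: "nat \<Rightarrow> (nat \<Rightarrow> complex vec set) topology" where
  "zariski_flags n =
     topology (\<lambda>U. U \<subseteq> flags n \<and> openin (zariski_GL n) {g \<in> GL n. flag_of_mat n g \<in> U})"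

definition irreducible_in :: "'a topology \<Rightarrow> 'a set \<Rightarrow> bool" where
  "irreducible_in X S \<longleftrightarrow> S \<subseteq> topspace X \<and> S \<noteq> {} \<and>
     (\<forall>C D. closedin (subtopology X S) C \<and> closedin (subtopology X S) D \<and> S = C \<union> D
        \<longrightarrow> S = C \<or> S = D)"


definition Hess :: "nat \<Rightarrow> complex mat \<Rightarrow> (nat \<Rightarrow> nat) \<Rightarrow> (nat \<Rightarrow> complex vec set) set" where
  "Hess n x m = {V \<in> flags n. \<forall>i\<in>{1..n}. (\<lambda>u. x *\<^sub>v u) ` V i \<subseteq> V (m i)}"

definition x_pq :: "nat \<Rightarrow> nat \<Rightarrow> complex \<Rightarrow> complex \<Rightarrow> complex mat" where
  "x_pq p q a b = mat_diag (p + q) (\<lambda>i. if i < p then a else b)"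

definition centralizer_GL :: "nat \<Rightarrow> complex mat \<Rightarrow> complex mat set" where
  "centralizer_GL n x = {g \<in> GL n. g * x = x * g}"

definition gamma_vec :: "nat \<Rightarrow> nat \<Rightarrow> (nat \<Rightarrow> nat) \<Rightarrow> nat \<Rightarrow> complex vec" where
  "gamma_vec p q w i =
     (let e = (\<lambda>j. unit_vec (p + q) (j - 1)) in
      if i \<le> q then e i + e (p + inv_into UNIV w i)
      else if i \<le> p then e i
      else e (w (i - p)) - e i)"

definition gamma_orbit ::
    "nat \<Rightarrow> nat \<Rightarrow> complex \<Rightarrow> complex \<Rightarrow> (nat \<Rightarrow> nat) \<Rightarrow> (nat \<Rightarrow> complex vec set) set" where
  "gamma_orbit p q a b w =
     (\<lambda>g. act_flag (p + q) g (flag_of_vectors (p + q) (gamma_vec p q w)))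
       ` centralizer_GL (p + q) (x_pq p q a b)"


lemma openin_zariski_GL:
  "openin (zariski_GL n) U \<longleftrightarrow>
     (\<exists>F \<subseteq> mat_polys n. U = GL n - {g \<in> GL n. \<forall>f\<in>F. f g = 0})"
proof -
  have "istopology (\<lambda>U. \<exists>F \<subseteq> mat_polys n. U = GL n - {g \<in> GL n. \<forall>f\<in>F. f g = 0})"
    unfolding istopology_def
  proof (intro conjI allI impI)
    fix S T
    assume "\<exists>F \<subseteq> mat_polys n. S = GL n - {g \<in> GL n. \<forall>f\<in>F. f g = 0}"
      and "\<exists>F \<subseteq> mat_polys n. T = GL n - {g \<in> GL n. \<forall>f\<in>F. f g = 0}"
    then obtain F H where F: "F \<subseteq> mat_polys n" "S = GL n - {g \<in> GL n. \<forall>f\<in>F. f g = 0}"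
      and H: "H \<subseteq> mat_polys n" "T = GL n - {g \<in> GL n. \<forall>f\<in>H. f g = 0}"
      by blast
    let ?P = "(\<lambda>(f, h) g. f g * h g) ` (F \<times> H)"
    have "?P \<subseteq> mat_polys n"
      using F(1) H(1) by (auto intro: mat_polys.mult)
    moreover have "S \<inter> T = GL n - {g \<in> GL n. \<forall>f\<in>?P. f g = 0}"
    proof (rule Set.set_eqI)
      fix g
      have "(\<forall>k\<in>?P. k g = 0) \<longleftrightarrow> (\<forall>f\<in>F. \<forall>h\<in>H. f g * h g = 0)"
        by simp
      then show "g \<in> S \<inter> T \<longleftrightarrow> g \<in> GL n - {g \<in> GL n. \<forall>f\<in>?P. f g = 0}"
        unfolding F(2) H(2) by auto
    qed
    ultimately show "\<exists>F \<subseteq> mat_polys n. S \<inter> T = GL n - {g \<in> GL n. \<forall>f\<in>F. f g = 0}"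
      by (intro exI conjI)
  next
    fix K
    assume "\<forall>U\<in>K. \<exists>F \<subseteq> mat_polys n. U = GL n - {g \<in> GL n. \<forall>f\<in>F. f g = 0}"
    then obtain F where
      F: "\<forall>U\<in>K. F U \<subseteq> mat_polys n \<and> U = GL n - {g \<in> GL n. \<forall>f\<in>F U. f g = 0}"
      by (rule bchoice[THEN exE])
    have "\<Union>K = GL n - {g \<in> GL n. \<forall>f\<in>\<Union>(F ` K). f g = 0}" (is "_ = ?R")
    proof (rule Set.set_eqI)
      fix g
      have "g \<in> U \<longleftrightarrow> g \<in> GL n \<and> (\<exists>f\<in>F U. f g \<noteq> 0)" if "U \<in> K" for U
        using bspec[OF F that, THEN conjunct2] by (subst (asm) set_eq_iff) auto
      then show "g \<in> \<Union>K \<longleftrightarrow> g \<in> ?R"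
        by auto
    qed
    moreover have "\<Union>(F ` K) \<subseteq> mat_polys n"
      using F by blast
    ultimately show "\<exists>F \<subseteq> mat_polys n. \<Union>K = GL n - {g \<in> GL n. \<forall>f\<in>F. f g = 0}"
      by (intro exI conjI)
  qed
  then show ?thesis
    by (simp add: zariski_GL_def)
qed

lemma topspace_zariski_GL [simp]: "topspace (zariski_GL n) = GL n"
proof
  show "topspace (zariski_GL n) \<subseteq> GL n"
  proof -
    obtain F :: "(complex mat \<Rightarrow> complex) set"
      where "topspace (zariski_GL n) = GL n - {g \<in> GL n. \<forall>f\<in>F. f g = 0}"
      using openin_topspace[of "zariski_GL n"] unfolding openin_zariski_GL by (elim exE conjE)
    then show ?thesis
      by (simp only: Diff_subset)
  qed
  have "GL n = GL n - {g \<in> GL n. \<forall>f\<in>{\<lambda>_. 1}. f g = (0::complex)}"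
    by auto
  then have "openin (zariski_GL n) (GL n)"
    unfolding openin_zariski_GL using mat_polys.const[of 1 n] by (intro exI[of _ "{\<lambda>_. 1}"] conjI) auto
  then show "GL n \<subseteq> topspace (zariski_GL n)"
    by (rule openin_subset)
qed

lemma openin_zariski_flags:
  "openin (zariski_flags n) U \<longleftrightarrow>
     U \<subseteq> flags n \<and> openin (zariski_GL n) {g \<in> GL n. flag_of_mat n g \<in> U}"
proof -
  have "istopology (\<lambda>U. U \<subseteq> flags n \<and> openin (zariski_GL n) {g \<in> GL n. flag_of_mat n g \<in> U})"
    unfolding istopology_def
  proof (intro conjI allI impI)
    fix S T
    assume "S \<subseteq> flags n \<and> openin (zariski_GL n) {g \<in> GL n. flag_of_mat n g \<in> S}"
      and "T \<subseteq> flags n \<and> openin (zariski_GL n) {g \<in> GL n. flag_of_mat n g \<in> T}"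
    moreover have "{g \<in> GL n. flag_of_mat n g \<in> S \<inter> T} =
        {g \<in> GL n. flag_of_mat n g \<in> S} \<inter> {g \<in> GL n. flag_of_mat n g \<in> T}"
      by blast
    ultimately show "S \<inter> T \<subseteq> flags n"
      "openin (zariski_GL n) {g \<in> GL n. flag_of_mat n g \<in> S \<inter> T}"
      by auto
  next
    fix K
    assume *: "\<forall>U\<in>K. U \<subseteq> flags n \<and> openin (zariski_GL n) {g \<in> GL n. flag_of_mat n g \<in> U}"
    then show "\<Union>K \<subseteq> flags n"
      by blast
    have "{g \<in> GL n. flag_of_mat n g \<in> \<Union>K} = (\<Union>U\<in>K. {g \<in> GL n. flag_of_mat n g \<in> U})"
      by blast
    with * show "openin (zariski_GL n) {g \<in> GL n. flag_of_mat n g \<in> \<Union>K}"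
      by auto
  qed
  then show ?thesis
    by (simp add: zariski_flags_def)
qed

lemma flag_of_mat_in_flags:
  assumes "g \<in> GL n"
  shows "flag_of_mat n g \<in> flags n"
proof -
  interpret vec_space "TYPE(complex)" n .
  have g: "g \<in> carrier_mat n n" and inv: "invertible_mat g"
    using assms by (auto simp: GL_def)
  have det: "det g \<noteq> 0"
  proof -
    obtain h where h: "inverts_mat g h" "inverts_mat h g"
      using inv by (auto simp: invertible_mat_def)
    have gh: "g * h = 1\<^sub>m n" and hg: "h * g = 1\<^sub>m (dim_row h)"
      using h g by (auto simp: inverts_mat_def)
    have "dim_col h = n" using arg_cong[OF gh, of dim_col] by simp
    moreover have "dim_row h = n" using arg_cong[OF hg, of dim_col] g by simp
    ultimately have "h \<in> carrier_mat n n" by auto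
    then have "det g * det h = 1"
      using det_mult[OF g, of h] gh by simp
    then show ?thesis by auto
  qed
  have rank: "rank g = n"
    using det det_rank_iff[OF g] by simp
  have dist: "distinct (cols g)"
    using non_distinct_low_rank[OF g] rank by auto
  have li: "lin_indpt (set (cols g))"
    using full_rank_lin_indpt[OF g rank dist] .
  define v where "v = (\<lambda>j. col g (j - 1))"
  have im: "v ` {1..i} \<subseteq> set (cols g)" if "i \<le> n" for i
    using that g by (force simp: v_def cols_def)
  have inj: "inj_on v {1..n}"
  proof (rule inj_onI)
    fix i j assume ij: "i \<in> {1..n}" "j \<in> {1..n}" "v i = v j"
    then have "cols g ! (i - 1) = cols g ! (j - 1)"
      using g by (auto simp: v_def)
    then have "i - 1 = j - 1"
      using dist ij(1,2) g by (subst (asm) nth_eq_iff_index_eq) auto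
    then show "i = j" using ij by auto
  qed
  have sub: "v ` {1..i} \<subseteq> carrier_vec n" for i
    using g by (auto simp: v_def)
  have "VectorSpace.subspace class_ring (cspan n (v ` {1..i})) (cspace n)" for i
    using sub span_is_subspace by simp
  moreover have "vectorspace.dim class_ring ((cspace n)\<lparr>carrier := cspan n (v ` {1..i})\<rparr>) = i"
    if "i \<le> n" for i
  proof -
    have "lin_indpt (v ` {1..i})"
      using subset_li_is_li[OF li im[OF that]] .
    then have "maximal (v ` {1..i}) (\<lambda>T. T \<subseteq> v ` {1..i} \<and> lin_indpt T)"
      by (auto simp: maximal_def)
    then have "vectorspace.dim class_ring (span_vs (v ` {1..i})) = card (v ` {1..i})"
      using dim_span sub by simp
    also have "card (v ` {1..i}) = i"
      using inj that by (subst card_image) (auto intro: inj_on_subset)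
    finally show ?thesis .
  qed
  moreover have "cspan n (v ` {1..i}) \<subseteq> cspan n (v ` {1..Suc i})" for i
    by (rule span_is_monotone) auto
  ultimately show ?thesis
    by (auto simp: flags_def flag_of_mat_def flag_of_vectors_def v_def)
qed

lemma topspace_zariski_flags [simp]: "topspace (zariski_flags n) = flags n"
proof
  show "topspace (zariski_flags n) \<subseteq> flags n"
    using openin_topspace[of "zariski_flags n"] unfolding openin_zariski_flags by (rule conjunct1)
  have "{g \<in> GL n. flag_of_mat n g \<in> flags n} = GL n"
    using flag_of_mat_in_flags by blast
  then have "openin (zariski_flags n) (flags n)"
    unfolding openin_zariski_flags using openin_topspace[of "zariski_GL n"] by simp
  then show "flags n \<subseteq> topspace (zariski_flags n)"
    by (rule openin_subset)
qed

end

theory Submission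
  imports Defs
begin

text \<open>
  Replace \<open>x\<close> by the involution \<open>s = diag(1, \<dots>, 1, -1, \<dots>, -1)\<close>, which has the same centralizer
  and the same Hessenberg varieties. Every flag has an adapted basis \<open>h\<close> with
  \<open>s h\<^sub>k = \<epsilon>\<^sub>k h\<^bsub>\<sigma> k\<^esub>\<close> for an involution \<open>\<sigma>\<close> and signs \<open>\<epsilon>\<close> (a clan); the
  \<open>K\<close>-orbits are the sets of flags of a given clan, and such a flag lies in \<open>Hess(x, m)\<close> iff \<open>\<sigma>\<close>
  is bounded by \<open>m\<close>. A line \<open>h\<^sub>i + t h\<^sub>c\<close> exhibits an orbit in the closure of the orbit of a
  modified clan. If \<open>m\<close> satisfies (2), a clan bounded by \<open>m\<close> that admits no bounded modification
  pairs \<open>{1..q}\<close> with \<open>{p+1..n}\<close> through the inverse of a 231-free permutation with running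
  maximum \<open>l\<close>, and this permutation is unique; hence (3). Orbit closures are irreducible since
  bases adapted to a fixed clan form an open subset of a linear space. If (2) fails,
  then \<open>m\<^sub>i < p + i\<close> for some \<open>i \<le> q\<close>, and \<open>Hess(x, m)\<close> is covered by two proper closed
  subsets, given by the vanishing of minors of the first \<open>i\<close> and of the first \<open>p\<close> columns.
  Finally 231-free permutations correspond to Hessenberg vectors of length \<open>q\<close>, which are
  counted by a ballot recursion.
\<close>

section \<open>Bases and coordinates\<close>

text \<open>Every closure statement is reduced to a polynomial curve of bases: a closed set of flags
  is the zero set of polynomials in the entries of a basis, so vanishing for
  \<open>t \<noteq> 0\<close> forces vanishing at \<open>t = 0\<close>, and irreducibility needs
  only the line joining two adapted bases. The five moves on clans lower an integer weight, so they
  stop. That they stop at the right clans is a counting argument with two inputs: the inequality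
  \<open>p + i \<le> m i\<close> for \<open>i \<le> q\<close>, which is what condition (2) amounts
  to, and the trace of \<open>s\<close>, which fixes the excess of plus signs over minus signs at
  \<open>p - q\<close>. Existence of a 231-free permutation with a prescribed running maximum of its
  inverse is then taken from geometry: the Hessenberg variety is nonempty, so it contains a flag,
  hence some final clan exists. Uniqueness is combinatorial: the first place where two inverses
  differ produces a 231 pattern. The existence result, applied with \<open>p = q\<close>, also
  supplies the surjectivity behind the count.\<close>

definition fmat :: "nat \<Rightarrow> (nat \<Rightarrow> complex vec) \<Rightarrow> complex mat" where
  "fmat n h = mat n n (\<lambda>(i, k). h k $ i)"

definition vecs :: "nat \<Rightarrow> (nat \<Rightarrow> complex vec) \<Rightarrow> bool" where
  "vecs n h \<longleftrightarrow> (\<forall>k<n. h k \<in> carrier_vec n)"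

text \<open>Span of the first \<open>i\<close> vectors, positions counted from 0. The recursion
  replaces \<open>cspan\<close> (see \<open>cspan_eq_vspan\<close>) so that statements about flags
  can be proved by induction on \<open>i\<close>.\<close>

primrec vspan :: "nat \<Rightarrow> (nat \<Rightarrow> complex vec) \<Rightarrow> nat \<Rightarrow> complex vec set" where
  "vspan n h 0 = {0\<^sub>v n}"
| "vspan n h (Suc i) = {c \<cdot>\<^sub>v h i + z | c z. z \<in> vspan n h i}"

text \<open>Independence is stated along the flag, each vector against its predecessors, which is
  the form that choosing vectors from successive members of a flag produces.\<close>

definition is_basis :: "nat \<Rightarrow> (nat \<Rightarrow> complex vec) \<Rightarrow> bool" where
  "is_basis n h \<longleftrightarrow> vecs n h \<and> (\<forall>k<n. h k \<notin> vspan n h k)"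

lemma fmat_carrier [simp]: "fmat n h \<in> carrier_mat n n"
  by (simp add: fmat_def)

lemma vecsD [simp]: "vecs n h \<Longrightarrow> k < n \<Longrightarrow> h k \<in> carrier_vec n"
  by (simp add: vecs_def)

lemma is_basisD: "is_basis n h \<Longrightarrow> vecs n h" "is_basis n h \<Longrightarrow> k < n \<Longrightarrow> h k \<notin> vspan n h k"
  by (auto simp: is_basis_def)

lemma vspan_carrier: "vecs n h \<Longrightarrow> i \<le> n \<Longrightarrow> vspan n h i \<subseteq> carrier_vec n"
  by (induction i) (auto simp: vecs_def)

lemma vspan_zero: "vecs n h \<Longrightarrow> i \<le> n \<Longrightarrow> 0\<^sub>v n \<in> vspan n h i"
proof (induction i)
  case (Suc i)
  then have "h i \<in> carrier_vec n" by auto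
  then have "0\<^sub>v n = 0 \<cdot>\<^sub>v h i + 0\<^sub>v n"
    by (intro eq_vecI) auto
  moreover have "0\<^sub>v n \<in> vspan n h i" using Suc by simp
  ultimately show ?case unfolding vspan.simps by blast
qed auto

lemma vspan_add:
  assumes "vecs n h" "i \<le> n" "u \<in> vspan n h i" "v \<in> vspan n h i"
  shows "u + v \<in> vspan n h i"
  using assms
proof (induction i arbitrary: u v)
  case (Suc i)
  obtain c z where u: "u = c \<cdot>\<^sub>v h i + z" "z \<in> vspan n h i" using Suc.prems by auto
  obtain d y where v: "v = d \<cdot>\<^sub>v h i + y" "y \<in> vspan n h i" using Suc.prems by auto
  have car: "h i \<in> carrier_vec n" "z \<in> carrier_vec n" "y \<in> carrier_vec n"
    using u v Suc.prems vspan_carrier[of n h i] by auto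
  have "u + v = (c + d) \<cdot>\<^sub>v h i + (z + y)"
    unfolding u v by (intro eq_vecI) (use car in \<open>auto simp: algebra_simps\<close>)
  moreover have "z + y \<in> vspan n h i" using Suc u v by simp
  ultimately show ?case by auto
qed auto

lemma vspan_smult:
  assumes "vecs n h" "i \<le> n" "u \<in> vspan n h i"
  shows "a \<cdot>\<^sub>v u \<in> vspan n h i"
  using assms
proof (induction i arbitrary: u)
  case (Suc i)
  obtain c z where u: "u = c \<cdot>\<^sub>v h i + z" "z \<in> vspan n h i" using Suc.prems by auto
  have car: "h i \<in> carrier_vec n" "z \<in> carrier_vec n"
    using u Suc.prems vspan_carrier[of n h i] by auto
  have "a \<cdot>\<^sub>v u = (a * c) \<cdot>\<^sub>v h i + (a \<cdot>\<^sub>v z)"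
    unfolding u by (intro eq_vecI) (use car in \<open>auto simp: algebra_simps\<close>)
  moreover have "a \<cdot>\<^sub>v z \<in> vspan n h i" using Suc u by simp
  ultimately show ?case by auto
qed auto

lemma vspan_minus:
  assumes "vecs n h" "i \<le> n" "u \<in> vspan n h i" "v \<in> vspan n h i"
  shows "u - v \<in> vspan n h i"
proof -
  have "u \<in> carrier_vec n" "v \<in> carrier_vec n" using assms vspan_carrier by blast+
  then have "u - v = u + (-1) \<cdot>\<^sub>v v" by (intro eq_vecI) auto
  then show ?thesis using assms vspan_add vspan_smult by metis
qed

lemma vspan_SucI: "vecs n h \<Longrightarrow> Suc i \<le> n \<Longrightarrow> vspan n h i \<subseteq> vspan n h (Suc i)"
proof
  fix z assume a: "vecs n h" "Suc i \<le> n" "z \<in> vspan n h i"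
  then have "z \<in> carrier_vec n" using vspan_carrier[of n h i] by auto
  moreover have "h i \<in> carrier_vec n" using a by auto
  ultimately have "z = 0 \<cdot>\<^sub>v h i + z" by (intro eq_vecI) auto
  with a show "z \<in> vspan n h (Suc i)" by auto
qed

lemma vspan_mono:
  assumes "vecs n h" "i \<le> j" "j \<le> n" shows "vspan n h i \<subseteq> vspan n h j"
  using assms(2,3)
proof (induction j rule: dec_induct)
  case (step j)
  then show ?case using vspan_SucI[OF assms(1), of j] by auto
qed simp

lemma vspan_mem:
  assumes "vecs n h" "k < i" "i \<le> n" shows "h k \<in> vspan n h i"
proof -
  have "h k = 1 \<cdot>\<^sub>v h k + 0\<^sub>v n" using assms by (intro eq_vecI) (auto simp: vecs_def)
  moreover have "0\<^sub>v n \<in> vspan n h k" using assms by (intro vspan_zero) auto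
  ultimately have "h k \<in> vspan n h (Suc k)" unfolding vspan.simps by blast
  then show ?thesis using vspan_mono[of n h "Suc k" i] assms by auto
qed

lemma vspan_cong: "(\<And>k. k < i \<Longrightarrow> h k = h' k) \<Longrightarrow> vspan n h i = vspan n h' i"
  by (induction i) auto

lemma vspan_least:
  assumes "0\<^sub>v n \<in> S" "\<And>u v. u \<in> S \<Longrightarrow> v \<in> S \<Longrightarrow> u + v \<in> S" "\<And>c u. u \<in> S \<Longrightarrow> c \<cdot>\<^sub>v u \<in> S"
    and "\<And>k. k < i \<Longrightarrow> h k \<in> S"
  shows "vspan n h i \<subseteq> S"
  using assms(4) by (induction i) (auto intro!: assms(1-3))

lemma col_fmat: "vecs n h \<Longrightarrow> k < n \<Longrightarrow> col (fmat n h) k = h k"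
  by (intro eq_vecI) (auto simp: fmat_def vecs_def)

lemma mult_unit_vec: "(M :: complex mat) \<in> carrier_mat n n \<Longrightarrow> i < n \<Longrightarrow> M *\<^sub>v unit_vec n i = col M i"
  by (intro eq_vecI) (auto simp: scalar_prod_def if_distrib[of "\<lambda>x. _ * x"] intro: mult_1_right cong: if_cong)

lemma fmat_unit_vec: "vecs n h \<Longrightarrow> i < n \<Longrightarrow> fmat n h *\<^sub>v unit_vec n i = h i"
  by (simp add: mult_unit_vec[OF fmat_carrier] col_fmat)

lemma vspan_coords:
  assumes "vecs n h" "i \<le> n"
  shows "vspan n h i = {fmat n h *\<^sub>v y | y. y \<in> carrier_vec n \<and> (\<forall>k. i \<le> k \<and> k < n \<longrightarrow> y $ k = 0)}"
    (is "_ = ?R i")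
  using assms(2)
proof (induction i)
  case 0
  have "y = 0\<^sub>v n" if "y \<in> carrier_vec n" "\<forall>k. 0 \<le> k \<and> k < n \<longrightarrow> y $ k = 0" for y :: "complex vec"
    using that by (intro eq_vecI) auto
  moreover have "fmat n h *\<^sub>v 0\<^sub>v n = 0\<^sub>v n" by (intro eq_vecI) (auto simp: fmat_def)
  ultimately show ?case by (force intro: exI[of _ "0\<^sub>v n"])
next
  case (Suc i)
  then have IH: "vspan n h i = ?R i" and i: "i < n" by auto
  have hi: "h i = fmat n h *\<^sub>v unit_vec n i"
    using i assms(1) by (simp add: fmat_unit_vec)
  show ?case
  proof (intro equalityI subsetI)
    fix v assume "v \<in> vspan n h (Suc i)"
    then obtain c y where v: "v = c \<cdot>\<^sub>v h i + fmat n h *\<^sub>v y" and y: "y \<in> carrier_vec n" "\<forall>k. i \<le> k \<and> k < n \<longrightarrow> y $ k = 0"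
      using IH by auto
    have "v = fmat n h *\<^sub>v (c \<cdot>\<^sub>v unit_vec n i + y)"
      unfolding v hi using y
      by (simp add: mult_add_distrib_mat_vec[OF fmat_carrier] mult_mat_vec[OF fmat_carrier])
    then show "v \<in> ?R (Suc i)" using y i by (auto intro!: exI[of _ "c \<cdot>\<^sub>v unit_vec n i + y"])
  next
    fix v assume "v \<in> ?R (Suc i)"
    then obtain y where v: "v = fmat n h *\<^sub>v y" and y: "y \<in> carrier_vec n" "\<forall>k. Suc i \<le> k \<and> k < n \<longrightarrow> y $ k = 0" by auto
    let ?z = "y - y $ i \<cdot>\<^sub>v unit_vec n i"
    have z: "?z \<in> carrier_vec n" "\<forall>k. i \<le> k \<and> k < n \<longrightarrow> ?z $ k = 0"
      using y i by (auto simp: le_less dest: Suc_leI)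
    have "y = y $ i \<cdot>\<^sub>v unit_vec n i + ?z" using y by (intro eq_vecI) auto
    then have "v = fmat n h *\<^sub>v (y $ i \<cdot>\<^sub>v unit_vec n i + ?z)" using v by simp
    also have "\<dots> = y $ i \<cdot>\<^sub>v h i + fmat n h *\<^sub>v ?z"
      unfolding hi using z by (simp only: mult_add_distrib_mat_vec[OF fmat_carrier] mult_mat_vec[OF fmat_carrier] smult_carrier_vec unit_vec_carrier)
    finally show "v \<in> vspan n h (Suc i)" unfolding vspan.simps IH using z by blast
  qed
qed

text \<open>A nonzero kernel vector of the matrix, normalized at its last nonzero coordinate
  \<open>k\<close>, is the same thing as a relation that puts \<open>h k\<close> into the span of
  its predecessors.\<close>

lemma is_basis_iff_det:
  assumes "vecs n h" shows "is_basis n h \<longleftrightarrow> det (fmat n h) \<noteq> 0"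
proof
  assume d: "det (fmat n h) \<noteq> 0"
  have "h k \<notin> vspan n h k" if k: "k < n" for k
  proof
    assume "h k \<in> vspan n h k"
    then obtain y where y: "h k = fmat n h *\<^sub>v y" "y \<in> carrier_vec n" "\<forall>j. k \<le> j \<and> j < n \<longrightarrow> y $ j = 0"
      using vspan_coords[OF assms, of k] k by auto
    have hk: "h k = fmat n h *\<^sub>v unit_vec n k"
      using k assms by (simp add: fmat_unit_vec)
    let ?z = "y - unit_vec n k"
    have "fmat n h *\<^sub>v ?z = fmat n h *\<^sub>v y - fmat n h *\<^sub>v unit_vec n k"
      using y by (intro mult_minus_distrib_mat_vec[of _ n n]) auto
    also have "\<dots> = 0\<^sub>v n" using y hk assms k by (metis minus_cancel_vec vecsD)
    finally have "fmat n h *\<^sub>v ?z = 0\<^sub>v n" .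
    moreover have "?z \<in> carrier_vec n" using y by auto
    ultimately have "?z = 0\<^sub>v n" using d det_0_iff_vec_prod_zero[OF fmat_carrier] by blast
    moreover have "?z $ k = -1" using y k by auto
    ultimately show False using k by simp
  qed
  then show "is_basis n h" using assms by (simp add: is_basis_def)
next
  assume b: "is_basis n h"
  show "det (fmat n h) \<noteq> 0"
  proof
    assume "det (fmat n h) = 0"
    then obtain y where y: "y \<in> carrier_vec n" "y \<noteq> 0\<^sub>v n" "fmat n h *\<^sub>v y = 0\<^sub>v n"
      using det_0_iff_vec_prod_zero[OF fmat_carrier] by blast
    define k where "k = Max {k. k < n \<and> y $ k \<noteq> 0}"
    have ne: "{k. k < n \<and> y $ k \<noteq> 0} \<noteq> {}" using y by (auto intro: eq_vecI)
    have fin: "finite {k. k < n \<and> y $ k \<noteq> 0}" by simp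
    have k: "k < n" "y $ k \<noteq> 0" using Max_in[OF fin ne] by (auto simp: k_def)
    have kmax: "y $ j = 0" if "k < j" "j < n" for j
      using Max_ge[OF fin, of j] that by (fastforce simp: k_def)
    have hk: "h k = fmat n h *\<^sub>v unit_vec n k"
      using k assms by (simp add: fmat_unit_vec)
    let ?z = "unit_vec n k - (1 / y $ k) \<cdot>\<^sub>v y"
    have z: "?z \<in> carrier_vec n" "\<forall>j. k \<le> j \<and> j < n \<longrightarrow> ?z $ j = 0"
      using y k kmax by (auto simp: le_less)
    have "fmat n h *\<^sub>v ?z = fmat n h *\<^sub>v unit_vec n k - fmat n h *\<^sub>v ((1 / y $ k) \<cdot>\<^sub>v y)"
      using y by (intro mult_minus_distrib_mat_vec[of _ n n]) auto
    also have "\<dots> = h k - (1 / y $ k) \<cdot>\<^sub>v 0\<^sub>v n"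
      using hk y mult_mat_vec[OF fmat_carrier y(1)] by simp
    also have "\<dots> = h k" using is_basisD(1)[OF b] k by (intro eq_vecI) (auto simp: vecs_def)
    finally have "h k = fmat n h *\<^sub>v ?z" by simp
    then have "h k \<in> vspan n h k"
      unfolding vspan_coords[OF assms less_imp_le[OF k(1)]] using z by blast
    then show False using b k by (simp add: is_basis_def)
  qed
qed

lemma GL_iff_det: "g \<in> GL n \<longleftrightarrow> g \<in> carrier_mat n n \<and> det g \<noteq> 0"
proof
  assume g: "g \<in> GL n"
  then have c: "g \<in> carrier_mat n n" and "invertible_mat g" by (auto simp: GL_def)
  then obtain B where B: "inverts_mat g B" "inverts_mat B g" by (auto simp: invertible_mat_def)
  have gh: "g * B = 1\<^sub>m n" and hg: "B * g = 1\<^sub>m (dim_row B)"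
    using B c by (auto simp: inverts_mat_def)
  have "dim_col B = n" using arg_cong[OF gh, of dim_col] by simp
  moreover have "dim_row B = n" using arg_cong[OF hg, of dim_col] c by simp
  ultimately have "B \<in> carrier_mat n n" by auto
  then have "det g * det B = 1" using det_mult[OF c, of B] gh by simp
  then show "g \<in> carrier_mat n n \<and> det g \<noteq> 0" using c by auto
next
  assume g: "g \<in> carrier_mat n n \<and> det g \<noteq> 0"
  then obtain B where "B \<in> carrier_mat n n" "g * B = 1\<^sub>m n" "B * g = 1\<^sub>m n"
    using det_non_zero_imp_unit[of g n "()"] by (auto simp: Units_def ring_mat_def)
  then show "g \<in> GL n" using g by (auto simp: GL_def invertible_mat_def inverts_mat_def)
qed

lemma fmat_col: "g \<in> carrier_mat n n \<Longrightarrow> fmat n (col g) = g"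
  by (intro eq_matI) (auto simp: fmat_def)

lemma fmat_GL_iff: "vecs n h \<Longrightarrow> fmat n h \<in> GL n \<longleftrightarrow> is_basis n h"
  by (simp add: GL_iff_det is_basis_iff_det)

lemma vecs_col: "g \<in> carrier_mat n n \<Longrightarrow> vecs n (col g)"
  by (auto simp: vecs_def)

lemma GL_basis: "g \<in> GL n \<longleftrightarrow> g \<in> carrier_mat n n \<and> is_basis n (col g)"
  using fmat_GL_iff[of n "col g"] fmat_col[of g n] vecs_col[of g n] by (auto simp: GL_def)

lemma basis_det: "is_basis n h \<Longrightarrow> det (fmat n h) \<noteq> 0"
  using is_basis_iff_det is_basisD(1) by blast

declare vspan.simps(2) [simp del]

lemma vspan_full:
  assumes "is_basis n h" shows "vspan n h n = carrier_vec n"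
proof (intro equalityI subsetI)
  fix v :: "complex vec" assume "v \<in> carrier_vec n"
  have "fmat n h \<in> GL n" using assms fmat_GL_iff is_basisD by blast
  then obtain B where B: "B \<in> carrier_mat n n" "fmat n h * B = 1\<^sub>m n"
    using det_non_zero_imp_unit[of "fmat n h" n "()"] by (auto simp: Units_def ring_mat_def GL_iff_det)
  have "fmat n h *\<^sub>v (B *\<^sub>v v) = v"
    using B \<open>v \<in> carrier_vec n\<close> by (metis assoc_mult_mat_vec fmat_carrier one_mult_mat_vec)
  moreover have "B *\<^sub>v v \<in> carrier_vec n" using B \<open>v \<in> carrier_vec n\<close> by auto
  ultimately show "v \<in> vspan n h n" using vspan_coords[of n h n] is_basisD(1)[OF assms] by force
qed (use vspan_carrier[of n h n] is_basisD(1)[OF assms] in auto)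

text \<open>Preimages of the unit vectors are the columns of a right inverse, so the determinant is
  a unit.\<close>

lemma is_basisI_span:
  assumes h: "vecs n h" and u: "\<And>k. k < n \<Longrightarrow> unit_vec n k \<in> vspan n h n"
  shows "is_basis n h"
proof -
  have "\<exists>y. y \<in> carrier_vec n \<and> fmat n h *\<^sub>v y = unit_vec n k" if "k < n" for k
    using u[OF that] vspan_coords[OF h, of n] by force
  then obtain y where y: "\<And>k. k < n \<Longrightarrow> y k \<in> carrier_vec n \<and> fmat n h *\<^sub>v y k = unit_vec n k" by metis
  then have vy: "vecs n y" by (auto simp: vecs_def)
  have "fmat n h * fmat n y = 1\<^sub>m n"
  proof (rule mat_col_eqI)
    fix k assume "k < dim_col (1\<^sub>m n :: complex mat)"
    then have k: "k < n" by simp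
    have "col (fmat n h * fmat n y) k = fmat n h *\<^sub>v col (fmat n y) k"
      using k by (intro col_mult2[of _ n n _ n]) auto
    then show "col (fmat n h * fmat n y) k = col (1\<^sub>m n) k" using y k col_fmat[OF vy] by simp
  qed (auto simp: fmat_def)
  then have "det (fmat n h) * det (fmat n y) = 1"
    using det_mult[of "fmat n h" n "fmat n y"] by simp
  then show ?thesis using is_basis_iff_det[OF h] by auto
qed

text \<open>Invertible upper triangular change of basis, that is, the right action of
  \<open>B\<close>: it keeps every member of the flag. All later comparisons of two bases of one
  flag go through this criterion.\<close>

lemma vspan_triangular:
  assumes h: "is_basis n h" and t: "\<And>k. k < n \<Longrightarrow> \<exists>c z. c \<noteq> 0 \<and> z \<in> vspan n h k \<and> h' k = c \<cdot>\<^sub>v h k + z"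
  shows "is_basis n h'" "i \<le> n \<Longrightarrow> vspan n h' i = vspan n h i"
proof -
  have vh: "vecs n h" using h is_basisD by blast
  have vh': "vecs n h'"
    unfolding vecs_def
  proof (intro allI impI)
    fix k assume "k < n"
    then show "h' k \<in> carrier_vec n" using t[of k] vspan_carrier[OF vh, of k] vh by fastforce
  qed
  have eq: "vspan n h' i = vspan n h i" if "i \<le> n" for i
    using that
  proof (induction i)
    case (Suc i)
    then obtain c z where cz: "c \<noteq> 0" "z \<in> vspan n h i" "h' i = c \<cdot>\<^sub>v h i + z" using t[of i] by auto
    have car: "h i \<in> carrier_vec n" "z \<in> carrier_vec n"
      using cz Suc.prems vspan_carrier[of n h i] vh by auto
    have IH: "vspan n h' i = vspan n h i" using Suc by simp
    have i: "i \<le> n" using Suc by simp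
    show ?case
    proof (intro equalityI subsetI)
      fix v assume "v \<in> vspan n h' (Suc i)"
      then obtain d y where v: "v = d \<cdot>\<^sub>v h' i + y" "y \<in> vspan n h i" using IH by (auto simp: vspan.simps)
      have "y \<in> carrier_vec n" using v vspan_carrier[OF vh i] by auto
      then have "v = (d * c) \<cdot>\<^sub>v h i + (d \<cdot>\<^sub>v z + y)" unfolding v cz
        by (intro eq_vecI) (use car in \<open>auto simp: algebra_simps\<close>)
      moreover have "d \<cdot>\<^sub>v z + y \<in> vspan n h i" using v cz vspan_add[OF vh i] vspan_smult[OF vh i] by auto
      ultimately show "v \<in> vspan n h (Suc i)" by (auto simp: vspan.simps)
    next
      fix v assume "v \<in> vspan n h (Suc i)"
      then obtain d y where v: "v = d \<cdot>\<^sub>v h i + y" "y \<in> vspan n h i" by (auto simp: vspan.simps)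
      have yc: "y \<in> carrier_vec n" using v vspan_carrier[OF vh i] by auto
      have "v = (d / c) \<cdot>\<^sub>v h' i + ((- d / c) \<cdot>\<^sub>v z + y)" unfolding v cz
        by (intro eq_vecI) (use car yc cz(1) in \<open>auto simp: field_simps\<close>)
      moreover have "(- d / c) \<cdot>\<^sub>v z + y \<in> vspan n h' i"
        using v cz vspan_add[OF vh i] vspan_smult[OF vh i] IH by auto
      ultimately show "v \<in> vspan n h' (Suc i)" by (auto simp: vspan.simps)
    qed
  qed simp
  show "i \<le> n \<Longrightarrow> vspan n h' i = vspan n h i" by (rule eq)
  have "h' k \<notin> vspan n h' k" if k: "k < n" for k
  proof
    assume "h' k \<in> vspan n h' k"
    then have m: "h' k \<in> vspan n h k" using eq k by simp
    obtain c z where cz: "c \<noteq> 0" "z \<in> vspan n h k" "h' k = c \<cdot>\<^sub>v h k + z" using t[OF k] by auto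
    have "z \<in> carrier_vec n" using cz vspan_carrier[OF vh, of k] k by auto
    then have "h k = (1 / c) \<cdot>\<^sub>v (h' k - z)"
      using cz vh k by (intro eq_vecI) (auto simp: vecs_def)
    then have "h k \<in> vspan n h k"
      using vspan_smult[OF vh _ vspan_minus[OF vh _ m cz(2)]] k by simp
    then show False using h k by (auto simp: is_basis_def)
  qed
  then show "is_basis n h'" using vh' by (simp add: is_basis_def)
qed

section \<open>Flags and their Zariski topology\<close>

lemma cspan_eq_vspan:
  assumes h: "vecs n h" and i: "i \<le> n" shows "cspan n (h ` {..<i}) = vspan n h i"
proof -
  interpret vec_space "TYPE(complex)" n .
  have sub: "h ` {..<i} \<subseteq> carrier_vec n" using h i by auto
  show ?thesis
  proof (intro equalityI)
    have "submodule class_ring (vspan n h i) (cspace n)"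
      unfolding submodule_def using vspan_carrier[OF h i] vspan_zero[OF h i] vspan_add[OF h i] vspan_smult[OF h i] vec_module
      by auto
    moreover have "h ` {..<i} \<subseteq> vspan n h i" using vspan_mem[OF h _ i] by auto
    ultimately show "cspan n (h ` {..<i}) \<subseteq> vspan n h i" by (intro span_is_subset)
  next
    have sm: "submodule class_ring (cspan n (h ` {..<i})) (cspace n)" using span_is_submodule sub by simp
    show "vspan n h i \<subseteq> cspan n (h ` {..<i})"
    proof (rule vspan_least)
      show "h k \<in> cspan n (h ` {..<i})" if "k < i" for k using in_own_span sub that by auto
      show "0\<^sub>v n \<in> cspan n (h ` {..<i})" using sm by (auto simp: submodule_def)
      show "u + v \<in> cspan n (h ` {..<i})" if "u \<in> cspan n (h ` {..<i})" "v \<in> cspan n (h ` {..<i})" for u v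
        using sm that by (auto simp: submodule_def)
      show "c \<cdot>\<^sub>v u \<in> cspan n (h ` {..<i})" if "u \<in> cspan n (h ` {..<i})" for c u
        using smult_in_span[OF sub that] .
    qed
  qed
qed

definition flag :: "nat \<Rightarrow> (nat \<Rightarrow> complex vec) \<Rightarrow> nat \<Rightarrow> complex vec set" where
  "flag n h = (\<lambda>i\<in>{1..n}. vspan n h i)"

lemma flag_of_vectors_eq:
  assumes "vecs n h" and "\<And>i. 1 \<le> i \<Longrightarrow> i \<le> n \<Longrightarrow> v i = h (i - 1)"
  shows "flag_of_vectors n v = flag n h"
proof
  fix i
  have "v ` {1..i} = h ` {..<i}" if "i \<le> n"
  proof -
    have "{1..i} = Suc ` {..<i}" by (auto simp: image_iff) (metis Suc_pred' lessThan_iff less_eq_Suc_le not_less_eq_eq)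
    then have "v ` {1..i} = (\<lambda>k. v (Suc k)) ` {..<i}" by (simp add: image_image)
    also have "\<dots> = h ` {..<i}" using assms(2) that by (intro image_cong) auto
    finally show ?thesis .
  qed
  then show "flag_of_vectors n v i = flag n h i"
    using cspan_eq_vspan[OF assms(1)] by (auto simp: flag_of_vectors_def flag_def)
qed

lemma flag_of_mat_eq: "g \<in> carrier_mat n n \<Longrightarrow> flag_of_mat n g = flag n (col g)"
  unfolding flag_of_mat_def by (rule flag_of_vectors_eq) (auto simp: vecs_def)

lemma flag_fmat: "vecs n h \<Longrightarrow> flag_of_mat n (fmat n h) = flag n h"
  unfolding flag_of_mat_def by (rule flag_of_vectors_eq) (auto simp: col_fmat)

lemma flag_nth: "1 \<le> i \<Longrightarrow> i \<le> n \<Longrightarrow> flag n h i = vspan n h i"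
  by (simp add: flag_def)

lemma flag_in_flags: "is_basis n h \<Longrightarrow> flag n h \<in> flags n"
  using flag_of_mat_in_flags[of "fmat n h" n] by (simp add: flag_fmat fmat_GL_iff is_basisD)

lemma flag_eqI: "(\<And>i. i \<le> n \<Longrightarrow> vspan n h i = vspan n h' i) \<Longrightarrow> flag n h = flag n h'"
  by (simp add: flag_def cong: restrict_cong)

lemma vspan_dim:
  assumes h: "vecs n h" and i: "i \<le> n" and li: "\<And>k. k < i \<Longrightarrow> h k \<notin> vspan n h k"
  shows "card (h ` {..<i}) = i" "\<not> LinearCombinations.module.lin_dep class_ring (cspace n) (h ` {..<i})"
proof -
  interpret vec_space "TYPE(complex)" n .
  have "card (h ` {..<i}) = i \<and> lin_indpt (h ` {..<i})"
    using i li
  proof (induction i)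
    case 0
    have "lin_indpt {}" by (auto simp: lin_dep_def)
    then show ?case by simp
  next
    case (Suc i)
    then have IH: "card (h ` {..<i}) = i" "lin_indpt (h ` {..<i})" by auto
    have sub: "h ` {..<i} \<subseteq> carrier_vec n" "h i \<in> carrier_vec n" using h Suc.prems by auto
    have ns: "h i \<notin> span (h ` {..<i})" using cspan_eq_vspan[OF h, of i] Suc.prems by auto
    then have ni: "h i \<notin> h ` {..<i}" using in_own_span sub by auto
    have "lin_indpt (h ` {..<i} \<union> {h i})"
      using lin_dep_iff_in_span[of "h ` {..<i}" "h i"] sub IH ns ni by auto
    moreover have "h ` {..<i} \<union> {h i} = h ` {..<Suc i}" by (auto simp: lessThan_Suc)
    ultimately show ?case using IH ni by (simp add: lessThan_Suc)
  qed
  then show "card (h ` {..<i}) = i" "lin_indpt (h ` {..<i})" by auto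
qed

text \<open>Pick \<open>h i\<close> in member \<open>i + 1\<close> of the flag but outside member
  \<open>i\<close>. The spans are contained in the members by construction, and the prescribed
  dimensions force equality.\<close>

lemma flags_surj:
  assumes V: "V \<in> flags n"
  obtains h where "is_basis n h" "V = flag n h"
proof -
  interpret vec_space "TYPE(complex)" n .
  \<comment> \<open>The zero space is added as member 0, so that the first vector is chosen like all
    the others.\<close>
  define U where "U i = (if i = 0 then {0\<^sub>v n} else V i)" for i
  have sub: "VectorSpace.subspace class_ring (V i) (cspace n)" "vectorspace.dim class_ring ((cspace n)\<lparr>carrier := V i\<rparr>) = i"
    if "1 \<le> i" "i \<le> n" for i
    using V that by (auto simp: flags_def)
  have inc: "V i \<subseteq> V (Suc i)" if "1 \<le> i" "i < n" for i using V that by (auto simp: flags_def)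
  have Usub: "submodule class_ring (U i) (cspace n)" if "i \<le> n" for i
  proof (cases "i = 0")
    case True
    then have "U i = span {}" using span_empty by (simp add: U_def)
    then show ?thesis using span_is_submodule[of "{}"] by simp
  next
    case False
    then show ?thesis using sub[of i] that by (auto simp: U_def subspace_def)
  qed
  have U0: "0\<^sub>v n \<in> U i" "U i \<subseteq> carrier_vec n" if "i \<le> n" for i
    using Usub[OF that] by (auto simp: submodule_def)
  have Ucl: "u + v \<in> U i" "c \<cdot>\<^sub>v u \<in> U i" if "i \<le> n" "u \<in> U i" "v \<in> U i" for i u v c
    using Usub[OF that(1)] that by (auto simp: submodule_def)
  have Udim: "vectorspace.dim class_ring ((cspace n)\<lparr>carrier := U i\<rparr>) = i" if "i \<le> n" for i
  proof (cases "i = 0")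
    case True
    then have "U i = span {}" using span_empty by (simp add: U_def)
    then show ?thesis using dim_zero_vs True by simp
  next
    case False
    then show ?thesis using sub[of i] that by (simp add: U_def)
  qed
  have Uinc: "U i \<subseteq> U (Suc i)" if "i < n" for i
    using inc[of i] U0(1)[of "Suc i"] that by (auto simp: U_def)
  have "\<exists>v. v \<in> U (Suc i) - U i" if "i < n" for i
  proof (rule ccontr)
    assume "\<not> ?thesis"
    then have "U (Suc i) = U i" using Uinc[OF that] by blast
    then show False using Udim[of i] Udim[of "Suc i"] that by simp
  qed
  then have "\<forall>i. \<exists>v. i < n \<longrightarrow> v \<in> U (Suc i) - U i" by blast
  then obtain h where h: "\<And>i. i < n \<Longrightarrow> h i \<in> U (Suc i) - U i" by metis
  have Umono: "U i \<subseteq> U j" if "i \<le> j" "j \<le> n" for i j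
    using that
  proof (induction j rule: dec_induct)
    case (step j) then show ?case using Uinc[of j] by auto
  qed simp
  have vh: "vecs n h" unfolding vecs_def
  proof (intro allI impI)
    fix k assume "k < n" then show "h k \<in> carrier_vec n" using h[of k] U0(2)[of "Suc k"] by auto
  qed
  have le: "vspan n h i \<subseteq> U i" if "i \<le> n" for i
  proof (rule vspan_least)
    show "h k \<in> U i" if "k < i" for k using h[of k] Umono[of "Suc k" i] that \<open>i \<le> n\<close> by auto
  qed (use U0 Ucl that in auto)
  have nin: "h k \<notin> vspan n h k" if "k < n" for k using le[of k] h[of k] that by auto
  then have b: "is_basis n h" using vh by (simp add: is_basis_def)
  have eq: "vspan n h i = U i" if i: "i \<le> n" for i
  proof (rule ccontr)
    \<comment> \<open>A further vector \<open>v\<close> of the member would give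
      \<open>i + 1\<close> independent vectors in a space of dimension \<open>i\<close>.\<close>
    assume "vspan n h i \<noteq> U i"
    then obtain v where v: "v \<in> U i" "v \<notin> vspan n h i" using le[OF i] by blast
    let ?S = "h ` {..<i}"
    have fS: "finite ?S" by simp
    have sub: "?S \<subseteq> carrier_vec n" using vh i by auto
    have li: "card ?S = i" "lin_indpt ?S" using vspan_dim[OF vh i] nin i by auto
    have ns: "v \<notin> span ?S" using cspan_eq_vspan[OF vh i] v by simp
    have nS: "v \<notin> ?S" using ns in_own_span sub by auto
    have vc: "v \<in> carrier_vec n" using v U0 i by auto
    have li2: "lin_indpt (?S \<union> {v})"
      using lin_dep_iff_in_span[of ?S v] sub li ns nS vc by auto
    have sU: "?S \<union> {v} \<subseteq> U i" using le[OF i] vspan_mem[OF vh _ i] v by auto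
    have Uss: "VectorSpace.subspace class_ring (U i) (cspace n)"
      using Usub[OF i] by (auto simp: subspace_def vec_vs)
    interpret Ui: vectorspace class_ring "(cspace n)\<lparr>carrier := U i\<rparr>"
      using subspace_is_vs[OF Uss] .
    have li3: "\<not> Ui.lin_dep (?S \<union> {v})"
      using span_li_not_depend(2)[OF sU Usub[OF i]] li2 by simp
    \<comment> \<open>The dimension bound needs a finite spanning set of the member: an independent
      subset of largest cardinality exists, since cardinalities are at most \<open>n\<close>, and by
      maximality it spans.\<close>
    have "Ui.fin_dim"
    proof -
      have "\<exists>b. (b \<subseteq> U i \<and> lin_indpt b) \<and> (\<forall>c. c \<subseteq> U i \<and> lin_indpt c \<longrightarrow> card c \<le> card b)"
      proof (rule ex_has_greatest_nat)
        show "{} \<subseteq> U i \<and> lin_indpt {}" by (auto simp: lin_dep_def)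
        show "\<forall>c. c \<subseteq> U i \<and> lin_indpt c \<longrightarrow> card c < Suc n"
          using li_le_dim(2)[OF fin_dim] dim_is_n U0(2)[OF i] by (auto simp: less_Suc_eq_le)
      qed
      then obtain b where b: "b \<subseteq> U i \<and> lin_indpt b" "\<And>c. c \<subseteq> U i \<and> lin_indpt c \<Longrightarrow> card c \<le> card b"
        by blast
      have bc: "b \<subseteq> carrier_vec n" using b U0(2)[OF i] by auto
      have bf: "finite b" using fin_dim_li_fin[OF fin_dim] b bc by simp
      have "U i \<subseteq> span b"
      proof
        fix u assume u: "u \<in> U i"
        show "u \<in> span b"
        proof (rule ccontr)
          assume nu: "u \<notin> span b"
          then have nb: "u \<notin> b" using in_own_span bc by auto
          have "lin_indpt (b \<union> {u})"
            using lin_dep_iff_in_span[of b u] bc b nu nb u U0(2)[OF i] by auto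
          then have "card (b \<union> {u}) \<le> card b" using b u by auto
          then show False using nb bf by simp
        qed
      qed
      moreover have "Ui.span b = span b"
        using span_li_not_depend(1)[of b "U i"] b Usub[OF i] by auto
      moreover have "span b \<subseteq> U i" using span_is_subset[of b "U i"] b Usub[OF i] by auto
      ultimately show ?thesis unfolding Ui.fin_dim_def using bf b by auto
    qed
    then have "card (?S \<union> {v}) \<le> Ui.dim" using Ui.li_le_dim(2)[of "?S \<union> {v}"] sU li3 by simp
    also have "Ui.dim = i" using Udim[OF i] .
    finally show False using li nS by simp
  qed
  have "V = flag n h"
  proof
    fix i show "V i = flag n h i"
      using V eq[of i] by (cases "i \<in> {1..n}") (auto simp: flag_def flags_def U_def extensional_def)
  qed
  with b show thesis by (rule that)
qed

text \<open>The working form of the quotient topology: every element of \<open>GL n\<close> is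
  \<open>fmat\<close> of the basis formed by its columns, so closedness is tested on bases. The
  equations must hold or fail together for all bases of one flag, which the equivalence for every
  \<open>h\<close> encodes.\<close>

lemma closedin_zariski_flags:
  "closedin (zariski_flags n) C \<longleftrightarrow> C \<subseteq> flags n \<and>
     (\<exists>F \<subseteq> mat_polys n. \<forall>h. is_basis n h \<longrightarrow> (flag n h \<in> C \<longleftrightarrow> (\<forall>f\<in>F. f (fmat n h) = 0)))"
proof -
  have 1: "{g \<in> GL n. flag_of_mat n g \<in> flags n - C} = GL n - {g \<in> GL n. \<forall>f\<in>F. f g = 0} \<longleftrightarrow>
     (\<forall>h. is_basis n h \<longrightarrow> (flag n h \<in> C \<longleftrightarrow> (\<forall>f\<in>F. f (fmat n h) = 0)))" (is "?A = ?B \<longleftrightarrow> ?R") for F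
  proof
    assume AB: "?A = ?B"
    show ?R
    proof (intro allI impI)
      fix h assume h: "is_basis n h"
      then have g: "fmat n h \<in> GL n" "flag_of_mat n (fmat n h) = flag n h" "flag n h \<in> flags n"
        by (simp_all add: fmat_GL_iff flag_fmat is_basisD(1) flag_in_flags)
      have "fmat n h \<in> ?A \<longleftrightarrow> fmat n h \<in> ?B" using AB by simp
      then show "flag n h \<in> C \<longleftrightarrow> (\<forall>f\<in>F. f (fmat n h) = 0)" using g by auto
    qed
  next
    assume R: ?R
    show "?A = ?B"
    proof (rule Set.set_eqI)
      fix g
      have "flag_of_mat n g \<in> C \<longleftrightarrow> (\<forall>f\<in>F. f g = 0)" if "g \<in> GL n"
        using R[rule_format, of "col g"] that by (simp add: GL_basis flag_of_mat_eq fmat_col)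
      then show "g \<in> ?A \<longleftrightarrow> g \<in> ?B"
        using flag_of_mat_in_flags[of g n] by auto
    qed
  qed
  show ?thesis
    unfolding closedin_def openin_zariski_flags openin_zariski_GL topspace_zariski_flags 1
    by (simp only: Diff_subset simp_thms)
qed

lemma mat_polys_sum: "finite S \<Longrightarrow> (\<And>s. s \<in> S \<Longrightarrow> f s \<in> mat_polys n) \<Longrightarrow> (\<lambda>g. \<Sum>s\<in>S. f s g) \<in> mat_polys n"
  by (induction S rule: finite_induct) (auto intro: mat_polys.intros)

lemma mat_polys_prod: "finite S \<Longrightarrow> (\<And>s. s \<in> S \<Longrightarrow> f s \<in> mat_polys n) \<Longrightarrow> (\<lambda>g. \<Prod>s\<in>S. f s g) \<in> mat_polys n"
  by (induction S rule: finite_induct) (auto intro: mat_polys.intros)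

lemma mat_polys_det:
  assumes "\<And>i j. i < k \<Longrightarrow> j < k \<Longrightarrow> (\<lambda>g. M g i j) \<in> mat_polys n"
  shows "(\<lambda>g. det (mat k k (\<lambda>(i, j). M g i j))) \<in> mat_polys n"
proof -
  have "(\<lambda>g. \<Sum>p \<in> {p. p permutes {0..<k}}. signof p * (\<Prod>i = 0..<k. M g i (p i))) \<in> mat_polys n"
    by (intro mat_polys_sum mat_polys.mult mat_polys_prod mat_polys.const assms finite_permutations)
      (auto simp: permutes_in_image)
  also have "(\<lambda>g. \<Sum>p \<in> {p. p permutes {0..<k}}. signof p * (\<Prod>i = 0..<k. M g i (p i)))
      = (\<lambda>g. det (mat k k (\<lambda>(i, j). M g i j)))"
    by (auto simp: det_def fun_eq_iff permutes_in_image intro!: sum.cong prod.cong)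
  finally show ?thesis .
qed

lemma mat_polys_curve:
  assumes "f \<in> mat_polys n" "\<And>i j. i < n \<Longrightarrow> j < n \<Longrightarrow> \<exists>P. \<forall>t. \<gamma> t $$ (i, j) = poly P t"
  shows "\<exists>P. \<forall>t. f (\<gamma> t) = poly P t"
  using assms(1)
proof induction
  case (const c) show ?case by (intro exI[of _ "[:c:]"]) auto
next
  case (entry i j) then show ?case using assms(2) by blast
next
  case (add f h) then show ?case by (metis poly_add)
next
  case (mult f h) then show ?case by (metis poly_mult)
qed

lemma poly_eq_0_off: "(\<And>t. t \<noteq> 0 \<Longrightarrow> poly P t = 0) \<Longrightarrow> P = (0 :: complex poly)"
proof (rule ccontr)
  assume "\<And>t. t \<noteq> 0 \<Longrightarrow> poly P t = 0" "P \<noteq> 0"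
  then have "UNIV - {0} \<subseteq> {t. poly P t = 0}" "finite {t. poly P t = 0}" using poly_roots_finite by auto
  then have "finite (UNIV - {0 :: complex})" by (rule finite_subset)
  then show False using infinite_UNIV_char_0[where 'a = complex] by simp
qed

text \<open>Each equation of the closure becomes, along the curve, a polynomial in \<open>t\<close>
  that vanishes for all \<open>t \<noteq> 0\<close>; it has infinitely many zeros, so it vanishes at
  0 as well.\<close>

lemma flag_limit:
  assumes poly: "\<And>i k. i < n \<Longrightarrow> k < n \<Longrightarrow> \<exists>P. \<forall>t. \<gamma> t k $ i = poly P t"
    and b0: "is_basis n (\<gamma> 0)"
    and b: "\<And>t. t \<noteq> 0 \<Longrightarrow> is_basis n (\<gamma> t) \<and> flag n (\<gamma> t) \<in> S"
    and S: "S \<subseteq> flags n"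
  shows "flag n (\<gamma> 0) \<in> zariski_flags n closure_of S"
proof -
  let ?C = "zariski_flags n closure_of S"
  obtain F where F: "F \<subseteq> mat_polys n" "\<And>h. is_basis n h \<Longrightarrow> flag n h \<in> ?C \<longleftrightarrow> (\<forall>f\<in>F. f (fmat n h) = 0)"
    using closedin_closure_of[of "zariski_flags n" S] unfolding closedin_zariski_flags by blast
  have SC: "S \<subseteq> ?C" using S by (intro closure_of_subset) simp
  have "f (fmat n (\<gamma> 0)) = 0" if f: "f \<in> F" for f
  proof -
    obtain P where P: "\<And>t. f (fmat n (\<gamma> t)) = poly P t"
      using mat_polys_curve[of f n "\<lambda>t. fmat n (\<gamma> t)"] f F(1) poly by (auto simp: fmat_def)
    have "poly P t = 0" if "t \<noteq> 0" for t
      using b[OF that] F(2) f SC P[symmetric] by auto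
    then have "P = 0" by (rule poly_eq_0_off)
    then show ?thesis by (simp add: P)
  qed
  then show ?thesis using F(2)[OF b0] by blast
qed

text \<open>Cramer's rule: replacing column \<open>k\<close> by \<open>v\<close> multiplies the
  nonzero determinant by the coordinate of \<open>v\<close> at \<open>h k\<close>. This makes span
  membership a polynomial condition.\<close>

lemma vspan_iff_det:
  assumes h: "is_basis n h" and v: "v \<in> carrier_vec n" and i: "i \<le> n"
  shows "v \<in> vspan n h i \<longleftrightarrow> (\<forall>k. i \<le> k \<and> k < n \<longrightarrow> det (replace_col (fmat n h) v k) = 0)"
proof -
  have vh: "vecs n h" and d: "det (fmat n h) \<noteq> 0" using h is_basisD basis_det by blast+
  obtain y where y: "y \<in> carrier_vec n" "v = fmat n h *\<^sub>v y"
    using vspan_full[OF h] vspan_coords[OF vh, of n] v by blast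
  have "det (replace_col (fmat n h) v k) = 0 \<longleftrightarrow> y $ k = 0" if "k < n" for k
    using cramer_lemma_mat[OF fmat_carrier y(1) that, of h] y(2) d by simp
  moreover have "v \<in> vspan n h i \<longleftrightarrow> (\<forall>k. i \<le> k \<and> k < n \<longrightarrow> y $ k = 0)"
  proof
    assume "v \<in> vspan n h i"
    then obtain z where z: "z \<in> carrier_vec n" "v = fmat n h *\<^sub>v z" "\<forall>k. i \<le> k \<and> k < n \<longrightarrow> z $ k = 0"
      using vspan_coords[OF vh i] by auto
    have "fmat n h *\<^sub>v (y - z) = fmat n h *\<^sub>v y - fmat n h *\<^sub>v z"
      using y z by (intro mult_minus_distrib_mat_vec[of _ n n]) auto
    then have "fmat n h *\<^sub>v (y - z) = 0\<^sub>v n" using v y z by simp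
    moreover have "y - z \<in> carrier_vec n" using y z by auto
    ultimately have "y - z = 0\<^sub>v n" using d det_0_iff_vec_prod_zero[OF fmat_carrier] by blast
    then have "y $ k - z $ k = 0" if "k < n" for k using that y z
      by (metis index_minus_vec(1) index_zero_vec(1) carrier_vecD)
    then show "\<forall>k. i \<le> k \<and> k < n \<longrightarrow> y $ k = 0" using z by simp
  qed (use y vspan_coords[OF vh i] in auto)
  ultimately show ?thesis by auto
qed

text \<open>Since \<open>m\<close> is increasing, it suffices to test each basis vector in the first
  member containing it; \<open>h k\<close> first occurs in member \<open>Suc k\<close>.\<close>

lemma Hess_iff:
  assumes h: "is_basis n h" and x: "x \<in> carrier_mat n n" and m: "hessenberg_vector n m"
  shows "flag n h \<in> Hess n x m \<longleftrightarrow> (\<forall>k<n. x *\<^sub>v h k \<in> vspan n h (m (Suc k)))"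
proof -
  have vh: "vecs n h" using h is_basisD by blast
  have mn: "m i \<le> n" "i \<le> m i" if "1 \<le> i" "i \<le> n" for i using m that by (auto simp: hessenberg_vector_def)
  have mono: "m i \<le> m j" if "1 \<le> i" "i \<le> j" "j \<le> n" for i j
    using m that by (auto simp: hessenberg_vector_def mono_on_def)
  have "flag n h \<in> Hess n x m \<longleftrightarrow> (\<forall>i\<in>{1..n}. (\<lambda>u. x *\<^sub>v u) ` vspan n h i \<subseteq> vspan n h (m i))"
    using flag_in_flags[OF h] mn by (fastforce simp: Hess_def flag_nth)
  also have "\<dots> \<longleftrightarrow> (\<forall>k<n. x *\<^sub>v h k \<in> vspan n h (m (Suc k)))"
  proof
    assume a: "\<forall>i\<in>{1..n}. (\<lambda>u. x *\<^sub>v u) ` vspan n h i \<subseteq> vspan n h (m i)"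
    show "\<forall>k<n. x *\<^sub>v h k \<in> vspan n h (m (Suc k))"
    proof (intro allI impI)
      fix k assume k: "k < n"
      then have "h k \<in> vspan n h (Suc k)" using vspan_mem[OF vh] by auto
      moreover have "Suc k \<in> {1..n}" using k by auto
      ultimately show "x *\<^sub>v h k \<in> vspan n h (m (Suc k))" using a by blast
    qed
  next
    assume a: "\<forall>k<n. x *\<^sub>v h k \<in> vspan n h (m (Suc k))"
    show "\<forall>i\<in>{1..n}. (\<lambda>u. x *\<^sub>v u) ` vspan n h i \<subseteq> vspan n h (m i)"
    proof
      fix i assume i: "i \<in> {1..n}"
      have mi: "m i \<le> n" using mn i by auto
      let ?S = "{u \<in> carrier_vec n. x *\<^sub>v u \<in> vspan n h (m i)}"
      have "vspan n h i \<subseteq> ?S"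
      proof (rule vspan_least)
        have "x *\<^sub>v 0\<^sub>v n = 0\<^sub>v n" using x by (intro eq_vecI) auto
        then show "0\<^sub>v n \<in> ?S" using vspan_zero[OF vh mi] by auto
        show "u + v \<in> ?S" if "u \<in> ?S" "v \<in> ?S" for u v
          using that vspan_add[OF vh mi] mult_add_distrib_mat_vec[OF x, of u v] by auto
        show "c \<cdot>\<^sub>v u \<in> ?S" if "u \<in> ?S" for c u
          using that vspan_smult[OF vh mi] mult_mat_vec[OF x, of u c] by auto
        show "h k \<in> ?S" if "k < i" for k
        proof -
          have "x *\<^sub>v h k \<in> vspan n h (m (Suc k))" using a that i by auto
          moreover have "m (Suc k) \<le> m i" using mono[of "Suc k" i] that i by auto
          ultimately show ?thesis using vspan_mono[OF vh _ mi, of "m (Suc k)"] vh that i by auto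
        qed
      qed
      then show "(\<lambda>u. x *\<^sub>v u) ` vspan n h i \<subseteq> vspan n h (m i)" by auto
    qed
  qed
  finally show ?thesis .
qed

lemma closedin_Hess:
  assumes x: "x \<in> carrier_mat n n" and m: "hessenberg_vector n m"
  shows "closedin (zariski_flags n) (Hess n x m)"
  unfolding closedin_zariski_flags
proof (intro conjI exI)
  show "Hess n x m \<subseteq> flags n" by (auto simp: Hess_def)
  \<comment> \<open>\<open>D k j\<close> is the Cramer numerator of the coordinate of
    \<open>x h k\<close> at \<open>h j\<close>, written as a function of the matrix entries.\<close>
  define D where "D k j g = det (mat n n (\<lambda>(r, c). if c = j then (\<Sum>l<n. x $$ (r, l) * g $$ (l, k)) else g $$ (r, c)))"
    for k j :: nat and g :: "complex mat"
  let ?F = "{D k j | k j. k < n \<and> m (Suc k) \<le> j \<and> j < n}"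
  have "D k j \<in> mat_polys n" if "k < n" for k j
    unfolding D_def
  proof (rule mat_polys_det)
    fix r c assume rc: "r < n" "c < n"
    have "(\<lambda>g. \<Sum>l<n. x $$ (r, l) * g $$ (l, k)) \<in> mat_polys n"
      by (intro mat_polys_sum mat_polys.mult mat_polys.const mat_polys.entry) (use that in auto)
    then show "(\<lambda>g. if c = j then \<Sum>l<n. x $$ (r, l) * g $$ (l, k) else g $$ (r, c)) \<in> mat_polys n"
      using rc by (cases "c = j") (auto intro: mat_polys.entry)
  qed
  then show "?F \<subseteq> mat_polys n" by auto
  show "\<forall>h. is_basis n h \<longrightarrow> (flag n h \<in> Hess n x m \<longleftrightarrow> (\<forall>f\<in>?F. f (fmat n h) = 0))"
  proof (intro allI impI)
    fix h assume h: "is_basis n h"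
    have vh: "vecs n h" using h is_basisD by blast
    have "D k j (fmat n h) = det (replace_col (fmat n h) (x *\<^sub>v h k) j)" if "k < n" for k j
    proof -
      have "mat n n (\<lambda>(r, c). if c = j then (\<Sum>l<n. x $$ (r, l) * fmat n h $$ (l, k)) else fmat n h $$ (r, c))
          = replace_col (fmat n h) (x *\<^sub>v h k) j"
      proof -
        have "h k \<in> carrier_vec n" using vh that by auto
        then show ?thesis using that x
          by (intro eq_matI) (auto simp: replace_col_def fmat_def scalar_prod_def atLeast0LessThan intro!: sum.cong)
      qed
      then show ?thesis unfolding D_def by simp
    qed
    moreover have "m (Suc k) \<le> n" if "k < n" for k using m that by (auto simp: hessenberg_vector_def)
    moreover have "x *\<^sub>v h k \<in> carrier_vec n" if "k < n" for k using x vecsD[OF vh that] by (rule mult_mat_vec_carrier)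
    ultimately show "flag n h \<in> Hess n x m \<longleftrightarrow> (\<forall>f\<in>?F. f (fmat n h) = 0)"
      unfolding Hess_iff[OF h x m] using vspan_iff_det[OF h] by (auto; metis)
  qed
qed

text \<open>The condition is the vanishing of one \<open>j\<close> by \<open>j\<close> minor, with
  rows \<open>r0, ..., r0 + j - 1\<close> and the first \<open>j\<close> columns: a kernel vector of
  this block is a combination of the first \<open>j\<close> basis vectors that vanishes in those
  rows.\<close>

lemma closedin_minor:
  assumes j: "1 \<le> j" "r0 + j \<le> n"
  shows "closedin (zariski_flags n) {V \<in> flags n. \<exists>u\<in>V j. u \<noteq> 0\<^sub>v n \<and> (\<forall>r<j. u $ (r0 + r) = 0)}"
    (is "closedin _ ?C")
  unfolding closedin_zariski_flags
proof (intro conjI exI)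
  show "?C \<subseteq> flags n" by auto
  define D where "D g = det (mat j j (\<lambda>(r, c). g $$ (r0 + r, c)))" for g :: "complex mat"
  have "D \<in> mat_polys n" unfolding D_def by (intro mat_polys_det mat_polys.entry) (use j in auto)
  then show "{D} \<subseteq> mat_polys n" by simp
  show "\<forall>h. is_basis n h \<longrightarrow> (flag n h \<in> ?C \<longleftrightarrow> (\<forall>f\<in>{D}. f (fmat n h) = 0))"
  proof (intro allI impI)
    fix h assume h: "is_basis n h"
    have vh: "vecs n h" and d: "det (fmat n h) \<noteq> 0" using h is_basisD basis_det by blast+
    let ?M = "mat j j (\<lambda>(r, c). fmat n h $$ (r0 + r, c))"
    have M: "?M \<in> carrier_mat j j" by simp
    have row: "(fmat n h *\<^sub>v y) $ (r0 + r) = (?M *\<^sub>v vec j (\<lambda>k. y $ k)) $ r"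
      if "y \<in> carrier_vec n" "\<forall>k. j \<le> k \<and> k < n \<longrightarrow> y $ k = 0" "r < j" for y r
    proof -
      have "(fmat n h *\<^sub>v y) $ (r0 + r) = (\<Sum>k\<in>{0..<n}. fmat n h $$ (r0 + r, k) * y $ k)"
        using that j by (auto simp: scalar_prod_def fmat_def)
      also have "\<dots> = (\<Sum>k\<in>{0..<j}. fmat n h $$ (r0 + r, k) * y $ k)"
        using that j by (intro sum.mono_neutral_right) auto
      also have "\<dots> = (?M *\<^sub>v vec j (\<lambda>k. y $ k)) $ r"
        using that j by (auto simp: scalar_prod_def)
      finally show ?thesis .
    qed
    have "flag n h \<in> ?C \<longleftrightarrow> (\<exists>u\<in>vspan n h j. u \<noteq> 0\<^sub>v n \<and> (\<forall>r<j. u $ (r0 + r) = 0))"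
      using flag_in_flags[OF h] j by (auto simp: flag_nth)
    also have "\<dots> \<longleftrightarrow> (\<exists>z \<in> carrier_vec j. z \<noteq> 0\<^sub>v j \<and> ?M *\<^sub>v z = 0\<^sub>v j)"
    proof
      assume "\<exists>u\<in>vspan n h j. u \<noteq> 0\<^sub>v n \<and> (\<forall>r<j. u $ (r0 + r) = 0)"
      then obtain y where y: "y \<in> carrier_vec n" "\<forall>k. j \<le> k \<and> k < n \<longrightarrow> y $ k = 0"
        "fmat n h *\<^sub>v y \<noteq> 0\<^sub>v n" "\<forall>r<j. (fmat n h *\<^sub>v y) $ (r0 + r) = 0"
        using vspan_coords[OF vh, of j] j by auto
      have "?M *\<^sub>v vec j (\<lambda>k. y $ k) = 0\<^sub>v j"
        by (intro eq_vecI) (use row[OF y(1,2)] y(4) in auto)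
      moreover have "vec j (\<lambda>k. y $ k) \<noteq> 0\<^sub>v j"
      proof
        assume z: "vec j (\<lambda>k. y $ k) = 0\<^sub>v j"
        have "y $ k = 0" if "k < n" for k
          using arg_cong[OF z, of "\<lambda>v. v $ k"] y that by (cases "k < j") auto
        then have "y = 0\<^sub>v n" using y by (intro eq_vecI) auto
        then have "fmat n h *\<^sub>v y = 0\<^sub>v n" by (intro eq_vecI) (auto simp: fmat_def)
        then show False using y by simp
      qed
      ultimately show "\<exists>z \<in> carrier_vec j. z \<noteq> 0\<^sub>v j \<and> ?M *\<^sub>v z = 0\<^sub>v j" by (intro bexI[of _ "vec j (\<lambda>k. y $ k)"]) auto
    next
      assume "\<exists>z \<in> carrier_vec j. z \<noteq> 0\<^sub>v j \<and> ?M *\<^sub>v z = 0\<^sub>v j"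
      then obtain z where z: "z \<in> carrier_vec j" "z \<noteq> 0\<^sub>v j" "?M *\<^sub>v z = 0\<^sub>v j" by blast
      define y where "y = vec n (\<lambda>k. if k < j then z $ k else 0)"
      have y: "y \<in> carrier_vec n" "\<forall>k. j \<le> k \<and> k < n \<longrightarrow> y $ k = 0" by (auto simp: y_def)
      have vz: "vec j (\<lambda>k. y $ k) = z" using z j by (intro eq_vecI) (auto simp: y_def)
      have "y \<noteq> 0\<^sub>v n"
      proof
        assume "y = 0\<^sub>v n"
        then have "z = 0\<^sub>v j" using vz j by (auto intro!: eq_vecI)
        with z show False by simp
      qed
      then have "fmat n h *\<^sub>v y \<noteq> 0\<^sub>v n" using d y det_0_iff_vec_prod_zero[OF fmat_carrier] by blast
      moreover have "\<forall>r<j. (fmat n h *\<^sub>v y) $ (r0 + r) = 0" using row[OF y] vz z by auto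
      moreover have "fmat n h *\<^sub>v y \<in> vspan n h j" using vspan_coords[OF vh, of j] j y by auto
      ultimately show "\<exists>u\<in>vspan n h j. u \<noteq> 0\<^sub>v n \<and> (\<forall>r<j. u $ (r0 + r) = 0)" by blast
    qed
    also have "\<dots> \<longleftrightarrow> D (fmat n h) = 0" unfolding D_def using det_0_iff_vec_prod_zero[OF M] by blast
    finally show "flag n h \<in> ?C \<longleftrightarrow> (\<forall>f\<in>{D}. f (fmat n h) = 0)" by simp
  qed
qed

section \<open>Orbits of the centralizer\<close>

definition sgnv :: "nat \<Rightarrow> nat \<Rightarrow> complex vec \<Rightarrow> complex vec" where
  "sgnv p n u = vec n (\<lambda>k. if k < p then u $ k else - u $ k)"

text \<open>Only fixed points of \<open>\<sigma>\<close>, which correspond to eigenvectors of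
  \<open>s\<close>, carry a genuine sign. On an arc the second vector is chosen as the image of the
  first, so the sign is normalized to 1.\<close>

definition clan :: "nat \<Rightarrow> (nat \<Rightarrow> nat) \<Rightarrow> (nat \<Rightarrow> complex) \<Rightarrow> bool" where
  "clan n \<sigma> \<epsilon> \<longleftrightarrow> (\<forall>k<n. \<sigma> k < n \<and> \<sigma> (\<sigma> k) = k \<and> (\<sigma> k \<noteq> k \<longrightarrow> \<epsilon> k = 1) \<and> (\<epsilon> k = 1 \<or> \<epsilon> k = -1))"

definition adapted :: "nat \<Rightarrow> nat \<Rightarrow> (nat \<Rightarrow> nat) \<Rightarrow> (nat \<Rightarrow> complex) \<Rightarrow> (nat \<Rightarrow> complex vec) \<Rightarrow> bool" where
  "adapted p n \<sigma> \<epsilon> h \<longleftrightarrow> is_basis n h \<and> (\<forall>k<n. sgnv p n (h k) = \<epsilon> k \<cdot>\<^sub>v h (\<sigma> k))"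

lemma sgnv_carrier [simp]: "sgnv p n u \<in> carrier_vec n"
  by (simp add: sgnv_def)

lemma dim_sgnv [simp]: "dim_vec (sgnv p n u) = n"
  by (simp add: sgnv_def)

lemma sgnv_simps:
  "u \<in> carrier_vec n \<Longrightarrow> sgnv p n (sgnv p n u) = u"
  "u \<in> carrier_vec n \<Longrightarrow> v \<in> carrier_vec n \<Longrightarrow> sgnv p n (u + v) = sgnv p n u + sgnv p n v"
  "u \<in> carrier_vec n \<Longrightarrow> v \<in> carrier_vec n \<Longrightarrow> sgnv p n (u - v) = sgnv p n u - sgnv p n v"
  "u \<in> carrier_vec n \<Longrightarrow> sgnv p n (c \<cdot>\<^sub>v u) = c \<cdot>\<^sub>v sgnv p n u"
  by (auto simp: sgnv_def intro!: eq_vecI)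

lemma sgnv_eq_0: "u \<in> carrier_vec n \<Longrightarrow> sgnv p n u = 0\<^sub>v n \<Longrightarrow> u = 0\<^sub>v n"
proof -
  assume "u \<in> carrier_vec n" "sgnv p n u = 0\<^sub>v n"
  then have "u = sgnv p n (0\<^sub>v n)" using sgnv_simps(1)[of u n p] by simp
  also have "\<dots> = 0\<^sub>v n" by (intro eq_vecI) (auto simp: sgnv_def)
  finally show "u = 0\<^sub>v n" .
qed

lemma vspan_SucE:
  assumes "vecs n h" "k < n" "v \<in> vspan n h (Suc k)" "v \<notin> vspan n h k"
  obtains c z where "c \<noteq> 0" "z \<in> vspan n h k" "v = c \<cdot>\<^sub>v h k + z"
proof -
  obtain c z where cz: "z \<in> vspan n h k" "v = c \<cdot>\<^sub>v h k + z" using assms(3) by (auto simp: vspan.simps)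
  have "c \<noteq> 0"
  proof
    assume "c = 0"
    moreover have "h k \<in> carrier_vec n" "z \<in> carrier_vec n" using assms cz vspan_carrier[of n h k] by auto
    ultimately have "v = z" using cz by auto
    then show False using cz assms by simp
  qed
  with cz show thesis using that by blast
qed

lemma vspan_codim:
  assumes h: "vecs n h" "k < n" and v: "v \<in> vspan n h (Suc k)" "v \<notin> vspan n h k"
    and w: "w \<in> vspan n h (Suc k)" "w \<notin> vspan n h k"
  obtains c where "c \<noteq> 0" "w - c \<cdot>\<^sub>v v \<in> vspan n h k"
proof -
  obtain c z where cz: "c \<noteq> 0" "z \<in> vspan n h k" "v = c \<cdot>\<^sub>v h k + z" using vspan_SucE[OF h v] .
  obtain d y where dy: "d \<noteq> 0" "y \<in> vspan n h k" "w = d \<cdot>\<^sub>v h k + y" using vspan_SucE[OF h w] .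
  have car: "h k \<in> carrier_vec n" "z \<in> carrier_vec n" "y \<in> carrier_vec n"
    using h cz dy vspan_carrier[of n h k] by auto
  have "w - (d / c) \<cdot>\<^sub>v v = y - (d / c) \<cdot>\<^sub>v z"
    unfolding cz dy by (intro eq_vecI) (use car cz(1) in \<open>auto simp: field_simps\<close>)
  also have "\<dots> \<in> vspan n h k" using h cz dy vspan_minus[of n h k] vspan_smult[of n h k] by auto
  finally show thesis using that[of "d / c"] cz dy by auto
qed

text \<open>\<open>\<sigma>\<close> is the relative position of the flag and its image under
  \<open>s\<close>: \<open>\<sigma> i\<close> is the least \<open>j\<close> such that
  \<open>s\<close> sends some vector that is new in member \<open>i + 1\<close> into member
  \<open>j + 1\<close>. It is an involution because \<open>s\<close> is one.\<close>

lemma normal_form: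
  assumes g: "is_basis n g"
  obtains \<sigma> \<epsilon> h where "clan n \<sigma> \<epsilon>" "adapted p n \<sigma> \<epsilon> h" "flag n h = flag n g"
proof -
  let ?V = "vspan n g" and ?s = "sgnv p n"
  have vg: "vecs n g" using g is_basisD by blast
  have Vc: "?V i \<subseteq> carrier_vec n" if "i \<le> n" for i using vspan_carrier[OF vg that] .
  have Vn: "?V n = carrier_vec n" using vspan_full[OF g] .
  have V0: "0\<^sub>v n \<in> ?V i" if "i \<le> n" for i using vspan_zero[OF vg that] .
  define A where "A i j \<longleftrightarrow> (\<exists>v\<in>?V (Suc i) - ?V i. ?s v \<in> ?V (Suc j))" for i j
  define \<sigma> where "\<sigma> i = (LEAST j. A i j)" for i
  have gi: "g i \<in> ?V (Suc i) - ?V i" if "i < n" for i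
    using is_basisD(2)[OF g that] vspan_mem[OF vg, of i "Suc i"] that by auto
  have An: "A i (n - 1)" if "i < n" for i
  proof -
    have "?s (g i) \<in> ?V (Suc (n - 1))" using Vn that by simp
    then show ?thesis unfolding A_def using gi[OF that] by blast
  qed
  have As: "A i (\<sigma> i)" if "i < n" for i unfolding \<sigma>_def using An[OF that] by (rule LeastI)
  have \<sigma>n: "\<sigma> i < n" if "i < n" for i
  proof -
    have "\<sigma> i \<le> n - 1" unfolding \<sigma>_def using An[OF that] by (rule Least_le)
    then show ?thesis using that by simp
  qed
  have min: "?s v \<notin> ?V (\<sigma> i)" if i: "i < n" and v: "v \<in> ?V (Suc i) - ?V i" for i v
  proof (cases "\<sigma> i")
    case 0
    have "v \<in> carrier_vec n" using v Vc[of "Suc i"] i by auto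
    then show ?thesis using sgnv_eq_0[of v n p] V0[of i] i v 0 by auto
  next
    case (Suc j)
    then have "\<not> A i j" using not_less_Least[of j "A i"] by (simp add: \<sigma>_def)
    then show ?thesis using v Suc by (auto simp: A_def)
  qed
  have inv: "\<sigma> (\<sigma> i) = i" if i: "i < n" for i
  proof -
    let ?j = "\<sigma> i"
    have j: "?j < n" using \<sigma>n i by simp
    obtain v where v: "v \<in> ?V (Suc i) - ?V i" "?s v \<in> ?V (Suc ?j)" using As[OF i] by (auto simp: A_def)
    have vc: "v \<in> carrier_vec n" using v Vc[of "Suc i"] i by auto
    have w: "?s v \<in> ?V (Suc ?j) - ?V ?j" using v min[OF i v(1)] by auto
    have "A ?j i" unfolding A_def using w v(1) vc by (intro bexI[of _ "?s v"]) (auto simp: sgnv_simps)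
    then have le: "\<sigma> ?j \<le> i" unfolding \<sigma>_def[of ?j] by (rule Least_le)
    \<comment> \<open>If the image of some new vector \<open>w'\<close> of member
      \<open>j + 1\<close> fell into member \<open>i\<close>, it could be subtracted from
      \<open>v\<close> without leaving the vectors that are new in member \<open>i + 1\<close>; the
      image of the difference would lie in member \<open>j\<close>, against the minimality of
      \<open>j = \<sigma> i\<close>.\<close>
    have "\<not> \<sigma> ?j < i"
    proof
      assume lt: "\<sigma> ?j < i"
      obtain w' where w': "w' \<in> ?V (Suc ?j) - ?V ?j" "?s w' \<in> ?V (Suc (\<sigma> ?j))" using As[OF j] by (auto simp: A_def)
      have w'c: "w' \<in> carrier_vec n" using w' Vc[of "Suc ?j"] j by auto
      have sw': "?s w' \<in> ?V i" using w' vspan_mono[OF vg, of "Suc (\<sigma> ?j)" i] lt i by auto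
      obtain c where c: "c \<noteq> 0" "w' - c \<cdot>\<^sub>v ?s v \<in> ?V ?j"
        using vspan_codim[OF vg j, of "?s v" w'] w w' by auto
      let ?u = "v - (1 / c) \<cdot>\<^sub>v ?s w'"
      have x: "(1 / c) \<cdot>\<^sub>v ?s w' \<in> ?V i" using sw' vspan_smult[OF vg, of i] i by auto
      have "?u \<in> ?V (Suc i)"
        using vspan_minus[OF vg, of "Suc i" v] v x vspan_SucI[OF vg, of i] i by auto
      moreover have "?u \<notin> ?V i"
      proof
        assume u: "?u \<in> ?V i"
        have "v = ?u + (1 / c) \<cdot>\<^sub>v ?s w'" using vc by (intro eq_vecI) auto
        then have "v \<in> ?V i" using vspan_add[OF vg _ u x] i by simp
        then show False using v by simp
      qed
      ultimately have "?s ?u \<notin> ?V ?j" using min[OF i] by simp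
      moreover have "?s ?u = (- 1 / c) \<cdot>\<^sub>v (w' - c \<cdot>\<^sub>v ?s v)"
        using vc w'c c(1) by (simp add: sgnv_simps, intro eq_vecI) (auto simp: field_simps)
      moreover have "(- 1 / c) \<cdot>\<^sub>v (w' - c \<cdot>\<^sub>v ?s v) \<in> ?V ?j"
        using c vspan_smult[OF vg, of ?j] j by auto
      ultimately show False by simp
    qed
    then show ?thesis using le by simp
  qed
  obtain v where v: "\<And>i. i < n \<Longrightarrow> v i \<in> ?V (Suc i) - ?V i \<and> ?s (v i) \<in> ?V (Suc (\<sigma> i))"
    using As unfolding A_def by metis
  have sv: "?s (v i) \<in> ?V (Suc (\<sigma> i)) - ?V (\<sigma> i)" if "i < n" for i using v[OF that] min[OF that] by auto
  \<comment> \<open>The vectors \<open>v + s v\<close> and \<open>v - s v\<close> are eigenvectors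
    in member \<open>i + 1\<close>, and half their sum is \<open>v\<close>, so at least one of them
    is new there.\<close>
  have eig: "\<exists>e \<delta>. (\<delta> = 1 \<or> \<delta> = (-1 :: complex)) \<and> e \<in> ?V (Suc i) - ?V i \<and> ?s e = \<delta> \<cdot>\<^sub>v e"
    if i: "i < n" "\<sigma> i = i" for i
  proof -
    have vi: "v i \<in> ?V (Suc i) - ?V i" "?s (v i) \<in> ?V (Suc i)" using v[of i] i by auto
    then have vc: "v i \<in> carrier_vec n" using Vc[of "Suc i"] i by auto
    let ?a = "v i + ?s (v i)" and ?b = "v i - ?s (v i)"
    have ab: "?a \<in> ?V (Suc i)" "?b \<in> ?V (Suc i)"
      using vi vspan_add[OF vg, of "Suc i"] vspan_minus[OF vg, of "Suc i"] i by auto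
    have sa: "?s ?a = 1 \<cdot>\<^sub>v ?a" using vc by (simp add: sgnv_simps, intro eq_vecI) auto
    have sb: "?s ?b = (-1) \<cdot>\<^sub>v ?b" using vc by (simp add: sgnv_simps, intro eq_vecI) auto
    have "v i = (1/2) \<cdot>\<^sub>v (?a + ?b)" using vc by (intro eq_vecI) auto
    then have "\<not> (?a \<in> ?V i \<and> ?b \<in> ?V i)"
      using vspan_smult[OF vg, of i] vspan_add[OF vg, of i] vi i by (metis DiffE less_imp_le)
    then show ?thesis using ab sa sb by blast
  qed
  then obtain e \<delta> where e: "\<And>i. i < n \<Longrightarrow> \<sigma> i = i \<Longrightarrow> (\<delta> i = 1 \<or> \<delta> i = (-1 :: complex)) \<and> e i \<in> ?V (Suc i) - ?V i \<and> ?s (e i) = \<delta> i \<cdot>\<^sub>v e i"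
    by metis
  \<comment> \<open>An arc gets the chosen vector at its smaller end and the image of that vector at
    its larger end.\<close>
  define h where "h i = (if \<sigma> i = i then e i else if i < \<sigma> i then v i else ?s (v (\<sigma> i)))" for i
  define \<epsilon> where "\<epsilon> i = (if \<sigma> i = i then \<delta> i else 1)" for i
  have hV: "h i \<in> ?V (Suc i) - ?V i" if "i < n" for i
    using e[of i] v[of i] sv[of "\<sigma> i"] that inv[of i] \<sigma>n[of i] by (auto simp: h_def)
  have tri: "\<exists>c z. c \<noteq> 0 \<and> z \<in> ?V k \<and> h k = c \<cdot>\<^sub>v g k + z" if "k < n" for k
    using vspan_SucE[OF vg that, of "h k"] hV[OF that] by blast
  have b: "is_basis n h" "flag n h = flag n g"
    using vspan_triangular[OF g tri] by (auto intro!: flag_eqI)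
  have "?s (h k) = \<epsilon> k \<cdot>\<^sub>v h (\<sigma> k)" if k: "k < n" for k
  proof -
    have vc: "v i \<in> carrier_vec n" if "i < n" for i using v[OF that] Vc[of "Suc i"] that by auto
    show ?thesis
      using k inv[of k] \<sigma>n[of k] e[of k] vc[of k] vc[of "\<sigma> k"] by (auto simp: h_def \<epsilon>_def sgnv_simps)
  qed
  then have "adapted p n \<sigma> \<epsilon> h" using b by (simp add: adapted_def)
  moreover have "clan n \<sigma> \<epsilon>" using \<sigma>n inv e by (auto simp: clan_def \<epsilon>_def)
  ultimately show thesis using b that by blast
qed

lemma x_pq_carrier [simp]: "x_pq p q a b \<in> carrier_mat (p + q) (p + q)"
  by (simp add: x_pq_def mat_diag_def)

text \<open>The matrix is an affine function of \<open>s\<close> whose linear coefficient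
  \<open>(a - b) / 2\<close> is nonzero for distinct eigenvalues, so invariance conditions for the
  two are interchangeable.\<close>

lemma x_pq_mult:
  assumes "u \<in> carrier_vec (p + q)"
  shows "x_pq p q a b *\<^sub>v u = ((a + b) / 2) \<cdot>\<^sub>v u + ((a - b) / 2) \<cdot>\<^sub>v sgnv p (p + q) u"
proof (rule eq_vecI)
  fix i assume "i < dim_vec (((a + b) / 2) \<cdot>\<^sub>v u + ((a - b) / 2) \<cdot>\<^sub>v sgnv p (p + q) u)"
  then have i: "i < p + q" using assms by (simp add: sgnv_def)
  have "(x_pq p q a b *\<^sub>v u) $ i = (\<Sum>j\<in>{0..<p + q}. (if i = j then (if j < p then a else b) else 0) * u $ j)"
    using assms i by (auto simp: x_pq_def mat_diag_def scalar_prod_def intro!: sum.cong)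
  also have "\<dots> = (if i < p then a else b) * u $ i" using i by (simp add: if_distrib[of "\<lambda>x. x * _"] cong: if_cong)
  finally show "(x_pq p q a b *\<^sub>v u) $ i = (((a + b) / 2) \<cdot>\<^sub>v u + ((a - b) / 2) \<cdot>\<^sub>v sgnv p (p + q) u) $ i"
    using i assms by (auto simp: sgnv_def field_simps)
qed (use assms in \<open>auto simp: sgnv_def x_pq_def mat_diag_def\<close>)

lemma vspan_mem_iff:
  assumes h: "is_basis n h" and "k < n" "i \<le> n" shows "h k \<in> vspan n h i \<longleftrightarrow> k < i"
proof
  assume "h k \<in> vspan n h i"
  then show "k < i" using vspan_mono[OF is_basisD(1)[OF h], of i k] is_basisD(2)[OF h, of k] assms by (cases "k < i") auto
qed (use vspan_mem[OF is_basisD(1)[OF h]] assms in auto)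

lemma clanD:
  assumes "clan n \<sigma> \<epsilon>" "k < n"
  shows "\<sigma> k < n" "\<sigma> (\<sigma> k) = k" "\<sigma> k \<noteq> k \<Longrightarrow> \<epsilon> k = 1" "\<epsilon> k = 1 \<or> \<epsilon> k = -1" "\<epsilon> k \<noteq> 0"
  using assms unfolding clan_def by force+

text \<open>Modulo a multiple of \<open>h k\<close>, the vector \<open>x h k\<close> is a nonzero
  multiple of \<open>h (\<sigma> k)\<close>, and a basis vector lies in a member of the flag exactly
  when its index does.\<close>

lemma adapted_Hess_iff:
  assumes h: "adapted p (p + q) \<sigma> \<epsilon> h" and c: "clan (p + q) \<sigma> \<epsilon>"
    and ab: "a \<noteq> b" and m: "hessenberg_vector (p + q) m"
  shows "flag (p + q) h \<in> Hess (p + q) (x_pq p q a b) m \<longleftrightarrow> (\<forall>k<p + q. \<sigma> k < m (Suc k))"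
proof -
  let ?n = "p + q"
  have b: "is_basis ?n h" and s: "\<And>k. k < ?n \<Longrightarrow> sgnv p ?n (h k) = \<epsilon> k \<cdot>\<^sub>v h (\<sigma> k)" using h by (auto simp: adapted_def)
  have vh: "vecs ?n h" using b is_basisD by blast
  have "x_pq p q a b *\<^sub>v h k \<in> vspan ?n h (m (Suc k)) \<longleftrightarrow> \<sigma> k < m (Suc k)" if k: "k < ?n" for k
  proof -
    have mk: "m (Suc k) \<le> ?n" "Suc k \<le> m (Suc k)" using m k by (auto simp: hessenberg_vector_def)
    let ?\<alpha> = "(a + b) / 2" and ?\<beta> = "(a - b) / 2 * \<epsilon> k"
    have \<beta>: "?\<beta> \<noteq> 0" using ab clanD(5)[OF c k] by simp
    have hk: "h k \<in> carrier_vec ?n" "h (\<sigma> k) \<in> carrier_vec ?n" using vh k clanD(1)[OF c k] by auto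
    have hm: "?\<alpha> \<cdot>\<^sub>v h k \<in> vspan ?n h (m (Suc k))"
      using vspan_smult[OF vh mk(1)] vspan_mem_iff[OF b k mk(1)] mk by auto
    have x: "x_pq p q a b *\<^sub>v h k = ?\<alpha> \<cdot>\<^sub>v h k + ?\<beta> \<cdot>\<^sub>v h (\<sigma> k)"
      using x_pq_mult[OF hk(1)] s[OF k] by (simp add: smult_smult_assoc)
    have "x_pq p q a b *\<^sub>v h k \<in> vspan ?n h (m (Suc k)) \<longleftrightarrow> h (\<sigma> k) \<in> vspan ?n h (m (Suc k))"
    proof
      assume "x_pq p q a b *\<^sub>v h k \<in> vspan ?n h (m (Suc k))"
      then have "(1 / ?\<beta>) \<cdot>\<^sub>v (x_pq p q a b *\<^sub>v h k - ?\<alpha> \<cdot>\<^sub>v h k) \<in> vspan ?n h (m (Suc k))"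
        using vspan_smult[OF vh mk(1)] vspan_minus[OF vh mk(1) _ hm] by blast
      also have "(1 / ?\<beta>) \<cdot>\<^sub>v (x_pq p q a b *\<^sub>v h k - ?\<alpha> \<cdot>\<^sub>v h k) = h (\<sigma> k)"
        unfolding x using hk \<beta> by (intro eq_vecI) auto
      finally show "h (\<sigma> k) \<in> vspan ?n h (m (Suc k))" .
    next
      assume "h (\<sigma> k) \<in> vspan ?n h (m (Suc k))"
      then show "x_pq p q a b *\<^sub>v h k \<in> vspan ?n h (m (Suc k))"
        unfolding x using vspan_add[OF vh mk(1) hm] vspan_smult[OF vh mk(1)] by blast
    qed
    then show ?thesis using vspan_mem_iff[OF b clanD(1)[OF c k] mk(1)] by simp
  qed
  then show ?thesis using Hess_iff[OF b x_pq_carrier m] by simp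
qed

lemma centralizer_sgnv_iff:
  assumes ab: "a \<noteq> b" and g: "g \<in> carrier_mat (p + q) (p + q)"
  shows "g * x_pq p q a b = x_pq p q a b * g \<longleftrightarrow>
    (\<forall>u\<in>carrier_vec (p + q). g *\<^sub>v sgnv p (p + q) u = sgnv p (p + q) (g *\<^sub>v u))"
proof -
  let ?n = "p + q" and ?x = "x_pq p q a b"
  have 1: "g *\<^sub>v (?x *\<^sub>v u) = ((a + b) / 2) \<cdot>\<^sub>v (g *\<^sub>v u) + ((a - b) / 2) \<cdot>\<^sub>v (g *\<^sub>v sgnv p ?n u)"
    "?x *\<^sub>v (g *\<^sub>v u) = ((a + b) / 2) \<cdot>\<^sub>v (g *\<^sub>v u) + ((a - b) / 2) \<cdot>\<^sub>v sgnv p ?n (g *\<^sub>v u)"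
    if "u \<in> carrier_vec ?n" for u
    using that g x_pq_mult[of u p q a b] x_pq_mult[of "g *\<^sub>v u" p q a b]
    by (simp_all add: mult_add_distrib_mat_vec[OF g] mult_mat_vec[OF g])
  have 2: "g *\<^sub>v (?x *\<^sub>v u) = ?x *\<^sub>v (g *\<^sub>v u) \<longleftrightarrow> g *\<^sub>v sgnv p ?n u = sgnv p ?n (g *\<^sub>v u)"
    if u: "u \<in> carrier_vec ?n" for u
  proof
    assume e: "g *\<^sub>v (?x *\<^sub>v u) = ?x *\<^sub>v (g *\<^sub>v u)"
    have gc: "g *\<^sub>v u \<in> carrier_vec ?n" "g *\<^sub>v sgnv p ?n u \<in> carrier_vec ?n" using g u by (auto intro: mult_mat_vec_carrier)
    show "g *\<^sub>v sgnv p ?n u = sgnv p ?n (g *\<^sub>v u)"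
    proof (rule eq_vecI)
      fix i assume "i < dim_vec (sgnv p ?n (g *\<^sub>v u))"
      then have i: "i < ?n" by (simp add: sgnv_def)
      have "((a - b) / 2) * (g *\<^sub>v sgnv p ?n u) $ i = ((a - b) / 2) * sgnv p ?n (g *\<^sub>v u) $ i"
        using arg_cong[OF e[unfolded 1[OF u]], of "\<lambda>v. v $ i"] i carrier_vecD[OF gc(1)] carrier_vecD[OF gc(2)]
        by (simp del: index_mult_mat_vec dim_mult_mat_vec)
      then show "(g *\<^sub>v sgnv p ?n u) $ i = sgnv p ?n (g *\<^sub>v u) $ i" using ab by simp
    qed (use g in \<open>auto simp: sgnv_def\<close>)
  qed (simp add: 1 u)
  have "g * ?x = ?x * g \<longleftrightarrow> (\<forall>u\<in>carrier_vec ?n. g *\<^sub>v (?x *\<^sub>v u) = ?x *\<^sub>v (g *\<^sub>v u))"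
  proof
    assume "g * ?x = ?x * g"
    then show "\<forall>u\<in>carrier_vec ?n. g *\<^sub>v (?x *\<^sub>v u) = ?x *\<^sub>v (g *\<^sub>v u)"
      using assoc_mult_mat_vec[OF g x_pq_carrier] assoc_mult_mat_vec[OF x_pq_carrier g] by metis
  next
    assume a: "\<forall>u\<in>carrier_vec ?n. g *\<^sub>v (?x *\<^sub>v u) = ?x *\<^sub>v (g *\<^sub>v u)"
    show "g * ?x = ?x * g"
    proof (rule mat_col_eqI)
      fix i assume "i < dim_col (?x * g)"
      then have i: "i < ?n" using g by simp
      have u: "col M i = M *\<^sub>v unit_vec ?n i" if "M \<in> carrier_mat ?n ?n" for M :: "complex mat"
        using mult_unit_vec[OF that i] by simp
      show "col (g * ?x) i = col (?x * g) i"
        using a assoc_mult_mat_vec[OF g x_pq_carrier, of "unit_vec ?n i"] assoc_mult_mat_vec[OF x_pq_carrier g, of "unit_vec ?n i"]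
          u[OF mult_carrier_mat[OF g x_pq_carrier]] u[OF mult_carrier_mat[OF x_pq_carrier g]] by simp
    qed (use g x_pq_carrier[of p q a b] in \<open>auto simp del: x_pq_carrier\<close>)
  qed
  then show ?thesis using 2 by auto
qed

lemma fmat_mult: "g \<in> carrier_mat n n \<Longrightarrow> vecs n h \<Longrightarrow> fmat n (\<lambda>k. g *\<^sub>v h k) = g * fmat n h"
  by (intro eq_matI) (auto simp: fmat_def vecs_def scalar_prod_def intro!: sum.cong)

lemma is_basis_mult:
  assumes "g \<in> GL n" "is_basis n h" shows "is_basis n (\<lambda>k. g *\<^sub>v h k)"
proof -
  have g: "g \<in> carrier_mat n n" "det g \<noteq> 0" using assms by (auto simp: GL_iff_det)
  have "vecs n (\<lambda>k. g *\<^sub>v h k)" using g is_basisD(1)[OF assms(2)] by (auto simp: vecs_def intro: mult_mat_vec_carrier)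
  moreover have "det (fmat n (\<lambda>k. g *\<^sub>v h k)) \<noteq> 0"
    using fmat_mult[OF g(1) is_basisD(1)[OF assms(2)]] basis_det[OF assms(2)] det_mult[OF g(1) fmat_carrier, of h] g by simp
  ultimately show ?thesis using is_basis_iff_det by blast
qed

lemma act_flag_eq:
  assumes g: "g \<in> carrier_mat n n" and h: "vecs n h"
  shows "act_flag n g (flag n h) = flag n (\<lambda>k. g *\<^sub>v h k)"
proof -
  have "(\<lambda>u. g *\<^sub>v u) ` vspan n h i = vspan n (\<lambda>k. g *\<^sub>v h k) i" if "i \<le> n" for i
  proof -
    have v: "vecs n (\<lambda>k. g *\<^sub>v h k)" using g h by (auto simp: vecs_def intro: mult_mat_vec_carrier)
    have "g *\<^sub>v (fmat n h *\<^sub>v y) = fmat n (\<lambda>k. g *\<^sub>v h k) *\<^sub>v y" if "y \<in> carrier_vec n" for y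
      using fmat_mult[OF g h] assoc_mult_mat_vec[OF g fmat_carrier that] by simp
    then show ?thesis unfolding vspan_coords[OF h that] vspan_coords[OF v that] by (auto simp: image_iff) metis+
  qed
  then show ?thesis by (auto simp: act_flag_def flag_def cong: restrict_cong)
qed

lemma adapted_mult:
  assumes "a \<noteq> b" "g \<in> centralizer_GL (p + q) (x_pq p q a b)" "adapted p (p + q) \<sigma> \<epsilon> h" "\<And>k. k < p + q \<Longrightarrow> \<sigma> k < p + q"
  shows "adapted p (p + q) \<sigma> \<epsilon> (\<lambda>k. g *\<^sub>v h k)"
proof -
  let ?n = "p + q"
  have gG: "g \<in> GL ?n" and "g * x_pq p q a b = x_pq p q a b * g" using assms(2) by (auto simp: centralizer_GL_def)
  then have g: "g \<in> carrier_mat ?n ?n" and s: "\<And>u. u\<in>carrier_vec ?n \<Longrightarrow> g *\<^sub>v sgnv p ?n u = sgnv p ?n (g *\<^sub>v u)"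
    using centralizer_sgnv_iff[OF assms(1), of g p q] by (auto simp: GL_def)
  have h: "is_basis ?n h" "\<And>k. k < ?n \<Longrightarrow> sgnv p ?n (h k) = \<epsilon> k \<cdot>\<^sub>v h (\<sigma> k)" using assms(3) by (auto simp: adapted_def)
  have "sgnv p ?n (g *\<^sub>v h k) = \<epsilon> k \<cdot>\<^sub>v (g *\<^sub>v h (\<sigma> k))" if "k < ?n" for k
    using s[of "h k"] h(2)[OF that] vecsD[OF is_basisD(1)[OF h(1)]] that assms(4) mult_mat_vec[OF g] by metis
  then show ?thesis using is_basis_mult[OF gG h(1)] by (simp add: adapted_def)
qed

text \<open>The matrix that carries one adapted basis to the other transports the relations
  \<open>s h_k = \<epsilon>_k h_\<sigma>(k)\<close>, which have the same coefficients on both sides;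
  hence it commutes with \<open>s\<close>. So a clan determines a single orbit.\<close>

lemma adapted_transitive:
  assumes ab: "a \<noteq> b" and h: "adapted p (p + q) \<sigma> \<epsilon> h" and h': "adapted p (p + q) \<sigma> \<epsilon> h'" and \<sigma>: "\<And>k. k < p + q \<Longrightarrow> \<sigma> k < p + q"
  obtains g where "g \<in> centralizer_GL (p + q) (x_pq p q a b)" "\<And>k. k < p + q \<Longrightarrow> h' k = g *\<^sub>v h k"
proof -
  let ?n = "p + q"
  have b: "is_basis ?n h" "is_basis ?n h'" using h h' by (auto simp: adapted_def)
  have v: "vecs ?n h" "vecs ?n h'" using b is_basisD by blast+
  have s: "\<And>k. k < ?n \<Longrightarrow> sgnv p ?n (h k) = \<epsilon> k \<cdot>\<^sub>v h (\<sigma> k)" "\<And>k. k < ?n \<Longrightarrow> sgnv p ?n (h' k) = \<epsilon> k \<cdot>\<^sub>v h' (\<sigma> k)"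
    using h h' by (auto simp: adapted_def)
  obtain B where B: "B \<in> carrier_mat ?n ?n" "fmat ?n h * B = 1\<^sub>m ?n" "B * fmat ?n h = 1\<^sub>m ?n"
    using basis_det[OF b(1)] det_non_zero_imp_unit[of "fmat ?n h" ?n "()"] by (auto simp: Units_def ring_mat_def)
  define g where "g = fmat ?n h' * B"
  have g: "g \<in> carrier_mat ?n ?n" unfolding g_def using mult_carrier_mat[OF fmat_carrier B(1)] .
  have "det (fmat ?n h) * det B = 1" using det_mult[OF fmat_carrier B(1), of h] B by simp
  then have "det g \<noteq> 0" using det_mult[OF fmat_carrier B(1), of h'] basis_det[OF b(2)] by (auto simp: g_def)
  then have gG: "g \<in> GL ?n" using g by (simp add: GL_iff_det)
  have "g * fmat ?n h = fmat ?n h'"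
    unfolding g_def using B assoc_mult_mat[OF fmat_carrier B(1) fmat_carrier, of h' h] right_mult_one_mat[OF fmat_carrier, of ?n h'] by simp
  then have gf: "fmat ?n (\<lambda>k. g *\<^sub>v h k) = fmat ?n h'" using fmat_mult[OF g v(1)] by simp
  have gh: "h' k = g *\<^sub>v h k" if k: "k < ?n" for k
  proof -
    have "vecs ?n (\<lambda>k. g *\<^sub>v h k)" using g v by (auto simp: vecs_def intro: mult_mat_vec_carrier)
    then show ?thesis using col_fmat[of ?n h' k] col_fmat[of ?n "\<lambda>k. g *\<^sub>v h k" k] v k gf by simp
  qed
  \<comment> \<open>The vectors on which \<open>g\<close> and \<open>s\<close> commute form a
    subspace; it contains the basis \<open>h\<close>, hence everything.\<close>
  let ?S = "{u \<in> carrier_vec ?n. g *\<^sub>v sgnv p ?n u = sgnv p ?n (g *\<^sub>v u)}"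
  have gc: "g *\<^sub>v u \<in> carrier_vec ?n" if "u \<in> carrier_vec ?n" for u using g that by (rule mult_mat_vec_carrier)
  have "vspan ?n h ?n \<subseteq> ?S"
  proof (rule vspan_least)
    have "sgnv p ?n (0\<^sub>v ?n) = 0\<^sub>v ?n" by (intro eq_vecI) (auto simp: sgnv_def)
    moreover have "g *\<^sub>v 0\<^sub>v ?n = 0\<^sub>v ?n" using g by (intro eq_vecI) auto
    ultimately show "0\<^sub>v ?n \<in> ?S" by simp
    show "u + w \<in> ?S" if "u \<in> ?S" "w \<in> ?S" for u w
      using that gc by (simp add: sgnv_simps mult_add_distrib_mat_vec[OF g])
    show "c \<cdot>\<^sub>v u \<in> ?S" if "u \<in> ?S" for c u
      using that gc by (simp add: sgnv_simps mult_mat_vec[OF g])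
    show "h k \<in> ?S" if k: "k < ?n" for k
    proof -
      have "g *\<^sub>v sgnv p ?n (h k) = \<epsilon> k \<cdot>\<^sub>v (g *\<^sub>v h (\<sigma> k))"
        using s(1)[OF k] mult_mat_vec[OF g, of "h (\<sigma> k)"] v \<sigma>[OF k] by simp
      also have "\<dots> = sgnv p ?n (g *\<^sub>v h k)" using s(2)[OF k] gh[OF k] gh[OF \<sigma>[OF k]] by simp
      finally show ?thesis using v k by simp
    qed
  qed
  then have "\<forall>u\<in>carrier_vec ?n. g *\<^sub>v sgnv p ?n u = sgnv p ?n (g *\<^sub>v u)" using vspan_full[OF b(1)] by auto
  then have "g \<in> centralizer_GL ?n (x_pq p q a b)"
    using centralizer_sgnv_iff[OF ab g] gG by (simp add: centralizer_GL_def)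
  then show thesis using gh that by blast
qed

definition clan_orbit :: "nat \<Rightarrow> nat \<Rightarrow> (nat \<Rightarrow> nat) \<Rightarrow> (nat \<Rightarrow> complex) \<Rightarrow> (nat \<Rightarrow> complex vec set) set" where
  "clan_orbit p n \<sigma> \<epsilon> = flag n ` {h. adapted p n \<sigma> \<epsilon> h}"

lemma orbit_eq_clan_orbit:
  assumes ab: "a \<noteq> b" and h: "adapted p (p + q) \<sigma> \<epsilon> h" and \<sigma>: "\<And>k. k < p + q \<Longrightarrow> \<sigma> k < p + q"
  shows "(\<lambda>g. act_flag (p + q) g (flag (p + q) h)) ` centralizer_GL (p + q) (x_pq p q a b) = clan_orbit p (p + q) \<sigma> \<epsilon>"
    (is "?f ` ?K = _")
proof (intro equalityI subsetI)
  have vh: "vecs (p + q) h" using h by (auto simp: adapted_def is_basis_def)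
  have act: "?f g = flag (p + q) (\<lambda>k. g *\<^sub>v h k)" if "g \<in> ?K" for g
    using act_flag_eq[OF _ vh] that by (auto simp: centralizer_GL_def GL_def)
  fix V
  { assume "V \<in> ?f ` ?K"
    then show "V \<in> clan_orbit p (p + q) \<sigma> \<epsilon>"
      using adapted_mult[OF ab _ h \<sigma>] act by (auto simp: clan_orbit_def) }
  { assume "V \<in> clan_orbit p (p + q) \<sigma> \<epsilon>"
    then obtain h' where h': "adapted p (p + q) \<sigma> \<epsilon> h'" "V = flag (p + q) h'" by (auto simp: clan_orbit_def)
    then obtain g where g: "g \<in> ?K" "\<And>k. k < p + q \<Longrightarrow> h' k = g *\<^sub>v h k"
      using adapted_transitive[OF ab h h'(1) \<sigma>] by blast
    have "flag (p + q) h' = flag (p + q) (\<lambda>k. g *\<^sub>v h k)"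
      by (intro flag_eqI vspan_cong) (use g in auto)
    then have "V = ?f g" using act[OF g(1)] h' by simp
    then show "V \<in> ?f ` ?K" using g(1) by (rule image_eqI) }
qed

section \<open>Degenerations between orbits\<close>

lemma clan_orbit_flags: "clan_orbit p n \<sigma> \<epsilon> \<subseteq> flags n"
  by (auto simp: clan_orbit_def adapted_def flag_in_flags)

lemma is_basis_addcol:
  assumes h: "is_basis n h" and i: "i < n" "c < n" "i \<noteq> c"
  shows "is_basis n (h(i := h i + t \<cdot>\<^sub>v h c))"
proof -
  have vh: "vecs n h" using h is_basisD by blast
  have v: "vecs n (h(i := h i + t \<cdot>\<^sub>v h c))" using vh i by (auto simp: vecs_def)
  have hc: "h i \<in> carrier_vec n" "h c \<in> carrier_vec n" using vh i by auto
  have "fmat n (h(i := h i + t \<cdot>\<^sub>v h c)) = addcol t i c (fmat n h)"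
    using hc i by (intro eq_matI) (auto simp: fmat_def)
  then have "det (fmat n (h(i := h i + t \<cdot>\<^sub>v h c))) = det (fmat n h)"
    using det_addcol[OF i(2) i(3) fmat_carrier, of t h] by simp
  then show ?thesis using basis_det[OF h] is_basis_iff_det[OF v] by simp
qed

text \<open>Common frame of the moves. The curve is a column operation on \<open>h1\<close>, a
  second basis of the given flag, so it is a basis for every \<open>t\<close>. The vectors
  \<open>h' t\<close> are adapted to the new clan and span the same flag for
  \<open>t \<noteq> 0\<close>; they may become dependent at \<open>t = 0\<close>, which is why two
  families are kept apart.\<close>

lemma addcol_limit:
  assumes h: "is_basis n h"
    and h1: "\<And>k. k < n \<Longrightarrow> \<exists>d z. d \<noteq> 0 \<and> z \<in> vspan n h k \<and> h1 k = d \<cdot>\<^sub>v h k + z"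
    and i: "i < n" "c < n" "i \<noteq> c"
    and tri: "\<And>t k. t \<noteq> 0 \<Longrightarrow> k < n \<Longrightarrow>
       \<exists>d z. d \<noteq> 0 \<and> z \<in> vspan n (h1(i := h1 i + t \<cdot>\<^sub>v h1 c)) k \<and> h' t k = d \<cdot>\<^sub>v (h1(i := h1 i + t \<cdot>\<^sub>v h1 c)) k + z"
    and s: "\<And>t k. t \<noteq> 0 \<Longrightarrow> k < n \<Longrightarrow> sgnv p n (h' t k) = \<epsilon>' k \<cdot>\<^sub>v h' t (\<sigma>' k)"
  shows "flag n h \<in> zariski_flags n closure_of clan_orbit p n \<sigma>' \<epsilon>'"
proof -
  define \<gamma> where "\<gamma> t = h1(i := h1 i + t \<cdot>\<^sub>v h1 c)" for t
  have b1: "is_basis n h1" and f1: "flag n h1 = flag n h"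
    using vspan_triangular[OF h h1] by (auto intro!: flag_eqI)
  have v1: "vecs n h1" using b1 is_basisD by blast
  have b: "is_basis n (\<gamma> t)" for t unfolding \<gamma>_def using is_basis_addcol[OF b1 i] .
  have "flag n (\<gamma> 0) \<in> zariski_flags n closure_of clan_orbit p n \<sigma>' \<epsilon>'"
  proof (rule flag_limit)
    fix r k assume rk: "r < n" "k < n"
    have "h1 i \<in> carrier_vec n" "h1 c \<in> carrier_vec n" using v1 i by auto
    then have "\<gamma> t k $ r = poly (if k = i then [:h1 i $ r, h1 c $ r:] else [:h1 k $ r:]) t" for t
      using rk by (auto simp: \<gamma>_def)
    then show "\<exists>P. \<forall>t. \<gamma> t k $ r = poly P t" by blast
  next
    show "is_basis n (\<gamma> 0)" by (rule b)
    fix t :: complex assume t: "t \<noteq> 0"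
    have "is_basis n (h' t)" "flag n (h' t) = flag n (\<gamma> t)"
      using vspan_triangular[OF b, of t "h' t"] tri[OF t] by (auto intro!: flag_eqI simp: \<gamma>_def)
    then show "is_basis n (\<gamma> t) \<and> flag n (\<gamma> t) \<in> clan_orbit p n \<sigma>' \<epsilon>'"
      using b s[OF t] by (auto simp: clan_orbit_def adapted_def intro!: image_eqI[of _ _ "h' t"])
  qed (rule clan_orbit_flags)
  moreover have "flag n (\<gamma> 0) = flag n h1"
  proof (intro flag_eqI vspan_cong)
    fix j k assume "j \<le> n" "k < j"
    then have "h1 k \<in> carrier_vec n" "h1 c \<in> carrier_vec n" using v1 i by auto
    then show "\<gamma> 0 k = h1 k" by (auto simp: \<gamma>_def intro!: eq_vecI)
  qed
  ultimately show ?thesis using f1 by simp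
qed

lemma triangular_id:
  assumes "v = g k" "vecs n g" "k < n"
  shows "\<exists>d z. d \<noteq> 0 \<and> z \<in> vspan n g k \<and> v = d \<cdot>\<^sub>v g k + z"
proof -
  have "v = 1 \<cdot>\<^sub>v g k + 0\<^sub>v n" using assms by (intro eq_vecI) (auto simp: vecs_def)
  moreover have "0\<^sub>v n \<in> vspan n g k" using assms by (intro vspan_zero) auto
  ultimately show ?thesis using one_neq_zero by blast
qed

lemma triangular_lincomb:
  assumes "v = d \<cdot>\<^sub>v g k + c \<cdot>\<^sub>v g i" "vecs n g" "k < n" "i < k" "d \<noteq> 0"
  shows "\<exists>d z. d \<noteq> 0 \<and> z \<in> vspan n g k \<and> v = d \<cdot>\<^sub>v g k + z"
proof -
  have "c \<cdot>\<^sub>v g i \<in> vspan n g k" using assms vspan_smult vspan_mem less_imp_le by meson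
  then show ?thesis using assms by blast
qed

lemma triangular_lincomb2:
  assumes "v = d \<cdot>\<^sub>v g k + (c \<cdot>\<^sub>v g i + b \<cdot>\<^sub>v g j)" "vecs n g" "k < n" "i < k" "j < k" "d \<noteq> 0"
  shows "\<exists>d z. d \<noteq> 0 \<and> z \<in> vspan n g k \<and> v = d \<cdot>\<^sub>v g k + z"
proof -
  have "c \<cdot>\<^sub>v g i + b \<cdot>\<^sub>v g j \<in> vspan n g k" using assms vspan_add vspan_smult vspan_mem less_imp_le by meson
  then show ?thesis using assms by blast
qed

section \<open>Five elementary moves on clans, each realizing an orbit in the closure of
  another\<close>

context
  fixes p n \<sigma> \<epsilon> h
  assumes c: "clan n \<sigma> \<epsilon>" and h: "adapted p n \<sigma> \<epsilon> h"
begin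

lemma basis_h: "is_basis n h" and vecs_h: "vecs n h" and carrier_h: "k < n \<Longrightarrow> h k \<in> carrier_vec n"
  and sgnv_h: "k < n \<Longrightarrow> sgnv p n (h k) = \<epsilon> k \<cdot>\<^sub>v h (\<sigma> k)"
  using h by (auto simp: adapted_def is_basis_def)

lemma vecs_addcol: "i < n \<Longrightarrow> j < n \<Longrightarrow> vecs n (h(i := h i + t \<cdot>\<^sub>v h j))"
  using carrier_h by (auto simp: vecs_def)

lemma inv_eq: "k < n \<Longrightarrow> i < n \<Longrightarrow> \<sigma> k = i \<longleftrightarrow> k = \<sigma> i"
  using clanD[OF c] by metis

text \<open>Two opposite signs merge into an arc: a vector \<open>h i + t h j\<close> with
  \<open>t \<noteq> 0\<close> in the plane of two eigenvectors of opposite sign spans this plane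
  together with its image.\<close>

lemma move_sign_sign:
  assumes ij: "i < j" "j < n" "\<sigma> i = i" "\<sigma> j = j" "\<epsilon> i \<noteq> \<epsilon> j"
  shows "flag n h \<in> zariski_flags n closure_of clan_orbit p n (\<sigma>(i := j, j := i)) (\<epsilon>(i := 1, j := 1))"
proof -
  have i: "i < n" using ij by simp
  have \<epsilon>j: "\<epsilon> j = - \<epsilon> i" "\<epsilon> i \<noteq> 0" using clanD(4)[OF c i] clanD(4)[OF c ij(2)] ij by auto
  have car: "h i \<in> carrier_vec n" "h j \<in> carrier_vec n" using carrier_h i ij by auto
  define h' where "h' t = h(i := h i + t \<cdot>\<^sub>v h j, j := \<epsilon> i \<cdot>\<^sub>v h i + (- \<epsilon> i * t) \<cdot>\<^sub>v h j)" for t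
  show ?thesis
  proof (rule addcol_limit[OF basis_h, where h' = h' and i = i and c = j and ?h1.0 = h])
    fix k assume k: "k < n"
    show "\<exists>d z. d \<noteq> 0 \<and> z \<in> vspan n h k \<and> h k = d \<cdot>\<^sub>v h k + z"
      by (rule triangular_id[OF refl vecs_h k])
    fix t :: complex assume t: "t \<noteq> 0"
    let ?g = "h(i := h i + t \<cdot>\<^sub>v h j)"
    show "\<exists>d z. d \<noteq> 0 \<and> z \<in> vspan n ?g k \<and> h' t k = d \<cdot>\<^sub>v ?g k + z"
    proof (cases "k = j")
      case True
      have "h' t k = (- 2 * t * \<epsilon> i) \<cdot>\<^sub>v ?g k + \<epsilon> i \<cdot>\<^sub>v ?g i"
        using True ij car by (auto simp: h'_def field_simps intro!: eq_vecI)
      then show ?thesis by (rule triangular_lincomb[OF _ vecs_addcol[OF i ij(2)] k]) (use True ij t \<epsilon>j in auto)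
    qed (intro triangular_id[OF _ vecs_addcol[OF i ij(2)] k], auto simp: h'_def)
    show "sgnv p n (h' t k) = (\<epsilon>(i := 1, j := 1)) k \<cdot>\<^sub>v h' t ((\<sigma>(i := j, j := i)) k)"
      using ij \<epsilon>j car sgnv_h[OF i] sgnv_h[OF ij(2)] sgnv_h[OF k] inv_eq[OF k i] inv_eq[OF k ij(2)] clanD(4)[OF c i]
      by (auto simp: h'_def sgnv_simps intro!: eq_vecI)
  qed (use ij i in auto)
qed

text \<open>An arc \<open>k\<close>-\<open>i\<close> with a sign at \<open>j\<close> to its right:
  the arc reaches out to \<open>j\<close>, and the sign drops to \<open>i\<close>. The image of
  \<open>h k + t h j\<close> has a component along \<open>h j\<close> and becomes the partner at
  \<open>j\<close>.\<close>

lemma move_pair_sign: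
  assumes ij: "k < i" "i < j" "j < n" "\<sigma> k = i" "\<sigma> j = j"
  shows "flag n h \<in> zariski_flags n closure_of clan_orbit p n (\<sigma>(k := j, j := k, i := i)) (\<epsilon>(j := 1, i := \<epsilon> j))"
proof -
  have kn: "k < n" and i: "i < n" using ij by auto
  have \<sigma>i: "\<sigma> i = k" using inv_eq[OF kn i] ij by simp
  have e1: "\<epsilon> k = 1" "\<epsilon> i = 1" using clanD(3)[OF c kn] clanD(3)[OF c i] ij \<sigma>i by auto
  have \<epsilon>j: "\<epsilon> j = 1 \<or> \<epsilon> j = -1" using clanD(4)[OF c ij(3)] .
  have car: "h i \<in> carrier_vec n" "h j \<in> carrier_vec n" "h k \<in> carrier_vec n" using carrier_h i kn ij by auto
  \<comment> \<open>\<open>\<epsilon> j h i + h k\<close> is an eigenvector with the sign of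
    \<open>j\<close>. As \<open>k < i\<close>, placing it at \<open>i\<close> keeps the flag, so
    that position \<open>i\<close> already carries the sign that the new clan demands there.\<close>
  define h1 where "h1 = h(i := \<epsilon> j \<cdot>\<^sub>v h i + h k)"
  define h' where "h' t = h(i := \<epsilon> j \<cdot>\<^sub>v h i + h k, k := h k + t \<cdot>\<^sub>v h j, j := h i + (t * \<epsilon> j) \<cdot>\<^sub>v h j)" for t
  show ?thesis
  proof (rule addcol_limit[OF basis_h, where h' = h' and i = k and c = j and ?h1.0 = h1])
    fix r assume r: "r < n"
    show "\<exists>d z. d \<noteq> 0 \<and> z \<in> vspan n h r \<and> h1 r = d \<cdot>\<^sub>v h r + z"
    proof (cases "r = i")
      case True
      have "h1 r = \<epsilon> j \<cdot>\<^sub>v h r + 1 \<cdot>\<^sub>v h k" using True car by (auto simp: h1_def)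
      then show ?thesis by (rule triangular_lincomb[OF _ vecs_h r]) (use True ij \<epsilon>j in auto)
    qed (intro triangular_id[OF _ vecs_h r], auto simp: h1_def)
    fix t :: complex assume t: "t \<noteq> 0"
    let ?g = "h1(k := h1 k + t \<cdot>\<^sub>v h1 j)"
    have vg: "vecs n ?g" using carrier_h car by (auto simp: vecs_def h1_def)
    show "\<exists>d z. d \<noteq> 0 \<and> z \<in> vspan n ?g r \<and> h' t r = d \<cdot>\<^sub>v ?g r + z"
    proof (cases "r = j")
      case True
      have "h' t r = (2 * \<epsilon> j * t) \<cdot>\<^sub>v ?g r + (\<epsilon> j \<cdot>\<^sub>v ?g i + (- \<epsilon> j) \<cdot>\<^sub>v ?g k)"
        using True ij car \<epsilon>j by (auto simp: h'_def h1_def field_simps intro!: eq_vecI)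
      then show ?thesis by (rule triangular_lincomb2[OF _ vg r]) (use True ij t \<epsilon>j in auto)
    qed (intro triangular_id[OF _ vg r], use ij in \<open>auto simp: h'_def h1_def\<close>)
    show "sgnv p n (h' t r) = (\<epsilon>(j := 1, i := \<epsilon> j)) r \<cdot>\<^sub>v h' t ((\<sigma>(k := j, j := k, i := i)) r)"
      using ij \<epsilon>j e1 \<sigma>i car sgnv_h[OF i] sgnv_h[OF ij(3)] sgnv_h[OF r] sgnv_h[OF kn] inv_eq[OF r i] inv_eq[OF r ij(3)] inv_eq[OF r kn]
      by (auto simp: h'_def sgnv_simps intro!: eq_vecI)
  qed (use ij i in auto)
qed

text \<open>Mirror image of \<open>move_pair_sign\<close>: a sign at \<open>i\<close> to the left of
  an arc \<open>j\<close>-\<open>k\<close>. The eigenvector \<open>h i\<close> moves to position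
  \<open>j\<close>, and \<open>h i + t h j\<close> takes its place as the left end of an arc to
  \<open>k\<close>.\<close>

lemma move_sign_pair:
  assumes ij: "i < j" "j < k" "k < n" "\<sigma> i = i" "\<sigma> j = k"
  shows "flag n h \<in> zariski_flags n closure_of clan_orbit p n (\<sigma>(i := k, k := i, j := j)) (\<epsilon>(i := 1, j := \<epsilon> i))"
proof -
  have i: "i < n" and j: "j < n" using ij by auto
  have \<sigma>k: "\<sigma> k = j" using inv_eq[OF j ij(3)] ij by simp
  have e1: "\<epsilon> k = 1" "\<epsilon> j = 1" using clanD(3)[OF c ij(3)] clanD(3)[OF c j] ij \<sigma>k by auto
  have \<epsilon>i: "\<epsilon> i = 1 \<or> \<epsilon> i = -1" using clanD(4)[OF c i] .
  have car: "h i \<in> carrier_vec n" "h j \<in> carrier_vec n" "h k \<in> carrier_vec n" using carrier_h i j ij by auto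
  define h' where "h' t = h(i := h i + t \<cdot>\<^sub>v h j, j := h i, k := \<epsilon> i \<cdot>\<^sub>v h i + t \<cdot>\<^sub>v h k)" for t
  show ?thesis
  proof (rule addcol_limit[OF basis_h, where h' = h' and i = i and c = j and ?h1.0 = h])
    fix r assume r: "r < n"
    show "\<exists>d z. d \<noteq> 0 \<and> z \<in> vspan n h r \<and> h r = d \<cdot>\<^sub>v h r + z"
      by (rule triangular_id[OF refl vecs_h r])
    fix t :: complex assume t: "t \<noteq> 0"
    let ?g = "h(i := h i + t \<cdot>\<^sub>v h j)"
    have vg: "vecs n ?g" using vecs_addcol[OF i j] .
    show "\<exists>d z. d \<noteq> 0 \<and> z \<in> vspan n ?g r \<and> h' t r = d \<cdot>\<^sub>v ?g r + z"
    proof -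
      consider "r = j" | "r = k" | "r \<noteq> j" "r \<noteq> k" by blast
      then show ?thesis
      proof cases
        case 1
        have "h' t r = (- t) \<cdot>\<^sub>v ?g r + 1 \<cdot>\<^sub>v ?g i"
          using 1 ij car by (auto simp: h'_def field_simps intro!: eq_vecI)
        then show ?thesis by (rule triangular_lincomb[OF _ vg r]) (use 1 ij t in auto)
      next
        case 2
        have "h' t r = t \<cdot>\<^sub>v ?g r + (\<epsilon> i \<cdot>\<^sub>v ?g i + (- \<epsilon> i * t) \<cdot>\<^sub>v ?g j)"
          using 2 ij car by (auto simp: h'_def field_simps intro!: eq_vecI)
        then show ?thesis by (rule triangular_lincomb2[OF _ vg r]) (use 2 ij t in auto)
      next
        case 3
        then show ?thesis by (intro triangular_id[OF _ vg r]) (auto simp: h'_def)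
      qed
    qed
    show "sgnv p n (h' t r) = (\<epsilon>(i := 1, j := \<epsilon> i)) r \<cdot>\<^sub>v h' t ((\<sigma>(i := k, k := i, j := j)) r)"
      using ij \<epsilon>i e1 \<sigma>k car sgnv_h[OF i] sgnv_h[OF ij(3)] sgnv_h[OF r] sgnv_h[OF j] inv_eq[OF r i] inv_eq[OF r ij(3)] inv_eq[OF r j]
      by (auto simp: h'_def sgnv_simps intro!: eq_vecI)
  qed (use ij i in auto)
qed

text \<open>Two arcs side by side, \<open>k\<close>-\<open>i\<close> and
  \<open>j\<close>-\<open>l\<close>, become crossing arcs \<open>k\<close>-\<open>j\<close> and
  \<open>i\<close>-\<open>l\<close>: the image of \<open>h k + t h l\<close> is
  \<open>h i + t h j\<close>, and the old pair \<open>h i\<close>, \<open>h k\<close> is left for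
  the positions \<open>i\<close> and \<open>l\<close>.\<close>

lemma move_pair_pair:
  assumes ij: "k < i" "i < j" "j < l" "l < n" "\<sigma> k = i" "\<sigma> j = l"
  shows "flag n h \<in> zariski_flags n closure_of clan_orbit p n (\<sigma>(k := j, j := k, i := l, l := i)) \<epsilon>"
proof -
  have i: "i < n" and j: "j < n" and k: "k < n" using ij by auto
  have \<sigma>i: "\<sigma> i = k" "\<sigma> l = j" using inv_eq[OF k i] inv_eq[OF j ij(4)] ij by auto
  have e1: "\<epsilon> k = 1" "\<epsilon> j = 1" "\<epsilon> i = 1" "\<epsilon> l = 1" using clanD(3)[OF c] i j k \<sigma>i ij by auto
  have car: "h i \<in> carrier_vec n" "h j \<in> carrier_vec n" "h k \<in> carrier_vec n" "h l \<in> carrier_vec n" using carrier_h i j k ij by auto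
  define h' where "h' t = h(k := h k + t \<cdot>\<^sub>v h l, j := h i + t \<cdot>\<^sub>v h j, l := h k)" for t
  show ?thesis
  proof (rule addcol_limit[OF basis_h, where h' = h' and i = k and c = l and ?h1.0 = h])
    fix r assume r: "r < n"
    show "\<exists>d z. d \<noteq> 0 \<and> z \<in> vspan n h r \<and> h r = d \<cdot>\<^sub>v h r + z"
      by (rule triangular_id[OF refl vecs_h r])
    fix t :: complex assume t: "t \<noteq> 0"
    let ?g = "h(k := h k + t \<cdot>\<^sub>v h l)"
    have vg: "vecs n ?g" using vecs_addcol[OF k ij(4)] .
    show "\<exists>d z. d \<noteq> 0 \<and> z \<in> vspan n ?g r \<and> h' t r = d \<cdot>\<^sub>v ?g r + z"
    proof -
      consider "r = j" | "r = l" | "r \<noteq> j" "r \<noteq> l" by blast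
      then show ?thesis
      proof cases
        case 1
        have "h' t r = t \<cdot>\<^sub>v ?g r + 1 \<cdot>\<^sub>v ?g i"
          using 1 ij car by (auto simp: h'_def field_simps intro!: eq_vecI)
        then show ?thesis by (rule triangular_lincomb[OF _ vg r]) (use 1 ij t in auto)
      next
        case 2
        have "h' t r = (- t) \<cdot>\<^sub>v ?g r + 1 \<cdot>\<^sub>v ?g k"
          using 2 ij car by (auto simp: h'_def field_simps intro!: eq_vecI)
        then show ?thesis by (rule triangular_lincomb[OF _ vg r]) (use 2 ij t in auto)
      next
        case 3
        then show ?thesis by (intro triangular_id[OF _ vg r]) (auto simp: h'_def)
      qed
    qed
    show "sgnv p n (h' t r) = \<epsilon> r \<cdot>\<^sub>v h' t ((\<sigma>(k := j, j := k, i := l, l := i)) r)"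
      using ij e1 \<sigma>i car sgnv_h[OF i] sgnv_h[OF ij(4)] sgnv_h[OF r] sgnv_h[OF j] sgnv_h[OF k]
        inv_eq[OF r i] inv_eq[OF r ij(4)] inv_eq[OF r j] inv_eq[OF r k]
      by (auto simp: h'_def sgnv_simps intro!: eq_vecI)
  qed (use ij i in auto)
qed

text \<open>Crossing arcs \<open>k\<close>-\<open>i\<close> and \<open>j\<close>-\<open>x\<close>
  become nested arcs \<open>k\<close>-\<open>x\<close> and \<open>j\<close>-\<open>i\<close>: the
  image of \<open>h k + t h j\<close> is \<open>h i + t h x\<close>, and the old pair
  \<open>h k\<close>, \<open>h i\<close> is left for the positions \<open>j\<close> and
  \<open>i\<close>.\<close>

lemma move_crossing:
  assumes ij: "k < j" "j < i" "i < x" "x < n" "\<sigma> k = i" "\<sigma> j = x"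
  shows "flag n h \<in> zariski_flags n closure_of clan_orbit p n (\<sigma>(k := x, x := k, j := i, i := j)) \<epsilon>"
proof -
  have i: "i < n" and j: "j < n" and k: "k < n" using ij by auto
  have \<sigma>i: "\<sigma> i = k" "\<sigma> x = j" using inv_eq[OF k i] inv_eq[OF j ij(4)] ij by auto
  have e1: "\<epsilon> k = 1" "\<epsilon> j = 1" "\<epsilon> i = 1" "\<epsilon> x = 1" using clanD(3)[OF c] i j k \<sigma>i ij by auto
  have car: "h i \<in> carrier_vec n" "h j \<in> carrier_vec n" "h k \<in> carrier_vec n" "h x \<in> carrier_vec n" using carrier_h i j k ij by auto
  define h' where "h' t = h(k := h k + t \<cdot>\<^sub>v h j, j := h k, x := h i + t \<cdot>\<^sub>v h x)" for t
  show ?thesis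
  proof (rule addcol_limit[OF basis_h, where h' = h' and i = k and c = j and ?h1.0 = h])
    fix r assume r: "r < n"
    show "\<exists>d z. d \<noteq> 0 \<and> z \<in> vspan n h r \<and> h r = d \<cdot>\<^sub>v h r + z"
      by (rule triangular_id[OF refl vecs_h r])
    fix t :: complex assume t: "t \<noteq> 0"
    let ?g = "h(k := h k + t \<cdot>\<^sub>v h j)"
    have vg: "vecs n ?g" using vecs_addcol[OF k j] .
    show "\<exists>d z. d \<noteq> 0 \<and> z \<in> vspan n ?g r \<and> h' t r = d \<cdot>\<^sub>v ?g r + z"
    proof -
      consider "r = j" | "r = x" | "r \<noteq> j" "r \<noteq> x" by blast
      then show ?thesis
      proof cases
        case 1
        have "h' t r = (- t) \<cdot>\<^sub>v ?g r + 1 \<cdot>\<^sub>v ?g k"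
          using 1 ij car by (auto simp: h'_def field_simps intro!: eq_vecI)
        then show ?thesis by (rule triangular_lincomb[OF _ vg r]) (use 1 ij t in auto)
      next
        case 2
        have "h' t r = t \<cdot>\<^sub>v ?g r + 1 \<cdot>\<^sub>v ?g i"
          using 2 ij car by (auto simp: h'_def field_simps intro!: eq_vecI)
        then show ?thesis by (rule triangular_lincomb[OF _ vg r]) (use 2 ij t in auto)
      next
        case 3
        then show ?thesis by (intro triangular_id[OF _ vg r]) (auto simp: h'_def)
      qed
    qed
    show "sgnv p n (h' t r) = \<epsilon> r \<cdot>\<^sub>v h' t ((\<sigma>(k := x, x := k, j := i, i := j)) r)"
      using ij e1 \<sigma>i car sgnv_h[OF i] sgnv_h[OF ij(4)] sgnv_h[OF r] sgnv_h[OF j] sgnv_h[OF k]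
        inv_eq[OF r i] inv_eq[OF r ij(4)] inv_eq[OF r j] inv_eq[OF r k]
      by (auto simp: h'_def sgnv_simps intro!: eq_vecI)
  qed (use ij i in auto)
qed

end

section \<open>Maximal clans below a Hessenberg bound\<close>

lemma trace_mult_commute:
  fixes A B :: "'a :: comm_ring_1 mat"
  assumes "A \<in> carrier_mat n n" "B \<in> carrier_mat n n"
  shows "(\<Sum>i<n. (A * B) $$ (i, i)) = (\<Sum>i<n. (B * A) $$ (i, i))"
proof -
  have "(\<Sum>i<n. (A * B) $$ (i, i)) = (\<Sum>i<n. \<Sum>j<n. A $$ (i, j) * B $$ (j, i))"
    by (rule sum.cong[OF refl]) (use assms in \<open>simp add: scalar_prod_def atLeast0LessThan\<close>)
  also have "\<dots> = (\<Sum>j<n. \<Sum>i<n. B $$ (j, i) * A $$ (i, j))"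
    by (subst sum.swap) (simp add: mult.commute)
  also have "\<dots> = (\<Sum>i<n. (B * A) $$ (i, i))"
    by (rule sum.cong[OF refl]) (use assms in \<open>simp add: scalar_prod_def atLeast0LessThan\<close>)
  finally show ?thesis .
qed

text \<open>Trace of \<open>s\<close> computed in an adapted basis: arcs contribute only off the
  diagonal, fixed points contribute their sign. The local \<open>M\<close> is the matrix of
  \<open>s\<close> in this basis, and \<open>s\<close> itself is
  \<open>x_pq p q 1 (-1)\<close>.\<close>

lemma adapted_trace:
  assumes h: "adapted p (p + q) \<sigma> \<epsilon> h" and \<sigma>: "\<And>k. k < p + q \<Longrightarrow> \<sigma> k < p + q"
  shows "(\<Sum>k | k < p + q \<and> \<sigma> k = k. \<epsilon> k) = of_nat p - of_nat q"
proof -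
  let ?n = "p + q" and ?H = "fmat (p + q) h" and ?x = "x_pq p q 1 (-1)"
  define M where "M = mat ?n ?n (\<lambda>(i, k). if i = \<sigma> k then \<epsilon> k else 0)"
  have M: "M \<in> carrier_mat ?n ?n" by (simp add: M_def)
  have b: "is_basis ?n h" using h by (simp add: adapted_def)
  have v: "vecs ?n h" using b is_basisD by blast
  obtain B where B: "B \<in> carrier_mat ?n ?n" "?H * B = 1\<^sub>m ?n" "B * ?H = 1\<^sub>m ?n"
    using basis_det[OF b] det_non_zero_imp_unit[of ?H ?n "()"] by (auto simp: Units_def ring_mat_def)
  have "?x * ?H = ?H * M"
  proof (rule mat_col_eqI)
    fix k assume "k < dim_col (?H * M)"
    then have k: "k < ?n" by (simp add: M_def)
    have hk: "h k \<in> carrier_vec ?n" "h (\<sigma> k) \<in> carrier_vec ?n" using v k \<sigma> by auto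
    have "col (?x * ?H) k = ?x *\<^sub>v h k"
      using col_mult2[OF x_pq_carrier fmat_carrier k] col_fmat[OF v k] by simp
    also have "\<dots> = sgnv p ?n (h k)" using x_pq_mult[OF hk(1), of 1 "-1"] hk by (auto intro!: eq_vecI)
    also have "\<dots> = \<epsilon> k \<cdot>\<^sub>v h (\<sigma> k)" using h k by (simp add: adapted_def)
    also have "\<dots> = ?H *\<^sub>v (\<epsilon> k \<cdot>\<^sub>v unit_vec ?n (\<sigma> k))"
      using mult_unit_vec[OF fmat_carrier \<sigma>[OF k], of h] col_fmat[OF v \<sigma>[OF k]]
        mult_mat_vec[OF fmat_carrier, of "unit_vec ?n (\<sigma> k)" ?n h "\<epsilon> k"] by simp
    also have "\<epsilon> k \<cdot>\<^sub>v unit_vec ?n (\<sigma> k) = col M k" using k \<sigma>[OF k] by (intro eq_vecI) (auto simp: M_def)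
    also have "?H *\<^sub>v col M k = col (?H * M) k" using col_mult2[OF fmat_carrier M k] by simp
    finally show "col (?x * ?H) k = col (?H * M) k" .
  qed (auto simp: x_pq_def mat_diag_def M_def fmat_def)
  then have "?x = ?H * (M * B)"
    using B assoc_mult_mat[OF x_pq_carrier fmat_carrier B(1), of 1 "-1" h] assoc_mult_mat[OF fmat_carrier M B(1), of h]
      right_mult_one_mat[OF x_pq_carrier, of p q 1 "-1"] by simp
  then have "(\<Sum>i<?n. ?x $$ (i, i)) = (\<Sum>i<?n. (M * B * ?H) $$ (i, i))"
    using trace_mult_commute[OF fmat_carrier mult_carrier_mat[OF M B(1)], of h] by simp
  also have "M * B * ?H = M" using assoc_mult_mat[OF M B(1) fmat_carrier, of h] B M by simp
  also have "(\<Sum>i<?n. M $$ (i, i)) = (\<Sum>k | k < ?n \<and> \<sigma> k = k. \<epsilon> k)"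
    by (intro sum.mono_neutral_cong_right) (auto simp: M_def)
  finally have "(\<Sum>k | k < ?n \<and> \<sigma> k = k. \<epsilon> k) = (\<Sum>i<?n. if i < p then 1 else -1)"
    by (simp add: x_pq_def mat_diag_def)
  also have "\<dots> = of_nat p - of_nat q"
  proof (induction q)
    case 0
    have "(\<Sum>i<p. if i < p then 1 else - 1 :: complex) = (\<Sum>i<p. 1)" by (rule sum.cong[OF refl]) simp
    then show ?case by simp
  qed simp
  finally show ?thesis .
qed

text \<open>\<open>M k\<close> stands for \<open>m (k + 1)\<close>, so a clan is inside the bound
  when \<open>\<sigma> k < M k\<close>. The inequality \<open>M_large\<close> is condition (2) in
  this indexing, as \<open>l i\<close> is at least \<open>i\<close>.\<close>

locale clan_bound =
  fixes p q n :: nat and M :: "nat \<Rightarrow> nat"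
  assumes q: "1 \<le> q" "q \<le> p" and n: "n = p + q"
    and M_le: "k < n \<Longrightarrow> M k \<le> n" and M_gt: "k < n \<Longrightarrow> k < M k"
    and M_mono: "i \<le> j \<Longrightarrow> j < n \<Longrightarrow> M i \<le> M j"
    and M_large: "k < q \<Longrightarrow> p + k < M k"
begin

text \<open>The last five hypotheses say that no move stays inside the bound. Each wrong
  configuration would leave too few possible partners for the positions below some
  \<open>M k\<close>, either outright or in view of the trace.\<close>

lemma maximal_clan:
  assumes c: "clan n \<sigma> \<epsilon>"
    and tr: "(\<Sum>k | k < n \<and> \<sigma> k = k. \<epsilon> k) = of_nat p - of_nat q"
    and sign_sign: "\<And>i j. i < j \<Longrightarrow> j < n \<Longrightarrow> \<sigma> i = i \<Longrightarrow> \<sigma> j = j \<Longrightarrow> \<epsilon> i \<noteq> \<epsilon> j \<Longrightarrow> \<not> j < M i"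
    and pair_sign: "\<And>k i j. k < i \<Longrightarrow> i < j \<Longrightarrow> j < n \<Longrightarrow> \<sigma> k = i \<Longrightarrow> \<sigma> j = j \<Longrightarrow> \<not> j < M k"
    and sign_pair: "\<And>i j k. i < j \<Longrightarrow> j < k \<Longrightarrow> k < n \<Longrightarrow> \<sigma> i = i \<Longrightarrow> \<sigma> j = k \<Longrightarrow> \<not> k < M i"
    and pair_pair: "\<And>k i j l. k < i \<Longrightarrow> i < j \<Longrightarrow> j < l \<Longrightarrow> l < n \<Longrightarrow> \<sigma> k = i \<Longrightarrow> \<sigma> j = l \<Longrightarrow> \<not> (j < M k \<and> l < M i)"
    and crossing: "\<And>k j i x. k < j \<Longrightarrow> j < i \<Longrightarrow> i < x \<Longrightarrow> x < n \<Longrightarrow> \<sigma> k = i \<Longrightarrow> \<sigma> j = x \<Longrightarrow> \<not> x < M k"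
  shows "k < q \<Longrightarrow> p \<le> \<sigma> k \<and> \<sigma> k < n"
    and "q \<le> k \<Longrightarrow> k < p \<Longrightarrow> \<sigma> k = k \<and> \<epsilon> k = 1"
    and "p \<le> k \<Longrightarrow> k < n \<Longrightarrow> \<sigma> k < q"
proof -
  note cl = clanD[OF c]
  have inj: "inj_on \<sigma> {..<n}" using cl(2) by (metis inj_onI lessThan_iff)
  have card_im: "card (\<sigma> ` A) \<le> card A" if "finite A" for A using that by (rule card_image_le)
  have qn: "q \<le> n" "p \<le> n" using n by auto
  have tr_count: "(of_nat p - of_nat q :: complex) = s * (of_nat (card {x. x < n \<and> \<sigma> x = x \<and> \<epsilon> x = s}) - of_nat (card {x. x < n \<and> \<sigma> x = x \<and> \<epsilon> x \<noteq> s}))"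
    if s: "s = 1 \<or> s = -1" for s :: complex
  proof -
    have "(\<Sum>k | k < n \<and> \<sigma> k = k. \<epsilon> k) = (\<Sum>k \<in> {x. x < n \<and> \<sigma> x = x \<and> \<epsilon> x = s} \<union> {x. x < n \<and> \<sigma> x = x \<and> \<epsilon> x \<noteq> s}. \<epsilon> k)"
      by (intro sum.cong) auto
    also have "\<dots> = (\<Sum>k \<in> {x. x < n \<and> \<sigma> x = x \<and> \<epsilon> x = s}. \<epsilon> k) + (\<Sum>k \<in> {x. x < n \<and> \<sigma> x = x \<and> \<epsilon> x \<noteq> s}. \<epsilon> k)"
      by (intro sum.union_disjoint) auto
    also have "(\<Sum>k \<in> {x. x < n \<and> \<sigma> x = x \<and> \<epsilon> x = s}. \<epsilon> k) = (\<Sum>k \<in> {x. x < n \<and> \<sigma> x = x \<and> \<epsilon> x = s}. s)"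
      by (intro sum.cong) auto
    also have "(\<Sum>k \<in> {x. x < n \<and> \<sigma> x = x \<and> \<epsilon> x \<noteq> s}. \<epsilon> k) = (\<Sum>k \<in> {x. x < n \<and> \<sigma> x = x \<and> \<epsilon> x \<noteq> s}. - s)"
      by (intro sum.cong) (use cl(4) s in force)+
    finally show ?thesis using tr by (simp add: algebra_simps)
  qed
  have tr_int: "int p - int q = int (card {x. x < n \<and> \<sigma> x = x \<and> \<epsilon> x = 1}) - int (card {x. x < n \<and> \<sigma> x = x \<and> \<epsilon> x \<noteq> 1})"
  proof -
    have "(of_int (int p - int q) :: complex) = of_int (int (card {x. x < n \<and> \<sigma> x = x \<and> \<epsilon> x = 1}) - int (card {x. x < n \<and> \<sigma> x = x \<and> \<epsilon> x \<noteq> 1}))"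
      using tr_count[of 1] by simp
    then show ?thesis by (simp only: of_int_eq_iff)
  qed
  have no_sign: "\<sigma> i \<noteq> i" if i: "i < q" for i
  proof
    assume fi: "\<sigma> i = i"
    have i_n: "i < n" using i qn by simp
    define Fs where "Fs = {x. x < n \<and> \<sigma> x = x \<and> \<epsilon> x = \<epsilon> i}"
    define Fo where "Fo = {x. x < n \<and> \<sigma> x = x \<and> \<epsilon> x \<noteq> \<epsilon> i}"
    have Fo_R: "Fo \<subseteq> {M i..<n}"
    proof
      fix x assume x: "x \<in> Fo"
      have "\<not> x < M i"
      proof
        assume lt: "x < M i"
        have "x \<noteq> i" using x by (auto simp: Fo_def)
        then consider "i < x" | "x < i" by linarith
        then show False
        proof cases
          case 1 then show False using sign_sign[of i x] x fi lt by (auto simp: Fo_def)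
        next
          case 2
          then have "i < M x" using M_large[of x] i q by simp
          then show False using sign_sign[of x i] 2 x fi i_n by (auto simp: Fo_def)
        qed
      qed
      then show "x \<in> {M i..<n}" using x by (auto simp: Fo_def)
    qed
    \<comment> \<open>Below \<open>M i\<close> there is no fixed point of opposite sign, and no arc
      with both ends strictly between \<open>i\<close> and \<open>M i\<close>, because
      \<open>sign_pair\<close> would apply to it. So every position there is a fixed point of the
      same sign, lies left of \<open>i\<close>, or has its partner left of \<open>i\<close> or at
      \<open>M i\<close> or beyond.\<close>
    have cover: "{..<M i} \<subseteq> Fs \<union> {..<i} \<union> \<sigma> ` {..<i} \<union> \<sigma> ` ({M i..<n} - Fo)"
    proof
      fix x assume "x \<in> {..<M i}"
      then have x: "x < M i" "x < n" using M_le[OF i_n] by auto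
      let ?y = "\<sigma> x"
      have y: "?y < n" "\<sigma> ?y = x" using cl(1,2)[OF x(2)] by auto
      show "x \<in> Fs \<union> {..<i} \<union> \<sigma> ` {..<i} \<union> \<sigma> ` ({M i..<n} - Fo)"
      proof (cases "?y = x")
        case True
        then show ?thesis using x Fo_R by (auto simp: Fs_def Fo_def)
      next
        case False
        show ?thesis
        proof (cases "M i \<le> ?y")
          case True
          then have "?y \<in> {M i..<n} - Fo" using y False by (auto simp: Fo_def)
          then have "\<sigma> ?y \<in> \<sigma> ` ({M i..<n} - Fo)" by (rule imageI)
          then show ?thesis using y(2) by simp
        next
          case yM: False
          have "x < i \<or> ?y < i"
          proof (rule ccontr)
            assume "\<not> ?thesis"
            moreover have "x \<noteq> i" "?y \<noteq> i" using fi y False by auto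
            ultimately have "i < x" "i < ?y" by linarith+
            then show False
              using sign_pair[of i x ?y] sign_pair[of i ?y x] fi y x yM False by (cases "x < ?y") auto
          qed
          moreover have "x \<in> \<sigma> ` {..<i}" if "?y < i" using imageI[of ?y "{..<i}" \<sigma>] that y(2) by simp
          ultimately show ?thesis by auto
        qed
      qed
    qed
    have fin: "finite Fs" "finite Fo" by (auto simp: Fs_def Fo_def)
    have "M i \<le> card (Fs \<union> {..<i} \<union> \<sigma> ` {..<i} \<union> \<sigma> ` ({M i..<n} - Fo))"
      using card_mono[OF _ cover] fin by simp
    also have "\<dots> \<le> card Fs + i + card (\<sigma> ` {..<i}) + card (\<sigma> ` ({M i..<n} - Fo))"
      using card_Un_le[of "Fs \<union> {..<i} \<union> \<sigma> ` {..<i}" "\<sigma> ` ({M i..<n} - Fo)"]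
        card_Un_le[of "Fs \<union> {..<i}" "\<sigma> ` {..<i}"] card_Un_le[of Fs "{..<i}"] by simp
    also have "\<dots> \<le> card Fs + i + i + card ({M i..<n} - Fo)"
      using card_im[of "{..<i}"] card_im[of "{M i..<n} - Fo"] by simp
    also have "card ({M i..<n} - Fo) = n - M i - card Fo" using Fo_R fin by (simp add: card_Diff_subset)
    finally have le: "M i \<le> card Fs + i + i + (n - M i - card Fo)" .
    have "card Fo \<le> n - M i" using card_mono[OF _ Fo_R] by simp
    then have "int (card Fs) - int (card Fo) \<ge> 2 * int (M i) - int n - 2 * int i"
      using le M_le[OF i_n] by linarith
    \<comment> \<open>With \<open>M i \<ge> p + i + 1\<close> the lower bound
      \<open>2 M i - n - 2 i\<close> is at least \<open>p - q + 2\<close>, whereas the trace leaves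
      only \<open>p - q\<close> or its negative for the difference.\<close>
    then have ge: "int (card Fs) - int (card Fo) \<ge> int p - int q + 2" using M_large[OF i] n by linarith
    have "(of_int (int p - int q) :: complex) = \<epsilon> i * of_int (int (card Fs) - int (card Fo))"
      using tr_count[OF cl(4)[OF i_n]] by (simp add: Fs_def Fo_def)
    then have "(of_int (int p - int q) :: complex) = of_int (int (card Fs) - int (card Fo)) \<or>
       (of_int (int p - int q) :: complex) = of_int (- (int (card Fs) - int (card Fo)))"
      using cl(4)[OF i_n] by auto
    then have "int p - int q = int (card Fs) - int (card Fo) \<or> int p - int q = - (int (card Fs) - int (card Fo))"
      by (simp only: of_int_eq_iff)
    then show False using ge q by linarith
  qed
  \<comment> \<open>For an arc \<open>k\<close>-\<open>i\<close> inside the first \<open>q\<close>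
    positions, every position below \<open>M k\<close> lies left of \<open>i\<close> or has its
    partner at most \<open>k\<close> or at least \<open>M i\<close>. That allows at most
    \<open>i + (k + 1) + (n - M i)\<close> positions, fewer than \<open>M k\<close>.\<close>
  have no_pair: False if ki: "k < i" "i < q" "\<sigma> k = i" for k i
  proof -
    have kn: "k < n" "i < n" "k < q" using ki qn by auto
    have \<sigma>i: "\<sigma> i = k" using cl(2)[OF kn(1)] ki by simp
    have Mki: "M k \<le> M i" using M_mono[of k i] ki kn by simp
    have cover: "{..<M k} \<subseteq> {..<i} \<union> \<sigma> ` {..k} \<union> \<sigma> ` {M i..<n}"
    proof
      fix x assume "x \<in> {..<M k}"
      then have x: "x < M k" "x < n" using M_le[OF kn(1)] by auto
      let ?y = "\<sigma> x"
      have y: "?y < n" "\<sigma> ?y = x" using cl(1,2)[OF x(2)] by auto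
      have "x < i \<or> ?y \<le> k \<or> M i \<le> ?y"
      proof (rule ccontr)
        assume "\<not> ?thesis"
        then have a: "i \<le> x" "k < ?y" "?y < M i" by auto
        have "x \<noteq> i" using a \<sigma>i by auto
        then have xi: "i < x" using a by linarith
        have yi: "?y \<noteq> i" using a(1) \<sigma>i y ki(1) by auto
        consider "?y = x" | "x < ?y" | "i < ?y" "?y < x" | "?y < i" using yi by linarith
        then show False
        proof cases
          case 1 then show False using pair_sign[of k i x] ki xi x by simp
        next
          case 2 then show False using pair_pair[of k i x ?y] ki xi x y a by simp
        next
          case 3 then show False using pair_pair[of k i ?y x] ki xi x y a Mki by simp
        next
          case 4 then show False using crossing[of k ?y i x] ki xi x y a by simp
        qed
      qed
      moreover have "x \<in> \<sigma> ` {..k}" if "?y \<le> k" using imageI[of ?y "{..k}" \<sigma>] that y(2) by simp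
      moreover have "x \<in> \<sigma> ` {M i..<n}" if "M i \<le> ?y" using imageI[of ?y "{M i..<n}" \<sigma>] that y by simp
      ultimately show "x \<in> {..<i} \<union> \<sigma> ` {..k} \<union> \<sigma> ` {M i..<n}" by auto
    qed
    have "M k \<le> card ({..<i} \<union> \<sigma> ` {..k} \<union> \<sigma> ` {M i..<n})" using card_mono[OF _ cover] by simp
    also have "\<dots> \<le> i + card (\<sigma> ` {..k}) + card (\<sigma> ` {M i..<n})"
      using card_Un_le[of "{..<i} \<union> \<sigma> ` {..k}" "\<sigma> ` {M i..<n}"] card_Un_le[of "{..<i}" "\<sigma> ` {..k}"] by simp
    also have "\<dots> \<le> i + Suc k + (n - M i)" using card_im[of "{..k}"] card_im[of "{M i..<n}"] by simp
    finally show False using M_large[OF kn(3)] M_large[OF ki(2)] M_le[OF kn(2)] n q by linarith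
  qed
  have big: "q \<le> \<sigma> k" if k: "k < q" for k
  proof (rule ccontr)
    assume "\<not> q \<le> \<sigma> k"
    moreover have "\<sigma> (\<sigma> k) = k" using cl(2)[of k] k qn by simp
    ultimately show False
      using no_pair[of k "\<sigma> k"] no_pair[of "\<sigma> k" k] no_sign[OF k] k by (cases "k < \<sigma> k") auto
  qed
  \<comment> \<open>The first \<open>q\<close> positions now have \<open>q\<close> distinct partners
    further right, so \<open>p - q\<close> positions remain for fixed points. The trace demands an
    excess of \<open>p - q\<close> plus signs: there are no minus signs, and all remaining positions
    are fixed.\<close>
  define F where "F = {x. x < n \<and> \<sigma> x = x}"
  define Rm where "Rm = {q..<n} - \<sigma> ` {..<q}"
  have im_sub: "\<sigma> ` {..<q} \<subseteq> {q..<n}" using big cl(1) qn by fastforce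
  have card_im_q: "card (\<sigma> ` {..<q}) = q"
    using card_image[OF inj_on_subset[OF inj, of "{..<q}"]] qn by simp
  have cRm: "card Rm = p - q" using im_sub card_im_q n by (simp add: Rm_def card_Diff_subset)
  have F_Rm: "F \<subseteq> Rm"
  proof
    fix x assume x: "x \<in> F"
    have "q \<le> x" using x no_sign[of x] by (cases "x < q") (auto simp: F_def)
    moreover have "x \<notin> \<sigma> ` {..<q}"
    proof
      assume "x \<in> \<sigma> ` {..<q}"
      then obtain k where k: "k < q" "x = \<sigma> k" by auto
      then have "\<sigma> x = k" using cl(2)[of k] qn by simp
      then show False using k x \<open>q \<le> x\<close> by (auto simp: F_def)
    qed
    ultimately show "x \<in> Rm" using x by (auto simp: Rm_def F_def)
  qed
  have finF: "finite F" "finite Rm" by (auto simp: F_def Rm_def)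
  let ?P = "{x. x < n \<and> \<sigma> x = x \<and> \<epsilon> x = 1}" and ?N = "{x. x < n \<and> \<sigma> x = x \<and> \<epsilon> x \<noteq> 1}"
  have "card F = card ?P + card ?N"
    by (subst card_Un_disjoint[symmetric]) (auto simp: F_def intro!: arg_cong[of _ _ card])
  moreover have "card F \<le> p - q" using card_mono[OF finF(2) F_Rm] cRm by simp
  ultimately have N0: "card ?N = 0" and cF: "card F = p - q" using tr_int q by linarith+
  have "?N = {}" using N0 by simp
  then have plus: "\<epsilon> x = 1" if "x \<in> F" for x using that by (auto simp: F_def)
  have FR: "F = Rm" using card_subset_eq[OF finF(2) F_Rm] cF cRm by simp
  \<comment> \<open>If the partner of \<open>k\<close> lay before \<open>p\<close>, then every
    position in \<open>{p..<M k}\<close> would be the partner of some position left of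
    \<open>k\<close>, by \<open>pair_sign\<close> and \<open>crossing\<close>; that interval has
    more than \<open>k\<close> elements.\<close>
  have far: "p \<le> \<sigma> k" if k: "k < q" for k
  proof (rule ccontr)
    assume lt: "\<not> p \<le> \<sigma> k"
    have kn: "k < n" using k qn by simp
    have ki: "k < \<sigma> k" using big[OF k] k by simp
    have "{p..<M k} \<subseteq> \<sigma> ` {..<k}"
    proof
      fix x assume "x \<in> {p..<M k}"
      then have x: "p \<le> x" "x < M k" "x < n" using M_le[OF kn] by auto
      have "\<sigma> x \<noteq> x" using pair_sign[OF ki _ x(3) refl, of] x lt by linarith
      then have "x \<notin> F" by (simp add: F_def)
      then have "x \<in> \<sigma> ` {..<q}" using FR x q by (auto simp: Rm_def)
      then obtain j where j: "j < q" "x = \<sigma> j" by auto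
      have "j < k"
      proof (rule ccontr)
        assume "\<not> j < k"
        moreover have "j \<noteq> k" using j x lt by auto
        ultimately have kj: "k < j" by simp
        have "j < \<sigma> k" "\<sigma> k < x" using j(1) big[OF k] lt x(1) by linarith+
        then show False using crossing[OF kj _ _ x(3) refl j(2)[symmetric]] x(2) by blast
      qed
      then show "x \<in> \<sigma> ` {..<k}" using j by simp
    qed
    then have "card {p..<M k} \<le> card (\<sigma> ` {..<k})" by (intro card_mono) auto
    also have "\<dots> \<le> k" using card_im[of "{..<k}"] by simp
    finally show False using M_large[OF k] by simp
  qed
  have im: "\<sigma> ` {..<q} = {p..<n}"
  proof (rule card_subset_eq)
    show "\<sigma> ` {..<q} \<subseteq> {p..<n}" using far cl(1) qn by fastforce
  qed (use card_im_q n in auto)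
  show "k < q \<Longrightarrow> p \<le> \<sigma> k \<and> \<sigma> k < n" using far[of k] cl(1)[of k] qn by simp
  show "q \<le> k \<Longrightarrow> k < p \<Longrightarrow> \<sigma> k = k \<and> \<epsilon> k = 1"
  proof -
    assume "q \<le> k" "k < p"
    then have "k \<in> F" unfolding FR Rm_def im using n by auto
    then show "\<sigma> k = k \<and> \<epsilon> k = 1" using plus by (auto simp: F_def)
  qed
  show "\<sigma> k < q" if "p \<le> k" "k < n"
  proof -
    have "k \<in> \<sigma> ` {..<q}" unfolding im using that by simp
    then obtain j where j: "j < q" "k = \<sigma> j" by auto
    have "\<sigma> (\<sigma> j) = j" using cl(2)[of j] j(1) qn by simp
    then show ?thesis unfolding j(2) using j(1) by simp
  qed
qed

end

text \<open>Surgery on a set closed under \<open>\<sigma>\<close>. Positions outside keep their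
  partners, because an involution also preserves the complement.\<close>

lemma clan_modify:
  assumes c: "clan n \<sigma> \<epsilon>" and S: "S \<subseteq> {..<n}" "\<And>x. x \<in> S \<Longrightarrow> \<sigma> x \<in> S"
    and off: "\<And>x. x \<notin> S \<Longrightarrow> \<sigma>' x = \<sigma> x \<and> \<epsilon>' x = \<epsilon> x"
    and on: "\<And>x. x \<in> S \<Longrightarrow> \<sigma>' x \<in> S \<and> \<sigma>' (\<sigma>' x) = x \<and> (\<sigma>' x \<noteq> x \<longrightarrow> \<epsilon>' x = 1) \<and> (\<epsilon>' x = 1 \<or> \<epsilon>' x = -1)"
  shows "clan n \<sigma>' \<epsilon>'"
  unfolding clan_def
proof (intro allI impI)
  fix x assume x: "x < n"
  show "\<sigma>' x < n \<and> \<sigma>' (\<sigma>' x) = x \<and> (\<sigma>' x \<noteq> x \<longrightarrow> \<epsilon>' x = 1) \<and> (\<epsilon>' x = 1 \<or> \<epsilon>' x = - 1)"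
  proof (cases "x \<in> S")
    case True then show ?thesis using on[OF True] S(1) by blast
  next
    case False
    have "\<sigma> x \<notin> S"
    proof
      assume "\<sigma> x \<in> S"
      then have "\<sigma> (\<sigma> x) \<in> S" by (rule S(2))
      then show False using clanD(2)[OF c x] False by simp
    qed
    then have "\<sigma>' (\<sigma>' x) = \<sigma> (\<sigma> x)" "\<sigma>' x = \<sigma> x" "\<epsilon>' x = \<epsilon> x" using off[OF False] off[of "\<sigma> x"] by auto
    then show ?thesis using clanD(1-4)[OF c x] by metis
  qed
qed

lemma sum_modify:
  fixes f g :: "nat \<Rightarrow> nat"
  assumes S: "finite A" "S \<subseteq> A" and off: "\<And>x. x \<notin> S \<Longrightarrow> f x = g x" and lt: "sum f S < sum g S"
  shows "sum f A < sum g A"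
proof -
  have "sum f A = sum f (A - S) + sum f S" "sum g A = sum g (A - S) + sum g S"
    using sum.subset_diff[OF S(2,1)] by blast+
  moreover have "sum f (A - S) = sum g (A - S)" using off by (intro sum.cong) auto
  ultimately show ?thesis using lt by simp
qed

context clan_bound
begin

text \<open>The weight \<open>\<Sum>k * \<sigma> k\<close> drops whenever arcs get longer, so iterating the moves ends in
  a clan that admits no further move inside the bound \<open>M\<close>.\<close>

lemma closure_of_maximal:
  assumes c: "clan n \<sigma> \<epsilon>" and bel: "\<And>k. k < n \<Longrightarrow> \<sigma> k < M k" and h: "adapted p n \<sigma> \<epsilon> h"
    and T: "T \<subseteq> flags n"
    and top: "\<And>\<sigma> \<epsilon> h. clan n \<sigma> \<epsilon> \<Longrightarrow> adapted p n \<sigma> \<epsilon> h \<Longrightarrow> (\<And>k. k < n \<Longrightarrow> \<sigma> k < M k) \<Longrightarrow>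
      (\<And>k. k < q \<Longrightarrow> p \<le> \<sigma> k \<and> \<sigma> k < n) \<Longrightarrow> (\<And>k. q \<le> k \<Longrightarrow> k < p \<Longrightarrow> \<sigma> k = k \<and> \<epsilon> k = 1) \<Longrightarrow>
      (\<And>k. p \<le> k \<Longrightarrow> k < n \<Longrightarrow> \<sigma> k < q) \<Longrightarrow>
      (\<And>k j. k < j \<Longrightarrow> j < q \<Longrightarrow> \<sigma> k < \<sigma> j \<Longrightarrow> M k \<le> \<sigma> j) \<Longrightarrow> flag n h \<in> T"
  shows "flag n h \<in> zariski_flags n closure_of T"
  using c bel h
proof (induction "\<Sum>k<n. k * \<sigma> k" arbitrary: \<sigma> \<epsilon> h rule: less_induct)
  case less
  note c = less.prems(1) and bel = less.prems(2) and h = less.prems(3)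
  note cl = clanD[OF c]
  show ?case
  proof (rule ccontr)
    assume not: "flag n h \<notin> zariski_flags n closure_of T"
    \<comment> \<open>By induction the whole orbit of a modified clan lies in the closure of
      \<open>T\<close>, and a closure contains the closure of each of its subsets.\<close>
    have no_move: False
      if c': "clan n \<sigma>' \<epsilon>'" and b': "\<And>k. k < n \<Longrightarrow> \<sigma>' k < M k"
        and lt: "(\<Sum>k<n. k * \<sigma>' k) < (\<Sum>k<n. k * \<sigma> k)"
        and cls: "flag n h \<in> zariski_flags n closure_of clan_orbit p n \<sigma>' \<epsilon>'" for \<sigma>' \<epsilon>'
    proof -
      have "clan_orbit p n \<sigma>' \<epsilon>' \<subseteq> zariski_flags n closure_of T"
        using less.hyps[OF lt c' b'] by (auto simp: clan_orbit_def)
      then have "flag n h \<in> zariski_flags n closure_of (zariski_flags n closure_of T)"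
        using cls closure_of_mono by blast
      then show False using not by simp
    qed
    have below_off: "\<sigma>' x < M x" if "x < n" "x \<notin> S \<Longrightarrow> \<sigma>' x = \<sigma> x" "x \<in> S \<Longrightarrow> \<sigma>' x < M x" for \<sigma>' x S
      using that bel[of x] by (cases "x \<in> S") auto
    have sign_sign: "\<not> j < M i" if ij: "i < j" "j < n" "\<sigma> i = i" "\<sigma> j = j" "\<epsilon> i \<noteq> \<epsilon> j" for i j
    proof
      assume jM: "j < M i"
      let ?\<sigma> = "\<sigma>(i := j, j := i)" and ?\<epsilon> = "\<epsilon>(i := 1, j := 1)"
      have "clan n ?\<sigma> ?\<epsilon>" by (rule clan_modify[OF c, of "{i, j}"]) (use ij in auto)
      moreover have "?\<sigma> k < M k" if "k < n" for k
        by (rule below_off[OF that, of "{i, j}"]) (use ij jM M_gt[of j] in auto)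
      moreover have "(\<Sum>k<n. k * ?\<sigma> k) < (\<Sum>k<n. k * \<sigma> k)"
      proof (rule sum_modify[of _ "{i, j}"])
        \<comment> \<open>Writing the gaps between positions as positive summands avoids subtraction
          of naturals; here the weight drops by \<open>d * d\<close>.\<close>
        obtain d where d: "0 < d" "j = i + d" using less_imp_add_positive[OF ij(1)] by auto
        show "(\<Sum>k\<in>{i, j}. k * ?\<sigma> k) < (\<Sum>k\<in>{i, j}. k * \<sigma> k)"
          using ij d by (simp add: algebra_simps)
      qed (use ij in auto)
      ultimately show False using no_move move_sign_sign[OF c h ij] by blast
    qed
    have pair_sign: "\<not> j < M k" if ij: "k < i" "i < j" "j < n" "\<sigma> k = i" "\<sigma> j = j" for k i j
    proof
      assume jM: "j < M k"
      have \<sigma>i: "\<sigma> i = k" using cl(2)[of k] ij by simp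
      let ?\<sigma> = "\<sigma>(k := j, j := k, i := i)" and ?\<epsilon> = "\<epsilon>(j := 1, i := \<epsilon> j)"
      have e: "\<epsilon> k = 1" "\<epsilon> j = 1 \<or> \<epsilon> j = -1" using cl(3)[of k] cl(4)[of j] ij by auto
      have "clan n ?\<sigma> ?\<epsilon>" by (rule clan_modify[OF c, of "{k, i, j}"]) (use ij \<sigma>i e in auto)
      moreover have "?\<sigma> x < M x" if "x < n" for x
        by (rule below_off[OF that, of "{k, i, j}"]) (use ij jM M_gt[of j] M_gt[of i] in auto)
      moreover have "(\<Sum>x<n. x * ?\<sigma> x) < (\<Sum>x<n. x * \<sigma> x)"
      proof (rule sum_modify[of _ "{k, i, j}"])
        obtain a where a: "0 < a" "i = k + a" using less_imp_add_positive[OF ij(1)] by auto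
        obtain b where b: "0 < b" "j = k + a + b" using less_imp_add_positive[OF ij(2)] a by auto
        have "k * j + i * i + j * k < k * i + i * k + j * j" using a b by (simp add: algebra_simps)
        then show "(\<Sum>x\<in>{k, i, j}. x * ?\<sigma> x) < (\<Sum>x\<in>{k, i, j}. x * \<sigma> x)"
          using ij \<sigma>i by simp
      qed (use ij in auto)
      ultimately show False using no_move move_pair_sign[OF c h ij] by blast
    qed
    have sign_pair: "\<not> k < M i" if ij: "i < j" "j < k" "k < n" "\<sigma> i = i" "\<sigma> j = k" for i j k
    proof
      assume jM: "k < M i"
      have \<sigma>k: "\<sigma> k = j" using cl(2)[of j] ij by simp
      let ?\<sigma> = "\<sigma>(i := k, k := i, j := j)" and ?\<epsilon> = "\<epsilon>(i := 1, j := \<epsilon> i)"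
      have e: "\<epsilon> k = 1" "\<epsilon> i = 1 \<or> \<epsilon> i = -1" using cl(3)[of k] cl(4)[of i] ij \<sigma>k by auto
      have "clan n ?\<sigma> ?\<epsilon>" by (rule clan_modify[OF c, of "{k, i, j}"]) (use ij \<sigma>k e in auto)
      moreover have "?\<sigma> x < M x" if "x < n" for x
        by (rule below_off[OF that, of "{k, i, j}"]) (use ij jM M_gt[of j] M_gt[of k] in auto)
      moreover have "(\<Sum>x<n. x * ?\<sigma> x) < (\<Sum>x<n. x * \<sigma> x)"
      proof (rule sum_modify[of _ "{i, j, k}"])
        obtain a where a: "0 < a" "j = i + a" using less_imp_add_positive[OF ij(1)] by auto
        obtain b where b: "0 < b" "k = i + a + b" using less_imp_add_positive[OF ij(2)] a by auto
        have "i * k + j * j + k * i < i * i + j * k + k * j" using a b by (simp add: algebra_simps)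
        then show "(\<Sum>x\<in>{i, j, k}. x * ?\<sigma> x) < (\<Sum>x\<in>{i, j, k}. x * \<sigma> x)"
          using ij \<sigma>k by simp
      qed (use ij in auto)
      ultimately show False using no_move move_sign_pair[OF c h ij] by blast
    qed
    have pair_pair: "\<not> (j < M k \<and> l < M i)" if ij: "k < i" "i < j" "j < l" "l < n" "\<sigma> k = i" "\<sigma> j = l" for k i j l
    proof
      assume jM: "j < M k \<and> l < M i"
      have \<sigma>i: "\<sigma> i = k" "\<sigma> l = j" using cl(2)[of k] cl(2)[of j] ij by auto
      let ?\<sigma> = "\<sigma>(k := j, j := k, i := l, l := i)"
      have e: "\<epsilon> k = 1" "\<epsilon> i = 1" "\<epsilon> j = 1" "\<epsilon> l = 1" using cl(3) ij \<sigma>i by auto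
      have "clan n ?\<sigma> \<epsilon>" by (rule clan_modify[OF c, of "{k, i, j, l}"]) (use ij \<sigma>i e in auto)
      moreover have "?\<sigma> x < M x" if "x < n" for x
        by (rule below_off[OF that, of "{k, i, j, l}"]) (use ij jM M_gt[of j] M_gt[of l] in auto)
      moreover have "(\<Sum>x<n. x * ?\<sigma> x) < (\<Sum>x<n. x * \<sigma> x)"
      proof (rule sum_modify[of _ "{k, i, j, l}"])
        obtain a where a: "0 < a" "i = k + a" using less_imp_add_positive[OF ij(1)] by auto
        obtain b where b: "0 < b" "j = k + a + b" using less_imp_add_positive[OF ij(2)] a by auto
        obtain d where d: "0 < d" "l = k + a + b + d" using less_imp_add_positive[OF ij(3)] b by auto
        have "k * j + i * l + j * k + l * i < k * i + i * k + j * l + l * j"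
          using a b d by (simp add: algebra_simps)
        then show "(\<Sum>x\<in>{k, i, j, l}. x * ?\<sigma> x) < (\<Sum>x\<in>{k, i, j, l}. x * \<sigma> x)"
          using ij \<sigma>i by simp
      qed (use ij in auto)
      ultimately show False using no_move move_pair_pair[OF c h ij] by blast
    qed
    have crossing: "\<not> x < M k" if ij: "k < j" "j < i" "i < x" "x < n" "\<sigma> k = i" "\<sigma> j = x" for k j i x
    proof
      assume jM: "x < M k"
      have \<sigma>i: "\<sigma> i = k" "\<sigma> x = j" using cl(2)[of k] cl(2)[of j] ij by auto
      let ?\<sigma> = "\<sigma>(k := x, x := k, j := i, i := j)"
      have e: "\<epsilon> k = 1" "\<epsilon> i = 1" "\<epsilon> j = 1" "\<epsilon> x = 1" using cl(3) ij \<sigma>i by auto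
      have iM: "i < M j" using M_mono[of k j] jM ij by simp
      have "clan n ?\<sigma> \<epsilon>" by (rule clan_modify[OF c, of "{k, i, j, x}"]) (use ij \<sigma>i e in auto)
      moreover have "?\<sigma> y < M y" if "y < n" for y
        by (rule below_off[OF that, of "{k, i, j, x}"]) (use ij jM iM M_gt[of i] M_gt[of x] in auto)
      moreover have "(\<Sum>x<n. x * ?\<sigma> x) < (\<Sum>x<n. x * \<sigma> x)"
      proof (rule sum_modify[of _ "{k, j, i, x}"])
        obtain a where a: "0 < a" "j = k + a" using less_imp_add_positive[OF ij(1)] by auto
        obtain b where b: "0 < b" "i = k + a + b" using less_imp_add_positive[OF ij(2)] a by auto
        obtain d where d: "0 < d" "x = k + a + b + d" using less_imp_add_positive[OF ij(3)] b by auto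
        have "k * x + j * i + i * j + x * k < k * i + j * x + i * k + x * j"
          using a b d by (simp add: algebra_simps)
        then show "(\<Sum>y\<in>{k, j, i, x}. y * ?\<sigma> y) < (\<Sum>y\<in>{k, j, i, x}. y * \<sigma> y)"
          using ij \<sigma>i by simp
      qed (use ij in auto)
      ultimately show False using no_move move_crossing[OF c h ij] by blast
    qed
    have tr: "(\<Sum>k | k < n \<and> \<sigma> k = k. \<epsilon> k) = of_nat p - of_nat q"
      using adapted_trace[of p q \<sigma> \<epsilon> h] h cl(1) n by simp
    have mx1: "p \<le> \<sigma> k \<and> \<sigma> k < n" if "k < q" for k
      by (rule maximal_clan(1)[OF c tr]) (fact sign_sign pair_sign sign_pair pair_pair crossing that)+
    have mx2: "\<sigma> k = k \<and> \<epsilon> k = 1" if "q \<le> k" "k < p" for k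
      by (rule maximal_clan(2)[OF c tr]) (fact sign_sign pair_sign sign_pair pair_pair crossing that)+
    have mx3: "\<sigma> k < q" if "p \<le> k" "k < n" for k
      by (rule maximal_clan(3)[OF c tr]) (fact sign_sign pair_sign sign_pair pair_pair crossing that)+
    have "flag n h \<in> T"
    proof (rule top[OF c h])
      \<comment> \<open>Both partners lie beyond \<open>j\<close>, since
        \<open>j < q \<le> p\<close>; increasing partners therefore mean crossing arcs, and the
        failure of \<open>crossing\<close> is the required bound.\<close>
      fix k j assume kj: "k < j" "j < q" "\<sigma> k < \<sigma> j"
      have "j < \<sigma> k" "\<sigma> j < n" using mx1[of k] mx1[of j] kj q by auto
      then have "\<not> \<sigma> j < M k" using crossing[OF kj(1) _ kj(3) _ refl refl] by blast
      then show "M k \<le> \<sigma> j" by (rule leI)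
    qed (fact bel mx1 mx2 mx3)+
    then show False using not closure_of_subset[of T "zariski_flags n"] T by auto
  qed
qed

end

section \<open>The orbits of 231-free permutations\<close>

text \<open>The clan of the orbit of \<open>\<gamma>\<^sub>w\<close>. Positions in clans start at 0, while \<open>w\<close> acts on \<open>{1..q}\<close>.\<close>

definition gclan :: "nat \<Rightarrow> nat \<Rightarrow> (nat \<Rightarrow> nat) \<Rightarrow> nat \<Rightarrow> nat" where
  "gclan p q w k = (if k < q then p + (inv_into UNIV w (Suc k) - 1) else if k < p then k else w (Suc k - p) - 1)"

text \<open>The farthest position, counted from \<open>p\<close>, that is reached by the arcs
  starting at \<open>1, ..., i\<close>. So \<open>p + runmax w i\<close> is the smallest value at
  \<open>i\<close>, for \<open>i \<le> q\<close>, of an increasing bound that admits the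
  orbit.\<close>

definition runmax :: "(nat \<Rightarrow> nat) \<Rightarrow> nat \<Rightarrow> nat" where
  "runmax w i = Max (inv_into UNIV w ` {1..i})"

lemma inv_range:
  assumes "w permutes {1..q}" "i \<in> {1..q}" shows "inv_into UNIV w i \<in> {1..q}" "w i \<in> {1..q}"
  using assms permutes_in_image permutes_inv by metis+

lemma gclan_clan:
  assumes w: "w permutes {1..q}" and pq: "q \<le> p"
  shows "clan (p + q) (gclan p q w) (\<lambda>_. 1)"
  unfolding clan_def
proof (intro allI impI)
  fix k assume k: "k < p + q"
  have inv: "inv_into UNIV w (w j) = j" "w (inv_into UNIV w j) = j" for j using permutes_inverses[OF w] by auto
  have "gclan p q w k < p + q \<and> gclan p q w (gclan p q w k) = k"
  proof -
    consider "k < q" | "q \<le> k" "k < p" | "p \<le> k" by linarith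
    then show ?thesis
    proof cases
      case 1
      have "inv_into UNIV w (Suc k) \<in> {1..q}" using inv_range(1)[OF w] 1 by simp
      then show ?thesis using 1 pq by (auto simp: gclan_def inv Suc_diff_le)
    next
      case 2 then show ?thesis using pq by (auto simp: gclan_def)
    next
      case 3
      have "Suc k - p \<in> {1..q}" using 3 k by auto
      then have "w (Suc k - p) \<in> {1..q}" by (rule inv_range(2)[OF w])
      then show ?thesis using 3 pq by (auto simp: gclan_def inv)
    qed
  qed
  then show "gclan p q w k < p + q \<and> gclan p q w (gclan p q w k) = k \<and>
     (gclan p q w k \<noteq> k \<longrightarrow> (1::complex) = 1) \<and> ((1::complex) = 1 \<or> (1::complex) = - 1)" by simp
qed

text \<open>\<open>s\<close> changes the sign of the last \<open>q\<close> unit vectors, so it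
  exchanges the sum attached to the left end of an arc with the difference attached to its right
  end.\<close>

lemma gamma_adapted:
  assumes w: "w permutes {1..q}" and pq: "q \<le> p"
  shows "adapted p (p + q) (gclan p q w) (\<lambda>_. 1) (\<lambda>k. gamma_vec p q w (Suc k))"
proof -
  let ?n = "p + q" and ?\<sigma> = "gclan p q w" and ?h = "\<lambda>k. gamma_vec p q w (Suc k)"
  have c: "clan ?n ?\<sigma> (\<lambda>_. 1)" using gclan_clan[OF w pq] .
  have inv: "inv_into UNIV w (w j) = j" "w (inv_into UNIV w j) = j" for j using permutes_inverses[OF w] by auto
  have v: "vecs ?n ?h" by (auto simp: vecs_def gamma_vec_def Let_def)
  have h1: "?h k = unit_vec ?n k + unit_vec ?n (?\<sigma> k)" if "k < q" for k
    using inv_range(1)[OF w, of "Suc k"] that by (auto simp: gamma_vec_def Let_def gclan_def)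
  have h2: "?h k = unit_vec ?n k" if "q \<le> k" "k < p" for k
    using that by (auto simp: gamma_vec_def Let_def)
  have h3: "?h k = unit_vec ?n (?\<sigma> k) - unit_vec ?n k" if "p \<le> k" for k
    using that pq by (auto simp: gamma_vec_def Let_def gclan_def)
  have \<sigma>1: "p \<le> ?\<sigma> k \<and> ?\<sigma> k < ?n" if "k < q" for k
    using clanD(1)[OF c, of k] that by (auto simp: gclan_def)
  have \<sigma>2: "?\<sigma> k < q" if "p \<le> k" "k < ?n" for k
  proof -
    have "Suc k - p \<in> {1..q}" using that by auto
    then have "w (Suc k - p) \<in> {1..q}" by (rule inv_range(2)[OF w])
    then show ?thesis using that pq by (auto simp: gclan_def)
  qed
  have s: "sgnv p ?n (?h k) = 1 \<cdot>\<^sub>v ?h (?\<sigma> k)" if k: "k < ?n" for k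
  proof -
    consider "k < q" | "q \<le> k" "k < p" | "p \<le> k" by linarith
    then show ?thesis
    proof cases
      case 1
      have "?h (?\<sigma> k) = unit_vec ?n k - unit_vec ?n (?\<sigma> k)" using h3[of "?\<sigma> k"] \<sigma>1[OF 1] clanD(2)[OF c k] by simp
      then show ?thesis unfolding h1[OF 1] using 1 pq \<sigma>1[OF 1] by (intro eq_vecI) (auto simp: sgnv_def)
    next
      case 2
      have "?\<sigma> k = k" using 2 by (simp add: gclan_def)
      then show ?thesis using h2[OF 2] 2 by (intro eq_vecI) (auto simp: sgnv_def)
    next
      case 3
      have "?h (?\<sigma> k) = unit_vec ?n (?\<sigma> k) + unit_vec ?n k" using h1[of "?\<sigma> k"] \<sigma>2[OF 3 k] clanD(2)[OF c k] by simp
      then show ?thesis unfolding h3[OF 3] using 3 k pq \<sigma>2[OF 3 k] by (intro eq_vecI) (auto simp: sgnv_def)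
    qed
  qed
  have "is_basis ?n ?h"
  proof (rule is_basisI_span[OF v])
    fix k assume k: "k < ?n"
    have mem: "?h j \<in> vspan ?n ?h ?n" if "j < ?n" for j using vspan_mem[OF v that] by simp
    have \<sigma>k: "?\<sigma> k < ?n" using clanD(1)[OF c k] .
    \<comment> \<open>The half sum and the half difference of the two vectors on an arc recover the
      unit vectors.\<close>
    have add: "(1/2) \<cdot>\<^sub>v (?h k + ?h (?\<sigma> k)) \<in> vspan ?n ?h ?n" "(1/2) \<cdot>\<^sub>v (?h (?\<sigma> k) - ?h k) \<in> vspan ?n ?h ?n"
      using vspan_smult[OF v] vspan_add[OF v] vspan_minus[OF v] mem[OF k] mem[OF \<sigma>k] by auto
    consider "k < q" | "q \<le> k" "k < p" | "p \<le> k" by linarith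
    then show "unit_vec ?n k \<in> vspan ?n ?h ?n"
    proof cases
      case 1
      have "?h (?\<sigma> k) = unit_vec ?n k - unit_vec ?n (?\<sigma> k)" using h3[of "?\<sigma> k"] \<sigma>1[OF 1] clanD(2)[OF c k] by simp
      then have "(1/2) \<cdot>\<^sub>v (?h k + ?h (?\<sigma> k)) = unit_vec ?n k" unfolding h1[OF 1] by (intro eq_vecI) auto
      then show ?thesis using add(1) by simp
    next
      case 2 then show ?thesis using h2[OF 2] mem[OF k] by simp
    next
      case 3
      have "?h (?\<sigma> k) = unit_vec ?n (?\<sigma> k) + unit_vec ?n k" using h1[of "?\<sigma> k"] \<sigma>2[OF 3 k] clanD(2)[OF c k] by simp
      then have "(1/2) \<cdot>\<^sub>v (?h (?\<sigma> k) - ?h k) = unit_vec ?n k" unfolding h3[OF 3] by (intro eq_vecI) auto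
      then show ?thesis using add(2) by simp
    qed
  qed
  then show ?thesis using s by (simp add: adapted_def)
qed

lemma gamma_orbit_eq:
  assumes w: "w permutes {1..q}" and pq: "q \<le> p" and ab: "a \<noteq> b"
  shows "gamma_orbit p q a b w = clan_orbit p (p + q) (gclan p q w) (\<lambda>_. 1)"
proof -
  have ad: "adapted p (p + q) (gclan p q w) (\<lambda>_. 1) (\<lambda>k. gamma_vec p q w (Suc k))" using gamma_adapted[OF w pq] .
  then have "vecs (p + q) (\<lambda>k. gamma_vec p q w (Suc k))" by (simp add: adapted_def is_basis_def)
  then have "flag_of_vectors (p + q) (gamma_vec p q w) = flag (p + q) (\<lambda>k. gamma_vec p q w (Suc k))"
    by (rule flag_of_vectors_eq) simp
  then show ?thesis unfolding gamma_orbit_def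
    using orbit_eq_clan_orbit[OF ab ad] clanD(1)[OF gclan_clan[OF w pq]] by simp
qed

lemma gamma_orbit_ne:
  assumes w: "w permutes {1..q}" and pq: "q \<le> p" and ab: "a \<noteq> b"
  shows "gamma_orbit p q a b w \<noteq> {}"
  unfolding gamma_orbit_eq[OF assms] clan_orbit_def using gamma_adapted[OF w pq] by blast

lemma runmax_props:
  assumes w: "w permutes {1..q}" and i: "i \<in> {1..q}"
  shows "\<And>j. j \<in> {1..i} \<Longrightarrow> inv_into UNIV w j \<le> runmax w i" "\<exists>j\<in>{1..i}. inv_into UNIV w j = runmax w i" "runmax w i \<in> {i..q}"
proof -
  have fin: "finite (inv_into UNIV w ` {1..i})" and ne: "inv_into UNIV w ` {1..i} \<noteq> {}" using i by auto
  show le: "inv_into UNIV w j \<le> runmax w i" if "j \<in> {1..i}" for j unfolding runmax_def using Max_ge[OF fin] that by auto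
  show ex: "\<exists>j\<in>{1..i}. inv_into UNIV w j = runmax w i" using Max_in[OF fin ne] unfolding runmax_def by auto
  then have "runmax w i \<le> q" using inv_range(1)[OF w] i by fastforce
  \<comment> \<open>The maximum of \<open>i\<close> distinct positive integers is at least
    \<open>i\<close>.\<close>
  moreover have "i \<le> runmax w i"
  proof -
    have "inj (inv_into UNIV w)" using permutes_inv[OF w] permutes_inj by blast
    then have "i = card (inv_into UNIV w ` {1..i})" by (simp add: card_image inj_on_subset)
    also have "\<dots> \<le> card {1..runmax w i}"
    proof (intro card_mono subsetI)
      fix x assume "x \<in> inv_into UNIV w ` {1..i}"
      then obtain j where j: "j \<in> {1..i}" "x = inv_into UNIV w j" by blast
      then show "x \<in> {1..runmax w i}" using le[OF j(1)] inv_range(1)[OF w, of j] i by auto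
    qed simp
    finally show ?thesis by simp
  qed
  ultimately show "runmax w i \<in> {i..q}" by simp
qed

lemma runmax_hessenberg:
  assumes w: "w permutes {1..q}" shows "hessenberg_vector q (runmax w)"
  unfolding hessenberg_vector_def
proof (intro conjI ballI)
  show "mono_on {1..q} (runmax w)"
  proof (rule mono_onI)
    fix i j assume ij: "i \<in> {1..q}" "j \<in> {1..q}" "i \<le> j"
    then obtain k where "k \<in> {1..i}" "inv_into UNIV w k = runmax w i" using runmax_props(2)[OF w] by blast
    then show "runmax w i \<le> runmax w j" using runmax_props(1)[OF w ij(2), of k] ij by auto
  qed
qed (use runmax_props(3)[OF w] in auto)

text \<open>Let \<open>u\<close> be the inverse of \<open>w\<close>, \<open>c\<close> the value of
  the other inverse at \<open>i\<close>, and suppose \<open>u i < c\<close>. The value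
  \<open>j = w c\<close> exceeds \<open>i\<close>, because smaller values sit at the same places in
  both permutations. As \<open>c\<close> is at most the common running maximum, some
  \<open>k < i\<close> has \<open>u k > c\<close>. The places \<open>u i < c < u k\<close> then
  carry the values \<open>i\<close>, \<open>j\<close>, \<open>k\<close> with
  \<open>k < i < j\<close>, a 231 pattern in \<open>w\<close>.\<close>

lemma runmax_unique_aux:
  assumes w: "w permutes {1..q}" "w' permutes {1..q}" and av: "avoids_231 q w"
    and i: "i \<in> {1..q}" and eq: "runmax w i = runmax w' i" and prev: "\<And>j. j \<in> {1..<i} \<Longrightarrow> inv_into UNIV w j = inv_into UNIV w' j"
  shows "\<not> inv_into UNIV w i < inv_into UNIV w' i"
proof
  assume lt: "inv_into UNIV w i < inv_into UNIV w' i"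
  have inv: "inv_into UNIV w (w j) = j" "w (inv_into UNIV w j) = j" "inv_into UNIV w' (w' j) = j" "w' (inv_into UNIV w' j) = j" for j
    using permutes_inverses[OF w(1)] permutes_inverses[OF w(2)] by auto
  let ?c = "inv_into UNIV w' i"
  have c: "?c \<in> {1..q}" using inv_range(1)[OF w(2) i] .
  let ?j = "w ?c"
  have j: "?j \<in> {1..q}" using inv_range(2)[OF w(1) c] .
  have ji: "i < ?j"
  proof (rule ccontr)
    assume "\<not> i < ?j"
    then have "?j = i \<or> ?j \<in> {1..<i}" using j by auto
    moreover have "?j \<noteq> i" using lt inv(1)[of ?c] by auto
    ultimately have "inv_into UNIV w ?j = inv_into UNIV w' ?j" "?j \<noteq> i" using prev by auto
    then show False using inv by metis
  qed
  have "?c \<le> runmax w i" using runmax_props(1)[OF w(2) i, of i] i eq by simp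
  then obtain k where k: "k \<in> {1..i}" "?c \<le> inv_into UNIV w k" using runmax_props(2)[OF w(1) i] by force
  have "k \<noteq> i" using k lt by auto
  then have ki: "k < i" using k by simp
  have "inv_into UNIV w k \<noteq> ?c" using ki ji inv(2)[of k] by auto
  then have ck: "?c < inv_into UNIV w k" using k by simp
  have "inv_into UNIV w k \<le> q" "1 \<le> inv_into UNIV w i" using inv_range(1)[OF w(1)] k i by fastforce+
  moreover have "w (inv_into UNIV w k) < w (inv_into UNIV w i)" "w (inv_into UNIV w i) < w ?c" using ki ji inv by auto
  ultimately show False using av lt ck unfolding avoids_231_def by blast
qed

lemma runmax_unique:
  assumes w: "w permutes {1..q}" "w' permutes {1..q}" and av: "avoids_231 q w" "avoids_231 q w'"
    and eq: "\<And>i. i \<in> {1..q} \<Longrightarrow> runmax w i = runmax w' i"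
  shows "w = w'"
proof -
  have "inv_into UNIV w i = inv_into UNIV w' i" if "i \<in> {1..q}" for i
    using that
  proof (induction i rule: less_induct)
    case (less i)
    then have prev: "inv_into UNIV w j = inv_into UNIV w' j" if "j \<in> {1..<i}" for j using that by auto
    show ?case
      using runmax_unique_aux[OF w av(1) less.prems eq[OF less.prems] prev]
        runmax_unique_aux[OF w(2,1) av(2) less.prems eq[OF less.prems, symmetric] prev[symmetric]] by simp
  qed
  moreover have "inv_into UNIV w i = inv_into UNIV w' i" if "i \<notin> {1..q}" for i
    using that permutes_not_in[OF permutes_inv[OF w(1)]] permutes_not_in[OF permutes_inv[OF w(2)]] by simp
  ultimately have "inv_into UNIV w = inv_into UNIV w'" by blast
  then show ?thesis using permutes_inv_inv w by metis
qed

section \<open>Counting Hessenberg vectors\<close>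

text \<open>The last \<open>n\<close> entries of a Hessenberg vector of length \<open>q\<close>, all at least \<open>q + 1 - K\<close>.\<close>

definition hess_tails :: "nat \<Rightarrow> nat \<Rightarrow> nat \<Rightarrow> (nat \<Rightarrow> nat) set" where
  "hess_tails q n K = {l \<in> extensional {q + 1 - n..q}. mono_on {q + 1 - n..q} l \<and>
     (\<forall>i\<in>{q + 1 - n..q}. i \<le> l i \<and> q + 1 - K \<le> l i \<and> l i \<le> q)}"

text \<open>Ballot numbers in reflection form: the first binomial counts all increasing sequences of
  length \<open>n\<close> with \<open>K\<close> available values, the second removes those that
  violate \<open>i \<le> l i\<close> when \<open>K \<le> n + 1\<close>.\<close>

definition ballot :: "nat \<Rightarrow> nat \<Rightarrow> int" where
  "ballot n K = int ((n + K - 1) choose n) - int ((n + K - 1) choose (n + 1))"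

lemma finite_hess_tails: "finite (hess_tails q n K)"
proof (rule finite_subset)
  show "hess_tails q n K \<subseteq> {q + 1 - n..q} \<rightarrow>\<^sub>E {0..q}" by (auto simp: hess_tails_def PiE_def)
qed (auto intro: finite_PiE)

text \<open>Split by the first entry. If it exceeds the least permitted value \<open>q - K\<close>,
  monotonicity raises the lower bound for all entries; if it equals that value, delete it. The
  condition \<open>K \<le> n\<close> makes \<open>q - K\<close> admissible at position
  \<open>q - n\<close>.\<close>

lemma card_hess_tails_Suc:
  assumes "K \<le> n" "n < q"
  shows "card (hess_tails q (Suc n) (Suc K)) = card (hess_tails q (Suc n) K) + card (hess_tails q n (Suc K))"
proof -
  let ?j = "q - n" and ?c = "q - K"
  let ?f = "\<lambda>l. l(?j := ?c)"
  have I: "{q + 1 - Suc n..q} = insert ?j {q + 1 - n..q}" "?j \<notin> {q + 1 - n..q}" "?j \<le> ?c" "?c \<le> q"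
    using assms by auto
  have dec: "hess_tails q (Suc n) (Suc K) = hess_tails q (Suc n) K \<union> ?f ` hess_tails q n (Suc K)"
  proof (intro equalityI subsetI)
    fix l assume l: "l \<in> hess_tails q (Suc n) (Suc K)"
    then have ext: "l \<in> extensional (insert ?j {q + 1 - n..q})" and mono: "mono_on (insert ?j {q + 1 - n..q}) l"
      and b: "\<And>i. i \<in> insert ?j {q + 1 - n..q} \<Longrightarrow> i \<le> l i \<and> ?c \<le> l i \<and> l i \<le> q"
      unfolding hess_tails_def I by auto
    show "l \<in> hess_tails q (Suc n) K \<union> ?f ` hess_tails q n (Suc K)"
    proof (cases "l ?j = ?c")
      case True
      have "restrict l {q + 1 - n..q} \<in> hess_tails q n (Suc K)"
        using b mono by (auto simp: hess_tails_def mono_on_def)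
      moreover have "l = ?f (restrict l {q + 1 - n..q})"
        using True ext by (auto simp: fun_eq_iff extensional_def)
      ultimately show ?thesis by blast
    next
      case False
      then have gt: "q + 1 - K \<le> l ?j" using b[of ?j] assms by auto
      have "q + 1 - K \<le> l i" if i: "i \<in> insert ?j {q + 1 - n..q}" for i
      proof -
        have "?j \<le> i" using i by auto
        then have "l ?j \<le> l i" using mono_onD[OF mono, of ?j i] i by auto
        then show ?thesis using gt by simp
      qed
      then have "l \<in> hess_tails q (Suc n) K" unfolding hess_tails_def I(1) using ext mono b by blast
      then show ?thesis by (rule UnI1)
    qed
  next
    fix l assume "l \<in> hess_tails q (Suc n) K \<union> ?f ` hess_tails q n (Suc K)"
    then show "l \<in> hess_tails q (Suc n) (Suc K)"
    proof
      assume "l \<in> hess_tails q (Suc n) K"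
      moreover have "q + 1 - Suc K \<le> q + 1 - K" by simp
      ultimately show ?thesis unfolding hess_tails_def mem_Collect_eq by (meson order_trans)
    next
      assume "l \<in> ?f ` hess_tails q n (Suc K)"
      then obtain l' where l': "l' \<in> hess_tails q n (Suc K)" "l = ?f l'" by blast
      then have ext: "l' \<in> extensional {q + 1 - n..q}" and mono: "mono_on {q + 1 - n..q} l'"
        and b: "\<And>i. i \<in> {q + 1 - n..q} \<Longrightarrow> i \<le> l' i \<and> ?c \<le> l' i \<and> l' i \<le> q"
        unfolding hess_tails_def by auto
      have "mono_on (insert ?j {q + 1 - n..q}) (?f l')"
      proof (rule mono_onI)
        fix x y assume xy: "x \<in> insert ?j {q + 1 - n..q}" "y \<in> insert ?j {q + 1 - n..q}" "x \<le> y"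
        show "?f l' x \<le> ?f l' y"
        proof (cases "x = ?j")
          case True
          then show ?thesis using b[of y] xy by auto
        next
          case False
          then have "y \<noteq> ?j" using xy I(2) by auto
          then show ?thesis using False xy mono_onD[OF mono, of x y] by auto
        qed
      qed
      moreover have "?f l' \<in> extensional (insert ?j {q + 1 - n..q})" using ext by (auto simp: extensional_def)
      moreover have "\<forall>i\<in>insert ?j {q + 1 - n..q}. i \<le> ?f l' i \<and> ?c \<le> ?f l' i \<and> ?f l' i \<le> q"
        using b I by auto
      ultimately show ?thesis unfolding hess_tails_def I l' by simp
    qed
  qed
  have "hess_tails q (Suc n) K \<inter> ?f ` hess_tails q n (Suc K) = {}"
  proof -
    have "q + 1 - K \<le> l ?j" if "l \<in> hess_tails q (Suc n) K" for l
      using that unfolding hess_tails_def I by auto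
    moreover have "q - K < q + 1 - K" using assms by simp
    ultimately have "l ?j \<noteq> ?c" if "l \<in> hess_tails q (Suc n) K" for l using that by fastforce
    then have "?f l \<notin> hess_tails q (Suc n) K" for l by (metis fun_upd_same)
    then show ?thesis by blast
  qed
  moreover have "inj_on ?f (hess_tails q n (Suc K))"
  proof (rule inj_onI)
    fix l l' assume l: "l \<in> hess_tails q n (Suc K)" "l' \<in> hess_tails q n (Suc K)" "?f l = ?f l'"
    show "l = l'"
    proof (rule extensionalityI)
      show "l \<in> extensional {q + 1 - n..q}" "l' \<in> extensional {q + 1 - n..q}" using l by (auto simp: hess_tails_def)
      fix x assume "x \<in> {q + 1 - n..q}"
      then have "x \<noteq> ?j" using I(2) by auto
      then show "l x = l' x" using fun_cong[OF l(3), of x] by simp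
    qed
  qed
  ultimately show ?thesis unfolding dec using finite_hess_tails by (simp add: card_Un_disjoint card_image)
qed

lemma ballot_Suc: "ballot (Suc n) (Suc K) = ballot (Suc n) K + ballot n (Suc K)"
  by (cases "n + K") (auto simp: ballot_def)

text \<open>Boundary of the recursion: for tails of length \<open>n + 1\<close> the lower bound with
  \<open>K = n + 2\<close> is below the first index, so it allows nothing beyond
  \<open>K = n + 1\<close>. Numerically this is the symmetry of the row \<open>2 n + 1\<close> of
  Pascal's triangle.\<close>

lemma ballot_diag: "ballot (Suc n) (Suc (Suc n)) = ballot (Suc n) (Suc n)"
proof -
  have sym: "Suc (2 * n) choose n = Suc (2 * n) choose Suc n"
    using binomial_symmetric[of n "Suc (2 * n)"] by (simp add: Suc_diff_le)
  have e: "Suc n + Suc (Suc n) - 1 = Suc (Suc (2 * n))" "Suc n + Suc n - 1 = Suc (2 * n)" "Suc n + 1 = Suc (Suc n)" by simp_all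
  show ?thesis unfolding ballot_def e binomial_Suc_Suc[of "Suc (2 * n)"] sym by simp
qed

text \<open>Outer induction on the length, inner one on \<open>K\<close>. There are no tails of
  positive length for \<open>K = 0\<close>, since the entries would have to exceed
  \<open>q\<close>.\<close>

lemma card_hess_tails:
  assumes "n \<le> q" "K \<le> Suc n" "0 < n + K" shows "int (card (hess_tails q n K)) = ballot n K"
  using assms
proof (induction n arbitrary: K)
  case 0
  then have "hess_tails q 0 K = {\<lambda>_. undefined}" by (auto simp: hess_tails_def mono_on_def)
  then show ?case using 0 by (simp add: ballot_def le_Suc_eq)
next
  case (Suc n)
  note IH = Suc.IH and nq = Suc.prems(1)
  have le: "int (card (hess_tails q (Suc n) K)) = ballot (Suc n) K" if "K \<le> Suc n" for K
    using that
  proof (induction K)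
    case 0
    have "q - n \<in> {q + 1 - Suc n..q}" by auto
    then have "hess_tails q (Suc n) 0 = {}" unfolding hess_tails_def by fastforce
    then show ?case by (simp add: ballot_def binomial_eq_0)
  next
    case (Suc K)
    then show ?case using card_hess_tails_Suc[of K n q] IH[of "Suc K"] nq ballot_Suc[of n K] by simp
  qed
  show ?case
  proof (cases "K \<le> Suc n")
    case False
    then have K: "K = Suc (Suc n)" using Suc.prems by simp
    have "hess_tails q (Suc n) K = hess_tails q (Suc n) (Suc n)"
      unfolding hess_tails_def K by (intro Collect_cong conj_cong ball_cong refl) auto
    then show ?thesis using le[of "Suc n"] ballot_diag[of n] K by simp
  qed (rule le)
qed

lemma card_hessenberg:
  "real (card {l \<in> extensional {1..q}. hessenberg_vector q l}) = 1 / (real q + 1) * real ((2 * q) choose q)"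
proof -
  have "{l \<in> extensional {1..q}. hessenberg_vector q l} = hess_tails q q (Suc q)"
    by (auto simp: hess_tails_def hessenberg_vector_def)
  then have "int (card {l \<in> extensional {1..q}. hessenberg_vector q l}) = ballot q (Suc q)"
    using card_hess_tails[of q q "Suc q"] by simp
  also have "\<dots> = int ((2 * q) choose q) - int ((2 * q) choose (q + 1))" by (simp add: ballot_def mult_2)
  finally have "real (card {l \<in> extensional {1..q}. hessenberg_vector q l}) = real ((2 * q) choose q) - real ((2 * q) choose (q + 1))"
    by linarith
  moreover have "real (q + 1) * real ((2 * q) choose (q + 1)) = real q * real ((2 * q) choose q)"
  proof -
    \<comment> \<open>The absorption identities express the subtracted binomial through the central
      one and turn the difference into the Catalan quotient.\<close>
    have "Suc q * ((2 * q) choose Suc q) = (2 * q - q) * ((2 * q) choose q)"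
      by (simp only: binomial_absorption binomial_absorb_comp)
    then have "(q + 1) * ((2 * q) choose (q + 1)) = q * ((2 * q) choose q)" by simp
    then show ?thesis by (metis of_nat_mult)
  qed
  ultimately have "(real q + 1) * real (card {l \<in> extensional {1..q}. hessenberg_vector q l}) = real ((2 * q) choose q)"
    by (simp only: right_diff_distrib) (simp add: algebra_simps)
  then show ?thesis by (simp add: nonzero_eq_divide_eq mult.commute)
qed

section \<open>Irreducibility\<close>

lemma mat_polys_det_self: "\<exists>f \<in> mat_polys n. \<forall>g \<in> carrier_mat n n. f g = det g"
proof (intro bexI ballI)
  show "(\<lambda>g. det (mat n n (\<lambda>(i, j). g $$ (i, j)))) \<in> mat_polys n"
    by (intro mat_polys_det mat_polys.entry)
  fix g :: "complex mat" assume "g \<in> carrier_mat n n"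
  then have "mat n n (\<lambda>(i, j). g $$ (i, j)) = g" by (intro eq_matI) auto
  then show "det (mat n n (\<lambda>(i, j). g $$ (i, j))) = det g" by simp
qed

text \<open>If neither closed set contained the orbit, there would be adapted bases
  \<open>h1\<close> and \<open>h2\<close> whose flags miss \<open>C\<close> and \<open>D\<close>
  respectively. The equations defining adaptedness are linear, so the line joining the two satisfies
  them throughout, and for suitable \<open>t\<close> it gives a flag of the orbit missing both
  sets.\<close>

lemma irreducible_closure_clan_orbit:
  assumes ne: "clan_orbit p n \<sigma> \<epsilon> \<noteq> {}" and \<sigma>: "\<And>k. k < n \<Longrightarrow> \<sigma> k < n"
  shows "irreducible_in (zariski_flags n) (zariski_flags n closure_of clan_orbit p n \<sigma> \<epsilon>)"
  unfolding irreducible_in_def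
proof (intro conjI allI impI)
  let ?X = "zariski_flags n" and ?O = "clan_orbit p n \<sigma> \<epsilon>"
  let ?S = "?X closure_of ?O"
  have OS: "?O \<subseteq> ?S" using clan_orbit_flags by (intro closure_of_subset) simp
  show "?S \<subseteq> topspace ?X" by (rule closure_of_subset_topspace)
  show "?S \<noteq> {}" using OS ne by blast
  fix C D assume CD: "closedin (subtopology ?X ?S) C \<and> closedin (subtopology ?X ?S) D \<and> ?S = C \<union> D"
  then have cl: "closedin ?X C" "closedin ?X D" and sub: "C \<subseteq> ?S" "D \<subseteq> ?S" and un: "?S = C \<union> D"
    by (auto simp: closedin_closed_subtopology)
  have "?O \<subseteq> C \<or> ?O \<subseteq> D"
  proof (rule ccontr)
    assume "\<not> ?thesis"
    then obtain h1 h2 where h1: "adapted p n \<sigma> \<epsilon> h1" "flag n h1 \<notin> C" and h2: "adapted p n \<sigma> \<epsilon> h2" "flag n h2 \<notin> D"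
      unfolding clan_orbit_def by blast
    have b: "is_basis n h1" "is_basis n h2" using h1 h2 by (auto simp: adapted_def)
    have v: "vecs n h1" "vecs n h2" using b is_basisD by blast+
    obtain F where F: "F \<subseteq> mat_polys n" "\<And>h. is_basis n h \<Longrightarrow> flag n h \<in> C \<longleftrightarrow> (\<forall>f\<in>F. f (fmat n h) = 0)"
      using cl(1) unfolding closedin_zariski_flags by blast
    obtain G where G: "G \<subseteq> mat_polys n" "\<And>h. is_basis n h \<Longrightarrow> flag n h \<in> D \<longleftrightarrow> (\<forall>f\<in>G. f (fmat n h) = 0)"
      using cl(2) unfolding closedin_zariski_flags by blast
    obtain f where f: "f \<in> F" "f (fmat n h1) \<noteq> 0" using F(2)[OF b(1)] h1 by blast
    obtain g where g: "g \<in> G" "g (fmat n h2) \<noteq> 0" using G(2)[OF b(2)] h2 by blast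
    obtain d where d: "d \<in> mat_polys n" "\<forall>g \<in> carrier_mat n n. d g = det g" using mat_polys_det_self by blast
    define \<gamma> where "\<gamma> t k = (1 - t) \<cdot>\<^sub>v h1 k + t \<cdot>\<^sub>v h2 k" for t :: complex and k
    have v\<gamma>: "vecs n (\<gamma> t)" for t using v by (auto simp: vecs_def \<gamma>_def)
    have ent: "\<exists>P. \<forall>t. fmat n (\<gamma> t) $$ (i, j) = poly P t" if "i < n" "j < n" for i j
    proof (intro exI allI)
      fix t
      have "h1 j \<in> carrier_vec n" "h2 j \<in> carrier_vec n" using v that by auto
      then show "fmat n (\<gamma> t) $$ (i, j) = poly [:h1 j $ i, h2 j $ i - h1 j $ i:] t"
        using that by (auto simp: fmat_def \<gamma>_def algebra_simps)
    qed
    have fF: "f \<in> mat_polys n" "g \<in> mat_polys n" using f g F G by auto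
    obtain P where P: "\<And>t. f (fmat n (\<gamma> t)) = poly P t" using mat_polys_curve[OF fF(1) ent] by blast
    obtain Q where Q: "\<And>t. g (fmat n (\<gamma> t)) = poly Q t" using mat_polys_curve[OF fF(2) ent] by blast
    obtain R where R: "\<And>t. d (fmat n (\<gamma> t)) = poly R t" using mat_polys_curve[OF d(1) ent] by blast
    have \<gamma>01: "fmat n (\<gamma> 0) = fmat n h1" "fmat n (\<gamma> 1) = fmat n h2"
    proof -
      have "\<gamma> 0 k = h1 k" "\<gamma> 1 k = h2 k" if "k < n" for k
        using vecsD[OF v(1) that] vecsD[OF v(2) that] unfolding \<gamma>_def by (auto intro!: eq_vecI)
      then show "fmat n (\<gamma> 0) = fmat n h1" "fmat n (\<gamma> 1) = fmat n h2"
        by (auto simp: fmat_def intro!: eq_matI)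
    qed
    have "poly P 0 \<noteq> 0" "poly Q 1 \<noteq> 0" "poly R 0 \<noteq> 0"
      using P[of 0] Q[of 1] R[of 0] f g d(2) basis_det[OF b(1)] \<gamma>01 by auto
    \<comment> \<open>One parameter must avoid the zeros of three polynomials: an equation of
      \<open>C\<close>, nonzero at 0; an equation of \<open>D\<close>, nonzero at 1; and the
      determinant, nonzero at 0.\<close>
    then have "P * Q * R \<noteq> 0" by auto
    then have "finite {t. poly (P * Q * R) t = 0}" by (rule poly_roots_finite)
    then have "{t. poly (P * Q * R) t = 0} \<noteq> UNIV" using infinite_UNIV_char_0[where 'a = complex] by metis
    then obtain t where "poly (P * Q * R) t \<noteq> 0" by blast
    then have t: "poly P t \<noteq> 0" "poly Q t \<noteq> 0" "poly R t \<noteq> 0" by auto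
    have b\<gamma>: "is_basis n (\<gamma> t)" using is_basis_iff_det[OF v\<gamma>] t(3) R d(2) by simp
    have "sgnv p n (\<gamma> t k) = \<epsilon> k \<cdot>\<^sub>v \<gamma> t (\<sigma> k)" if k: "k < n" for k
    proof -
      have "h1 k \<in> carrier_vec n" "h2 k \<in> carrier_vec n" "h1 (\<sigma> k) \<in> carrier_vec n" "h2 (\<sigma> k) \<in> carrier_vec n"
        using v k \<sigma>[OF k] by auto
      then show ?thesis using h1(1) h2(1) k unfolding \<gamma>_def adapted_def
        by (simp add: sgnv_simps, intro eq_vecI) (auto simp: algebra_simps)
    qed
    then have "flag n (\<gamma> t) \<in> ?O" using b\<gamma> by (auto simp: clan_orbit_def adapted_def)
    then have "flag n (\<gamma> t) \<in> C \<or> flag n (\<gamma> t) \<in> D" using OS un by blast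
    then show False using F(2)[OF b\<gamma>] G(2)[OF b\<gamma>] f(1) g(1) P[of t] Q[of t] t by auto
  qed
  then show "?S = C \<or> ?S = D"
    using closure_of_minimal cl sub by (metis subset_antisym)
qed

section \<open>Maximal clans are the clans of 231-free permutations\<close>

context clan_bound
begin

text \<open>\<open>w\<close> records the partners of the last \<open>q\<close> positions, and
  \<open>u\<close> those of the first \<open>q\<close>; they are inverse to each other because
  \<open>\<sigma>\<close> is an involution.\<close>

lemma maximal_clan_gclan:
  assumes c: "clan n \<sigma> \<epsilon>" and bel: "\<And>k. k < n \<Longrightarrow> \<sigma> k < M k"
    and f1: "\<And>k. k < q \<Longrightarrow> p \<le> \<sigma> k \<and> \<sigma> k < n"
    and f2: "\<And>k. q \<le> k \<Longrightarrow> k < p \<Longrightarrow> \<sigma> k = k"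
    and f3: "\<And>k. p \<le> k \<Longrightarrow> k < n \<Longrightarrow> \<sigma> k < q"
    and f4: "\<And>k j. k < j \<Longrightarrow> j < q \<Longrightarrow> \<sigma> k < \<sigma> j \<Longrightarrow> M k \<le> \<sigma> j"
  obtains w where "w permutes {1..q}" "avoids_231 q w" "\<And>i. i \<in> {1..q} \<Longrightarrow> p + runmax w i = M (i - 1)"
    "\<And>k. k < n \<Longrightarrow> \<sigma> k = gclan p q w k"
proof -
  have inv: "\<sigma> (\<sigma> k) = k" if "k < n" for k using clanD(2)[OF c that] .
  have qn: "q \<le> n" "p \<le> n" using n by auto
  define w where "w j = (if j \<in> {1..q} then Suc (\<sigma> (p + j - 1)) else j)" for j
  define u where "u i = Suc (\<sigma> (i - 1)) - p" for i
  have u_in: "u i \<in> {1..q}" and wu: "w (u i) = i" if i: "i \<in> {1..q}" for i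
  proof -
    have s: "p \<le> \<sigma> (i - 1)" "\<sigma> (i - 1) < n" "\<sigma> (\<sigma> (i - 1)) = i - 1" using f1[of "i - 1"] inv[of "i - 1"] i qn by auto
    show "u i \<in> {1..q}" using s n by (auto simp: u_def)
    moreover have "p + u i - 1 = \<sigma> (i - 1)" using s by (simp add: u_def)
    ultimately show "w (u i) = i" using s i by (simp add: w_def)
  qed
  have w_in: "w j \<in> {1..q}" and uw: "u (w j) = j" if j: "j \<in> {1..q}" for j
  proof -
    have "\<sigma> (p + j - 1) < q" "\<sigma> (\<sigma> (p + j - 1)) = p + j - 1" using f3[of "p + j - 1"] inv[of "p + j - 1"] j n by auto
    then show "w j \<in> {1..q}" "u (w j) = j" using j by (auto simp: w_def u_def)
  qed
  have "bij_betw w {1..q} {1..q}"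
    by (rule bij_betw_byWitness[where f' = u]) (use u_in wu w_in uw in auto)
  then have w: "w permutes {1..q}" by (rule bij_imp_permutes) (auto simp: w_def)
  have invw: "inv_into UNIV w i = u i" if "i \<in> {1..q}" for i
    using permutes_inv_eq[OF w] wu[OF that] by simp
  have u_s: "p + u i = Suc (\<sigma> (i - 1))" if "i \<in> {1..q}" for i
  proof -
    have "i - 1 < q" using that by auto
    then show ?thesis using f1[of "i - 1"] by (simp add: u_def)
  qed
  \<comment> \<open>In a 231 pattern \<open>i < j < k\<close> the arcs starting at
    \<open>w i\<close> and \<open>w j\<close> cross. Since they admit no move, the partner of
    \<open>w j\<close> is beyond the bound at \<open>w i\<close>; but the partner of the smaller
    start \<open>w k\<close> is farther still and must respect a bound that is no larger.\<close>
  have av: "avoids_231 q w"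
    unfolding avoids_231_def
  proof
    assume "\<exists>i j k. 1 \<le> i \<and> i < j \<and> j < k \<and> k \<le> q \<and> w k < w i \<and> w i < w j"
    then obtain i j k where ijk: "1 \<le> i" "i < j" "j < k" "k \<le> q" "w k < w i" "w i < w j" by blast
    have r: "i \<in> {1..q}" "j \<in> {1..q}" "k \<in> {1..q}" using ijk by auto
    have s: "Suc (\<sigma> (w x - 1)) = p + x" if "x \<in> {1..q}" for x using u_s[OF w_in[OF that]] uw[OF that] by simp
    have lt: "w i - 1 < w j - 1" "w j - 1 < q" "w k - 1 < w i - 1" "w k - 1 < n"
      using ijk w_in[OF r(1)] w_in[OF r(2)] w_in[OF r(3)] qn by auto
    have "\<sigma> (w i - 1) < \<sigma> (w j - 1)" "\<sigma> (w j - 1) < \<sigma> (w k - 1)"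
      using s[OF r(1)] s[OF r(2)] s[OF r(3)] ijk by linarith+
    moreover have "M (w k - 1) \<le> M (w i - 1)" using M_mono[of "w k - 1" "w i - 1"] lt qn by simp
    ultimately show False using f4[OF lt(1,2)] bel[OF lt(4)] by linarith
  qed
  have rm: "p + runmax w i = M (i - 1)" if i: "i \<in> {1..q}" for i
  proof -
    have i1: "i - 1 < q" "i - 1 < n" using i qn by auto
    obtain j where j: "j \<in> {1..i}" "inv_into UNIV w j = runmax w i" using runmax_props(2)[OF w i] by blast
    have jq: "j \<in> {1..q}" using j i by auto
    have "p + runmax w i = Suc (\<sigma> (j - 1))" using invw[OF jq] u_s[OF jq] j by simp
    moreover have "\<sigma> (j - 1) < M (i - 1)"
    proof -
      have "j - 1 \<le> i - 1" "j - 1 < n" using j i1 by auto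
      then show ?thesis using bel[of "j - 1"] M_mono[of "j - 1" "i - 1"] i1 by linarith
    qed
    ultimately have le: "p + runmax w i \<le> M (i - 1)" by simp
    \<comment> \<open>\<open>c\<close> is the last position allowed at \<open>i\<close>. If its
      partner \<open>r\<close> came after position \<open>i - 1\<close>, the arcs starting there and
      at \<open>r\<close> would have increasing partners, and \<open>f4\<close> would put
      \<open>c\<close> outside the bound. So \<open>c\<close> is reached by one of the first
      \<open>i\<close> arcs and the running maximum attains the bound.\<close>
    define c where "c = M (i - 1) - 1"
    have cM: "M (i - 1) = Suc c" and cp: "p \<le> c" "c < n" using M_large[OF i1(1)] M_le[OF i1(2)] by (auto simp: c_def)
    define r where "r = \<sigma> c"
    have r: "r < q" "\<sigma> r = c" using f3[OF cp] inv[OF cp(2)] by (auto simp: r_def)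
    have ri: "r \<le> i - 1"
    proof (rule ccontr)
      assume "\<not> r \<le> i - 1"
      then have lt: "i - 1 < r" by simp
      have "\<sigma> (i - 1) \<noteq> c" using inv[OF i1(2)] lt by (auto simp: r_def)
      then have "\<sigma> (i - 1) < \<sigma> r" using bel[OF i1(2)] cM r(2) by simp
      then show False using f4[OF lt r(1)] r(2) cM by simp
    qed
    have "Suc r \<in> {1..q}" "Suc r \<in> {1..i}" using r ri i by auto
    then have "Suc c = p + u (Suc r)" "u (Suc r) \<le> runmax w i"
      using u_s[of "Suc r"] r(2) runmax_props(1)[OF w i, of "Suc r"] invw[of "Suc r"] by auto
    then show ?thesis using le cM by simp
  qed
  have "\<sigma> k = gclan p q w k" if k: "k < n" for k
  proof -
    consider "k < q" | "q \<le> k" "k < p" | "p \<le> k" by linarith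
    then show ?thesis
    proof cases
      case 1
      then have "Suc k \<in> {1..q}" by simp
      then show ?thesis using invw[of "Suc k"] u_s[of "Suc k"] u_in[of "Suc k"] 1 by (auto simp: gclan_def)
    next
      case 2 then show ?thesis using f2 by (simp add: gclan_def)
    next
      case 3
      then have "Suc k - p \<in> {1..q}" "p + (Suc k - p) - 1 = k" using k n by auto
      then have "w (Suc k - p) = Suc (\<sigma> k)" by (simp add: w_def)
      then show ?thesis using 3 q by (simp add: gclan_def)
    qed
  qed
  then show thesis using that w av rm by blast
qed

end

section \<open>Coordinate flags\<close>

lemma unit_flag_adapted:
  assumes \<pi>: "bij_betw \<pi> {..<p + q} {..<p + q}"
  shows "adapted p (p + q) id (\<lambda>k. if \<pi> k < p then 1 else -1) (\<lambda>k. unit_vec (p + q) (\<pi> k))"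
    "clan (p + q) id (\<lambda>k. if \<pi> k < p then 1 else -1)"
proof -
  let ?n = "p + q" and ?h = "\<lambda>k. unit_vec (p + q) (\<pi> k) :: complex vec"
  have v: "vecs ?n ?h" by (auto simp: vecs_def)
  have "is_basis ?n ?h"
  proof (rule is_basisI_span[OF v])
    fix k assume "k < ?n"
    then have "k \<in> \<pi> ` {..<?n}" using bij_betw_imp_surj_on[OF \<pi>] by simp
    then obtain j where j: "j < ?n" "\<pi> j = k" by auto
    then show "unit_vec ?n k \<in> vspan ?n ?h ?n" using vspan_mem[OF v j(1)] by simp
  qed
  moreover have "sgnv p ?n (unit_vec ?n i) = (if i < p then 1 else -1) \<cdot>\<^sub>v unit_vec ?n i" if "i < ?n" for i
    using that by (intro eq_vecI) (auto simp: sgnv_def)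
  moreover have "\<pi> k < ?n" if "k < ?n" for k using \<pi> that by (auto simp: bij_betw_def)
  ultimately show "adapted p ?n id (\<lambda>k. if \<pi> k < p then 1 else -1) ?h" by (simp add: adapted_def)
  show "clan ?n id (\<lambda>k. if \<pi> k < p then 1 else -1)" by (auto simp: clan_def)
qed

text \<open>Coordinate flags consist of subspaces stable under the diagonal matrix, so they lie in
  every Hessenberg variety of it. They serve as witnesses of nonemptiness and of properness of
  closed subsets.\<close>

lemma unit_flag_Hess:
  assumes \<pi>: "bij_betw \<pi> {..<p + q} {..<p + q}" and ab: "a \<noteq> b" and m: "hessenberg_vector (p + q) m"
  shows "flag (p + q) (\<lambda>k. unit_vec (p + q) (\<pi> k)) \<in> Hess (p + q) (x_pq p q a b) m"
  using adapted_Hess_iff[OF unit_flag_adapted[OF \<pi>] ab m] m by (auto simp: hessenberg_vector_def Suc_le_eq[symmetric])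

lemma vspan_unit_zero:
  assumes "u \<in> vspan n (\<lambda>k. unit_vec n (\<pi> k)) j" "s < n" "s \<notin> \<pi> ` {..<j}" "\<And>k. k < j \<Longrightarrow> \<pi> k < n"
  shows "u $ s = 0"
proof -
  let ?S = "{u \<in> carrier_vec n. u $ s = (0 :: complex)}"
  have "vspan n (\<lambda>k. unit_vec n (\<pi> k)) j \<subseteq> ?S"
    by (rule vspan_least) (use assms(2-4) in auto)
  then show ?thesis using assms by blast
qed

section \<open>Hessenberg varieties satisfying condition (2), and the resulting bijection\<close>

lemma gamma_orbit_subset_Hess_iff:
  assumes w: "w permutes {1..q}" and pq: "q \<le> p" and ab: "a \<noteq> b" and m: "hessenberg_vector (p + q) m"
  shows "gamma_orbit p q a b w \<subseteq> Hess (p + q) (x_pq p q a b) m \<longleftrightarrow> (\<forall>k<p + q. gclan p q w k < m (Suc k))"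
  unfolding gamma_orbit_eq[OF w pq ab]
  using adapted_Hess_iff[OF _ gclan_clan[OF w pq] ab m] gamma_adapted[OF w pq] by (auto simp: clan_orbit_def)

text \<open>Condition (2) for a given \<open>l\<close>.\<close>

definition shifted :: "nat \<Rightarrow> nat \<Rightarrow> (nat \<Rightarrow> nat) \<Rightarrow> (nat \<Rightarrow> nat) \<Rightarrow> bool" where
  "shifted p q m l \<longleftrightarrow> hessenberg_vector q l \<and> (\<forall>i\<in>{1..q}. m i = l i + p) \<and> (\<forall>i\<in>{q<..p + q}. m i = p + q)"

text \<open>Only the first \<open>q\<close> positions impose a condition, as the bound is
  \<open>n\<close> afterwards. Since \<open>l\<close> is increasing, bounding each partner is the
  same as bounding the running maximum.\<close>

lemma gclan_below_iff:
  assumes w: "w permutes {1..q}" and pq: "1 \<le> q" "q \<le> p" and m: "shifted p q m l"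
  shows "(\<forall>k<p + q. gclan p q w k < m (Suc k)) \<longleftrightarrow> (\<forall>i\<in>{1..q}. runmax w i \<le> l i)"
proof
  assume a: "\<forall>k<p + q. gclan p q w k < m (Suc k)"
  show "\<forall>i\<in>{1..q}. runmax w i \<le> l i"
  proof
    fix i assume i: "i \<in> {1..q}"
    obtain j where j: "j \<in> {1..i}" "inv_into UNIV w j = runmax w i" using runmax_props(2)[OF w i] by blast
    have jq: "j \<in> {1..q}" using j i by auto
    have "j - 1 < p + q" using jq by auto
    then have "gclan p q w (j - 1) < m (Suc (j - 1))" using a by blast
    moreover have "gclan p q w (j - 1) = p + (runmax w i - 1)" "Suc (j - 1) = j" using jq j by (auto simp: gclan_def)
    ultimately have "p + (runmax w i - 1) < l j + p" using m jq by (simp add: shifted_def)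
    moreover have "l j \<le> l i" using m j jq i by (auto simp: shifted_def hessenberg_vector_def mono_on_def)
    ultimately show "runmax w i \<le> l i" by simp
  qed
next
  assume a: "\<forall>i\<in>{1..q}. runmax w i \<le> l i"
  show "\<forall>k<p + q. gclan p q w k < m (Suc k)"
  proof (intro allI impI)
    fix k assume k: "k < p + q"
    show "gclan p q w k < m (Suc k)"
    proof (cases "k < q")
      case True
      then have kq: "Suc k \<in> {1..q}" by simp
      have "inv_into UNIV w (Suc k) \<le> runmax w (Suc k)" "1 \<le> inv_into UNIV w (Suc k)"
        using runmax_props(1)[OF w kq, of "Suc k"] inv_range(1)[OF w kq] by auto
      then have "inv_into UNIV w (Suc k) - 1 < l (Suc k)" using a kq by fastforce
      then show ?thesis using True m kq by (simp add: gclan_def shifted_def)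
    next
      case False
      then show ?thesis using clanD(1)[OF gclan_clan[OF w pq(2)] k] m k by (auto simp: shifted_def)
    qed
  qed
qed

lemma shifted_hessenberg:
  assumes "1 \<le> q" "q \<le> p" "hessenberg_vector q l"
  obtains m where "hessenberg_vector (p + q) m" "shifted p q m l"
proof -
  define m where "m i = (if i \<le> q then l i + p else p + q)" for i
  have l: "\<And>i. i \<in> {1..q} \<Longrightarrow> i \<le> l i \<and> l i \<le> q" "\<And>i j. i \<in> {1..q} \<Longrightarrow> j \<in> {1..q} \<Longrightarrow> i \<le> j \<Longrightarrow> l i \<le> l j"
    using assms(3) by (auto simp: hessenberg_vector_def mono_on_def)
  have "mono_on {1..p + q} m"
    by (rule mono_onI) (use l in \<open>auto simp: m_def\<close>)
  moreover have "i \<le> m i \<and> m i \<le> p + q" if "i \<in> {1..p + q}" for i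
    using l(1)[of i] that by (auto simp: m_def)
  ultimately have "hessenberg_vector (p + q) m" by (simp add: hessenberg_vector_def)
  moreover have "shifted p q m l" using assms(3) by (auto simp: shifted_def m_def)
  ultimately show thesis using that by blast
qed

text \<open>Pushing clans upward shows that the variety lies in the closure of the union
  \<open>T\<close> of all candidate orbits. There is at most one candidate by uniqueness, and at
  least one because the variety is nonempty.\<close>

lemma Hess_shifted:
  assumes pq: "1 \<le> q" "q \<le> p" and ab: "a \<noteq> b" and m: "hessenberg_vector (p + q) m" and sh: "shifted p q m l"
  obtains w where "w permutes {1..q}" "avoids_231 q w" "\<And>i. i \<in> {1..q} \<Longrightarrow> runmax w i = l i"
    "Hess (p + q) (x_pq p q a b) m = zariski_flags (p + q) closure_of gamma_orbit p q a b w"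
proof -
  let ?n = "p + q" and ?X = "zariski_flags (p + q)" and ?H = "Hess (p + q) (x_pq p q a b) m" and ?M = "\<lambda>k. m (Suc k)"
  have l: "\<And>i. i \<in> {1..q} \<Longrightarrow> i \<le> l i" "\<And>i. i \<in> {1..q} \<Longrightarrow> m i = l i + p"
    using sh by (auto simp: shifted_def hessenberg_vector_def)
  interpret clan_bound p q ?n ?M
  proof
    show "p + k < m (Suc k)" if "k < q" for k using l[of "Suc k"] that by auto
    show "m (Suc k) \<le> ?n" "k < m (Suc k)" if "k < ?n" for k
      using m that by (auto simp: hessenberg_vector_def Suc_le_eq[symmetric])
    show "m (Suc i) \<le> m (Suc j)" if "i \<le> j" "j < ?n" for i j
      using m that by (auto simp: hessenberg_vector_def mono_on_def)
  qed (use pq in auto)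
  define W where "W = {w. w permutes {1..q} \<and> avoids_231 q w \<and> (\<forall>i\<in>{1..q}. runmax w i = l i)}"
  define T where "T = (\<Union>w\<in>W. gamma_orbit p q a b w)"
  have T_flags: "T \<subseteq> flags ?n"
    unfolding T_def W_def using gamma_orbit_eq[OF _ pq(2) ab] clan_orbit_flags by blast
  have HT: "?H \<subseteq> ?X closure_of T"
  proof
    fix V assume V: "V \<in> ?H"
    then have "V \<in> flags ?n" by (auto simp: Hess_def)
    then obtain g where g: "is_basis ?n g" "V = flag ?n g" using flags_surj by blast
    obtain \<sigma> \<epsilon> h where h: "clan ?n \<sigma> \<epsilon>" "adapted p ?n \<sigma> \<epsilon> h" "flag ?n h = V"
      using normal_form[OF g(1), of p] g(2) by metis
    have bel: "\<sigma> k < m (Suc k)" if "k < ?n" for k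
      using adapted_Hess_iff[OF h(2,1) ab m] h(3) V that by simp
    have "flag ?n h \<in> ?X closure_of T"
    proof (rule closure_of_maximal[OF h(1) bel h(2) T_flags])
      fix \<sigma> \<epsilon> h
      assume c: "clan ?n \<sigma> \<epsilon>" and ad: "adapted p ?n \<sigma> \<epsilon> h" and bel: "\<And>k. k < ?n \<Longrightarrow> \<sigma> k < m (Suc k)"
        and f1: "\<And>k. k < q \<Longrightarrow> p \<le> \<sigma> k \<and> \<sigma> k < ?n" and f2: "\<And>k. q \<le> k \<Longrightarrow> k < p \<Longrightarrow> \<sigma> k = k \<and> \<epsilon> k = 1"
        and f3: "\<And>k. p \<le> k \<Longrightarrow> k < ?n \<Longrightarrow> \<sigma> k < q"
        and f4: "\<And>k j. k < j \<Longrightarrow> j < q \<Longrightarrow> \<sigma> k < \<sigma> j \<Longrightarrow> m (Suc k) \<le> \<sigma> j"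
      obtain w where w: "w permutes {1..q}" "avoids_231 q w" "\<And>i. i \<in> {1..q} \<Longrightarrow> p + runmax w i = m (Suc (i - 1))"
        "\<And>k. k < ?n \<Longrightarrow> \<sigma> k = gclan p q w k"
        using maximal_clan_gclan[OF c bel f1 conjunct1[OF f2] f3 f4] by blast
      have "w \<in> W" using w(1,2) w(3) l(2) by (auto simp: W_def)
      \<comment> \<open>Positions in the two outer ranges are exchanged by \<open>\<sigma>\<close>,
        so they lie on arcs, whose sign is 1 in any clan.\<close>
      moreover have "\<epsilon> k = 1" if k: "k < ?n" for k
      proof (cases "q \<le> k \<and> k < p")
        case False
        then have "\<sigma> k \<noteq> k" using f1[of k] f3[of k] k pq by (cases "k < q") auto
        then show ?thesis using clanD(3)[OF c k] by blast
      qed (use f2 in blast)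
      then have "adapted p ?n (gclan p q w) (\<lambda>_. 1) h" using ad w(4) by (simp add: adapted_def)
      then have "flag ?n h \<in> gamma_orbit p q a b w" unfolding gamma_orbit_eq[OF w(1) pq(2) ab] clan_orbit_def by blast
      ultimately show "flag ?n h \<in> T" unfolding T_def by blast
    qed
    then show "V \<in> ?X closure_of T" using h(3) by simp
  qed
  \<comment> \<open>The closure of an empty union would be empty, so one flag in the variety proves
    that a suitable permutation exists.\<close>
  have "flag ?n (\<lambda>k. unit_vec ?n (id k)) \<in> ?H" by (rule unit_flag_Hess[OF bij_betw_id ab m])
  then have "T \<noteq> {}" using HT by auto
  then obtain w where w: "w \<in> W" by (auto simp: T_def)
  have "W = {w}"
  proof -
    have "w' = w" if "w' \<in> W" for w'
      using that w runmax_unique[of w' q w] by (auto simp: W_def)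
    then show ?thesis using w by blast
  qed
  then have T: "T = gamma_orbit p q a b w" by (simp add: T_def)
  have wp: "w permutes {1..q}" "avoids_231 q w" "\<And>i. i \<in> {1..q} \<Longrightarrow> runmax w i = l i" using w by (auto simp: W_def)
  have "gamma_orbit p q a b w \<subseteq> ?H"
    using gamma_orbit_subset_Hess_iff[OF wp(1) pq(2) ab m] gclan_below_iff[OF wp(1) pq sh] wp(3) by simp
  then have "?X closure_of gamma_orbit p q a b w \<subseteq> ?H"
    by (rule closure_of_minimal[OF _ closedin_Hess[OF x_pq_carrier m]])
  then have "?H = ?X closure_of gamma_orbit p q a b w" using HT T by blast
  then show thesis using that wp by blast
qed

text \<open>The orbit determines the running maximum: \<open>runmax w\<close> is the least
  \<open>l\<close> whose Hessenberg variety contains it. Equal orbits therefore bound each other's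
  running maxima, and these determine a 231-free permutation.\<close>

lemma gamma_orbit_inj:
  assumes pq: "1 \<le> q" "q \<le> p" and ab: "a \<noteq> b"
  shows "inj_on (gamma_orbit p q a b) {w. w permutes {1..q} \<and> avoids_231 q w}"
proof (rule inj_onI)
  have le: "runmax w' i \<le> runmax w i"
    if w: "w permutes {1..q}" "w' permutes {1..q}" and eq: "gamma_orbit p q a b w = gamma_orbit p q a b w'" and i: "i \<in> {1..q}" for w w' i
  proof -
    obtain m where m: "hessenberg_vector (p + q) m" "shifted p q m (runmax w)"
      using shifted_hessenberg[OF pq runmax_hessenberg[OF w(1)]] .
    have "gamma_orbit p q a b w' \<subseteq> Hess (p + q) (x_pq p q a b) m"
      using gamma_orbit_subset_Hess_iff[OF w(1) pq(2) ab m(1)] gclan_below_iff[OF w(1) pq m(2)] eq by simp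
    then show ?thesis
      using gamma_orbit_subset_Hess_iff[OF w(2) pq(2) ab m(1)] gclan_below_iff[OF w(2) pq m(2)] i by simp
  qed
  fix w w' assume w: "w \<in> {w. w permutes {1..q} \<and> avoids_231 q w}" "w' \<in> {w. w permutes {1..q} \<and> avoids_231 q w}"
    "gamma_orbit p q a b w = gamma_orbit p q a b w'"
  then show "w = w'"
    using runmax_unique[of w q w'] le[of w w'] le[of w' w] by (simp add: le_antisym)
qed

text \<open>The running maximum is a bijection onto Hessenberg vectors of length \<open>q\<close>.
  Injectivity is \<open>runmax_unique\<close>; surjectivity comes from \<open>Hess_shifted\<close>
  for the auxiliary case \<open>p = q\<close> with eigenvalues 0 and 1.\<close>

lemma card_avoids_231:
  "real (card {w. w permutes {1..q} \<and> avoids_231 q w}) = 1 / (real q + 1) * real ((2 * q) choose q)" if q: "1 \<le> q"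
proof -
  let ?A = "{w. w permutes {1..q} \<and> avoids_231 q w}" and ?L = "{l \<in> extensional {1..q}. hessenberg_vector q l}"
  let ?r = "\<lambda>w. restrict (runmax w) {1..q}"
  have hr: "hessenberg_vector q (restrict l {1..q})" if "hessenberg_vector q l" for l
    using that by (auto simp: hessenberg_vector_def mono_on_def)
  have "bij_betw ?r ?A ?L"
    unfolding bij_betw_def
  proof (intro conjI equalityI subsetI)
    show "inj_on ?r ?A"
    proof (rule inj_onI)
      fix w w' assume w: "w \<in> ?A" "w' \<in> ?A" "?r w = ?r w'"
      have "runmax w i = runmax w' i" if "i \<in> {1..q}" for i using fun_cong[OF w(3), of i] that by simp
      then show "w = w'" using runmax_unique[of w q w'] w by simp
    qed
    fix l
    { assume "l \<in> ?r ` ?A" then show "l \<in> ?L" using hr runmax_hessenberg by auto }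
    { assume l: "l \<in> ?L"
      obtain m where m: "hessenberg_vector (q + q) m" "shifted q q m l"
        using shifted_hessenberg[OF q order_refl, of l] l by blast
      obtain w where w: "w permutes {1..q}" "avoids_231 q w" "\<And>i. i \<in> {1..q} \<Longrightarrow> runmax w i = l i"
        by (rule Hess_shifted[OF q order_refl zero_neq_one m]) (rule that)
      have "?r w = l" using w(3) l by (auto simp: extensional_def restrict_def)
      then show "l \<in> ?r ` ?A" using w by blast }
  qed
  then show ?thesis using card_hessenberg[of q] by (simp add: bij_betw_same_card)
qed

section \<open>Reducibility when condition (2) fails\<close>

lemma minus_part_vspan:
  assumes ab: "a \<noteq> b" and b: "is_basis (p + q) h" and m: "hessenberg_vector (p + q) m"
    and H: "flag (p + q) h \<in> Hess (p + q) (x_pq p q a b) m" and c: "c < i" "i \<le> p + q" "1 \<le> i"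
  shows "(1/2) \<cdot>\<^sub>v (h c - sgnv p (p + q) (h c)) \<in> vspan (p + q) h (m i)"
proof -
  let ?n = "p + q"
  have v: "vecs ?n h" using b is_basisD by blast
  have mi: "m i \<le> ?n" "i \<le> m i" using m c by (auto simp: hessenberg_vector_def)
  have cn: "c < ?n" using c by simp
  have hc: "h c \<in> carrier_vec ?n" using v cn by simp
  have "m (Suc c) \<le> m i" using m c by (auto simp: hessenberg_vector_def mono_on_def)
  then have x: "x_pq p q a b *\<^sub>v h c \<in> vspan ?n h (m i)"
    using H cn vspan_mono[OF v _ mi(1)] unfolding Hess_iff[OF b x_pq_carrier m] by blast
  have hm: "h c \<in> vspan ?n h (m i)" using vspan_mem[OF v _ mi(1)] c mi by simp
  \<comment> \<open>The projection onto the last \<open>q\<close> coordinates is an affine function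
    of the matrix, so it sends member \<open>i\<close> of the flag into member \<open>m i\<close> as
    well.\<close>
  have "(1/2) \<cdot>\<^sub>v (h c - sgnv p ?n (h c)) = (- 1 / (a - b)) \<cdot>\<^sub>v (x_pq p q a b *\<^sub>v h c - a \<cdot>\<^sub>v h c)"
    unfolding x_pq_mult[OF hc] using hc ab by (intro eq_vecI) (auto simp: field_simps)
  then show ?thesis using x hm vspan_smult[OF v mi(1)] vspan_minus[OF v mi(1)] by auto
qed

text \<open>Let \<open>N\<close> be the projection onto the last \<open>q\<close> coordinates. It
  maps \<open>V i\<close> into \<open>V (m i)\<close>, and modulo \<open>V p\<close> the latter has
  dimension below \<open>i\<close>. So some nonzero \<open>u\<close> in \<open>V i\<close> has
  \<open>N u\<close> in \<open>V p\<close>. If \<open>N u = 0\<close>, then \<open>u\<close> gives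
  the first alternative; otherwise \<open>N u\<close> gives the second.\<close>

lemma Hess_cover:
  assumes ab: "a \<noteq> b" and m: "hessenberg_vector (p + q) m" and i: "i \<in> {1..q}" "q \<le> p" and mi: "m i < p + i"
    and V: "V \<in> Hess (p + q) (x_pq p q a b) m"
  shows "(\<exists>u\<in>V i. u \<noteq> 0\<^sub>v (p + q) \<and> (\<forall>r<i. u $ (p + r) = 0)) \<or>
    (\<exists>u\<in>V p. u \<noteq> 0\<^sub>v (p + q) \<and> (\<forall>r<p. u $ (0 + r) = 0))"
proof -
  let ?n = "p + q"
  have "V \<in> flags ?n" using V by (auto simp: Hess_def)
  then obtain h where b: "is_basis ?n h" and Vh: "V = flag ?n h" using flags_surj by blast
  have v: "vecs ?n h" using b is_basisD by blast
  have min: "m i \<le> ?n" using m i by (auto simp: hessenberg_vector_def)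
  let ?N = "\<lambda>u. (1/2) \<cdot>\<^sub>v (u - sgnv p ?n u)"
  have hc: "h c \<in> carrier_vec ?n" if "c < i" for c using v that i by auto
  have "?N (h c) \<in> vspan ?n h (m i)" if "c < i" for c
    using minus_part_vspan[OF ab b m V[unfolded Vh] that] i by auto
  then have "\<forall>c. \<exists>z. c < i \<longrightarrow> z \<in> carrier_vec ?n \<and> (\<forall>k. m i \<le> k \<and> k < ?n \<longrightarrow> z $ k = 0) \<and> ?N (h c) = fmat ?n h *\<^sub>v z"
    unfolding vspan_coords[OF v min] by blast
  then obtain z where z: "\<And>c. c < i \<Longrightarrow> z c \<in> carrier_vec ?n \<and> (\<forall>k. m i \<le> k \<and> k < ?n \<longrightarrow> z c $ k = 0) \<and> ?N (h c) = fmat ?n h *\<^sub>v z c"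
    by metis
  \<comment> \<open>Column \<open>c\<close> holds the coordinates \<open>p, ..., p + i - 1\<close>
    of \<open>N (h c)\<close> in the basis \<open>h\<close>. The last row is zero because
    \<open>m i < p + i\<close>, so \<open>A\<close> is singular; a kernel vector \<open>y\<close>
    gives the coefficients of \<open>u\<close>.\<close>
  define A where "A = mat i i (\<lambda>(r, c). z c $ (p + r))"
  have A: "A \<in> carrier_mat i i" by (simp add: A_def)
  have "det A = 0"
  proof -
    have "A\<^sup>T *\<^sub>v unit_vec i (i - 1) = 0\<^sub>v i"
    proof (rule eq_vecI)
      fix c assume "c < dim_vec (0\<^sub>v i)"
      then have c: "c < i" by simp
      have "p + (i - 1) < ?n" "m i \<le> p + (i - 1)" using i mi by auto
      then have "z c $ (p + (i - 1)) = 0" using z[OF c] by blast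
      then show "(A\<^sup>T *\<^sub>v unit_vec i (i - 1)) $ c = 0\<^sub>v i $ c"
        using c mult_unit_vec[of "A\<^sup>T" i "i - 1"] A by (simp add: A_def)
    qed (use A in auto)
    moreover have "unit_vec i (i - 1) \<noteq> (0\<^sub>v i :: complex vec)"
    proof
      assume "unit_vec i (i - 1) = (0\<^sub>v i :: complex vec)"
      from arg_cong[OF this, of "\<lambda>v. v $ (i - 1)"] show False using i by simp
    qed
    moreover have "A\<^sup>T \<in> carrier_mat i i" using A by simp
    ultimately have "det (A\<^sup>T) = 0" using det_0_iff_vec_prod_zero[of "A\<^sup>T" i] unit_vec_carrier by blast
    then show ?thesis using det_transpose[OF A] by simp
  qed
  then obtain y where y: "y \<in> carrier_vec i" "y \<noteq> 0\<^sub>v i" "A *\<^sub>v y = 0\<^sub>v i"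
    using det_0_iff_vec_prod_zero[OF A] by blast
  define y' where "y' = vec ?n (\<lambda>k. if k < i then y $ k else 0)"
  define u where "u = fmat ?n h *\<^sub>v y'"
  \<comment> \<open>Coordinates of \<open>N u\<close> in the basis \<open>h\<close>: those from
    \<open>p\<close> to \<open>p + i - 1\<close> vanish by the choice of \<open>y\<close>, the later
    ones because they are not below \<open>m i\<close>.\<close>
  define x where "x = vec ?n (\<lambda>k. \<Sum>c<i. y $ c * z c $ k)"
  have i_n: "i \<le> ?n" "i \<le> p" using i by auto
  have uV: "u \<in> V i"
    unfolding Vh flag_nth[OF _ i_n(1)] u_def using i vspan_coords[OF v i_n(1)] by (force simp: y'_def flag_nth)
  have "y' \<noteq> 0\<^sub>v ?n"
  proof
    assume y0: "y' = 0\<^sub>v ?n"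
    have "y $ k = 0" if "k < i" for k using arg_cong[OF y0, of "\<lambda>v. v $ k"] that i_n by (simp add: y'_def)
    then have "y = 0\<^sub>v i" using y(1) by (intro eq_vecI) auto
    then show False using y by simp
  qed
  then have u0: "u \<noteq> 0\<^sub>v ?n"
  proof -
    have "y' \<in> carrier_vec ?n" by (simp add: y'_def)
    then show ?thesis
      unfolding u_def using det_0_iff_vec_prod_zero[OF fmat_carrier, of ?n h] basis_det[OF b] \<open>y' \<noteq> 0\<^sub>v ?n\<close> by blast
  qed
  have u_nth: "u $ k = (\<Sum>c<i. y $ c * h c $ k)" if "k < ?n" for k
  proof -
    have "u $ k = (\<Sum>c\<in>{0..<?n}. h c $ k * (if c < i then y $ c else 0))"
      using that by (simp add: u_def y'_def fmat_def scalar_prod_def)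
    also have "\<dots> = (\<Sum>c<i. h c $ k * y $ c)" using i_n by (intro sum.mono_neutral_cong_right) auto
    finally show ?thesis by (simp add: mult.commute)
  qed
  have Nu_nth: "?N u $ k = (if k < p then 0 else u $ k)" if "k < ?n" for k
    using that by (auto simp: sgnv_def u_def)
  have Nh_nth: "?N (h c) $ k = (if k < p then 0 else h c $ k)" if "k < ?n" "c < i" for k c
    using that hc[OF that(2)] by (auto simp: sgnv_def)
  have Nu: "?N u = fmat ?n h *\<^sub>v x"
  proof (rule eq_vecI)
    fix k assume "k < dim_vec (fmat ?n h *\<^sub>v x)"
    then have k: "k < ?n" by (simp add: fmat_def)
    have "?N u $ k = (\<Sum>c<i. y $ c * ?N (h c) $ k)"
      using Nu_nth[OF k] Nh_nth[OF k] u_nth[OF k] by simp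
    also have "\<dots> = (\<Sum>c<i. y $ c * (\<Sum>j<?n. h j $ k * z c $ j))"
    proof (rule sum.cong[OF refl])
      fix c assume "c \<in> {..<i}"
      then have "?N (h c) = fmat ?n h *\<^sub>v z c" "z c \<in> carrier_vec ?n" using z by auto
      then have "?N (h c) $ k = (\<Sum>j<?n. h j $ k * z c $ j)"
        using k by (simp add: fmat_def scalar_prod_def atLeast0LessThan)
      then show "y $ c * ?N (h c) $ k = y $ c * (\<Sum>j<?n. h j $ k * z c $ j)" by simp
    qed
    also have "\<dots> = (\<Sum>j<?n. \<Sum>c<i. h j $ k * (y $ c * z c $ j))"
      by (simp add: sum_distrib_left mult.left_commute) (rule sum.swap)
    also have "\<dots> = (fmat ?n h *\<^sub>v x) $ k"
      using k by (simp add: x_def fmat_def scalar_prod_def atLeast0LessThan sum_distrib_left)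
    finally show "?N u $ k = (fmat ?n h *\<^sub>v x) $ k" .
  qed (simp add: fmat_def)
  have "x $ k = 0" if k: "p \<le> k" "k < ?n" for k
  proof (cases "k - p < i")
    case True
    have "(A *\<^sub>v y) $ (k - p) = (\<Sum>c<i. z c $ (p + (k - p)) * y $ c)"
      using True y(1) by (simp add: A_def scalar_prod_def atLeast0LessThan)
    then show ?thesis using y(3) k True by (simp add: x_def mult.commute)
  next
    case False
    then have "z c $ k = 0" if "c < i" for c using z[OF that] mi k by auto
    then show ?thesis using k by (simp add: x_def)
  qed
  then have NV: "?N u \<in> V p"
    unfolding Vh Nu using vspan_coords[OF v, of p] i i_n by (force simp: flag_nth x_def)
  show ?thesis
  proof (cases "?N u = 0\<^sub>v ?n")
    case True
    have "u $ (p + r) = 0" if "r < i" for r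
      using Nu_nth[of "p + r"] True that i by auto
    then show ?thesis using uV u0 by blast
  next
    case False
    have "?N u $ (0 + r) = 0" if "r < p" for r using Nu_nth[of r] that by simp
    then show ?thesis using NV False by blast
  qed
qed

text \<open>The two alternatives of \<open>Hess_cover\<close> are closed conditions given by minors.
  Each fails at some coordinate flag of the variety, so the cover consists of proper
  subsets.\<close>

lemma irreducible_imp_large:
  assumes ab: "a \<noteq> b" and m: "hessenberg_vector (p + q) m" and i: "i \<in> {1..q}" and pq: "q \<le> p"
    and irr: "irreducible_in (zariski_flags (p + q)) (Hess (p + q) (x_pq p q a b) m)"
  shows "p + i \<le> m i"
proof (rule ccontr)
  assume "\<not> ?thesis"
  then have mi: "m i < p + i" by simp
  let ?n = "p + q" and ?X = "zariski_flags (p + q)" and ?H = "Hess (p + q) (x_pq p q a b) m"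
  let ?C = "{V \<in> flags ?n. \<exists>u\<in>V i. u \<noteq> 0\<^sub>v ?n \<and> (\<forall>r<i. u $ (p + r) = 0)}"
  let ?D = "{V \<in> flags ?n. \<exists>u\<in>V p. u \<noteq> 0\<^sub>v ?n \<and> (\<forall>r<p. u $ (0 + r) = 0)}"
  have cl: "closedin ?X ?C" "closedin ?X ?D" "closedin ?X ?H"
    using closedin_minor[of i p ?n] closedin_minor[of p 0 ?n] closedin_Hess[OF x_pq_carrier m] i pq by auto
  have Hf: "?H \<subseteq> flags ?n" by (auto simp: Hess_def)
  have un: "?H = (?H \<inter> ?C) \<union> (?H \<inter> ?D)"
  proof (intro equalityI subsetI)
    fix V assume V: "V \<in> ?H"
    then show "V \<in> (?H \<inter> ?C) \<union> (?H \<inter> ?D)" using Hess_cover[OF ab m i pq mi V] Hf by blast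
  qed (auto simp only: Un_iff Int_iff)
  have "closedin (subtopology ?X ?H) (?H \<inter> ?C)" "closedin (subtopology ?X ?H) (?H \<inter> ?D)"
    unfolding closedin_closed_subtopology[OF cl(3)] by (intro conjI closedin_Int cl Int_lower1)+
  note split = conjI[OF this(1) conjI[OF this(2) un]]
  have "?H = ?H \<inter> ?C \<or> ?H = ?H \<inter> ?D"
    by (rule irr[unfolded irreducible_in_def, THEN conjunct2, THEN conjunct2, rule_format, OF split])
  moreover have sub: "A \<subseteq> B" if "A = A \<inter> B" for A B :: "(nat \<Rightarrow> complex vec set) set" using that by blast
  ultimately have "?H \<subseteq> ?C \<or> ?H \<subseteq> ?D" by (elim disjE) (rule disjI1, erule sub, rule disjI2, erule sub)
  then consider "?H \<subseteq> ?C" | "?H \<subseteq> ?D" by (rule disjE)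
  then show False
  proof cases
    case 1
    \<comment> \<open>The last \<open>q\<close> unit vectors come first, so member \<open>i\<close>
      is spanned by the coordinates \<open>p, ..., p + i - 1\<close> and contains no nonzero vector
      vanishing there.\<close>
    define \<pi> where "\<pi> k = (if k < q then p + k else k - q)" for k
    have \<pi>: "bij_betw \<pi> {..<?n} {..<?n}"
      by (rule bij_betw_byWitness[where f' = "\<lambda>k. if k < p then k + q else k - p"]) (auto simp: \<pi>_def)
    let ?h = "\<lambda>k. unit_vec ?n (\<pi> k) :: complex vec"
    have "flag ?n ?h \<in> ?H" by (rule unit_flag_Hess[OF \<pi> ab m])
    then have "flag ?n ?h \<in> ?C" by (rule subsetD[OF 1])
    then obtain u where u: "u \<in> vspan ?n ?h i" "u \<noteq> 0\<^sub>v ?n" "\<And>r. r < i \<Longrightarrow> u $ (p + r) = 0"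
      using i by (auto simp: flag_nth)
    have "vecs ?n ?h" by (simp add: vecs_def)
    then have uc: "u \<in> carrier_vec ?n" using vspan_carrier[of ?n ?h i] u(1) i by auto
    have "u $ s = 0" if s: "s < ?n" for s
    proof (cases "p \<le> s \<and> s < p + i")
      case True
      then show ?thesis using u(3)[of "s - p"] by auto
    next
      case False
      then have "s \<notin> \<pi> ` {..<i}" using i by (auto simp: \<pi>_def)
      moreover have "\<pi> k < ?n" if "k < i" for k using that i by (auto simp: \<pi>_def)
      ultimately show ?thesis using vspan_unit_zero[OF u(1) s] by blast
    qed
    then have "u = 0\<^sub>v ?n" using uc by (intro eq_vecI) auto
    then show False using u by simp
  next
    case 2
    \<comment> \<open>In the standard flag, member \<open>p\<close> is spanned by the first
      \<open>p\<close> unit vectors and contains no nonzero vector vanishing in the first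
      \<open>p\<close> coordinates.\<close>
    let ?h = "\<lambda>k. unit_vec ?n (id k) :: complex vec"
    have "flag ?n ?h \<in> ?H" by (rule unit_flag_Hess[OF bij_betw_id ab m])
    then have "flag ?n ?h \<in> ?D" by (rule subsetD[OF 2])
    then obtain u where u: "u \<in> vspan ?n ?h p" "u \<noteq> 0\<^sub>v ?n" "\<And>r. r < p \<Longrightarrow> u $ r = 0"
      using i pq by (auto simp: flag_nth)
    have "vecs ?n ?h" by (simp add: vecs_def)
    then have uc: "u \<in> carrier_vec ?n" using vspan_carrier[of ?n ?h p] u(1) by auto
    have "u $ s = 0" if s: "s < ?n" for s
    proof (cases "s < p")
      case False
      then have "s \<notin> id ` {..<p}" by simp
      then show ?thesis using vspan_unit_zero[OF u(1) s] by simp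
    qed (use u(3) in blast)
    then have "u = 0\<^sub>v ?n" using uc by (intro eq_vecI) auto
    then show False using u by simp
  qed
qed

theorem theorem1:
  fixes p q n :: nat and m :: "nat \<Rightarrow> nat" and a b :: complex
  assumes "q \<ge> 1" and "p \<ge> q" and "n = p + q"
    and "a \<noteq> b"
    and "hessenberg_vector n m"
  shows "(irreducible_in (zariski_flags n) (Hess n (x_pq p q a b) m)
            \<longleftrightarrow> (\<exists>l. hessenberg_vector q l \<and> (\<forall>i\<in>{1..q}. m i = l i + p) \<and> (\<forall>i\<in>{q<..n}. m i = n)))
       \<and> ((\<exists>l. hessenberg_vector q l \<and> (\<forall>i\<in>{1..q}. m i = l i + p) \<and> (\<forall>i\<in>{q<..n}. m i = n))
            \<longleftrightarrow> (\<exists>w. w permutes {1..q} \<and> avoids_231 q w \<and>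
                   Hess n (x_pq p q a b) m = zariski_flags n closure_of gamma_orbit p q a b w))
       \<and> inj_on (gamma_orbit p q a b) {w. w permutes {1..q} \<and> avoids_231 q w}
       \<and> real (card (gamma_orbit p q a b ` {w. w permutes {1..q} \<and> avoids_231 q w}))
           = 1 / (real q + 1) * real ((2 * q) choose q)"
proof -
  note n = assms(3) and ab = assms(4)
  have pq: "1 \<le> q" "q \<le> p" using assms by auto
  have m: "hessenberg_vector (p + q) m" using assms by simp
  let ?I = "irreducible_in (zariski_flags n) (Hess n (x_pq p q a b) m)"
    and ?L = "\<exists>l. hessenberg_vector q l \<and> (\<forall>i\<in>{1..q}. m i = l i + p) \<and> (\<forall>i\<in>{q<..n}. m i = n)"
    and ?W = "\<exists>w. w permutes {1..q} \<and> avoids_231 q w \<and>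
                   Hess n (x_pq p q a b) m = zariski_flags n closure_of gamma_orbit p q a b w"
  have "?I \<Longrightarrow> ?L"
  proof -
    assume ?I
    then have large: "p + i \<le> m i" if "i \<in> {1..q}" for i
      using irreducible_imp_large[OF ab m that pq(2)] n by simp
    have mm: "m i \<le> p + q" if "i \<in> {1..p + q}" for i using m that by (simp add: hessenberg_vector_def)
    have mono: "m i \<le> m j" if "i \<in> {1..p + q}" "j \<in> {1..p + q}" "i \<le> j" for i j
      using m that by (auto simp: hessenberg_vector_def mono_on_def)
    have "hessenberg_vector q (\<lambda>i. m i - p)"
      unfolding hessenberg_vector_def
    proof (intro conjI ballI)
      show "mono_on {1..q} (\<lambda>i. m i - p)" by (intro mono_onI diff_le_mono mono) auto
      fix i assume i: "i \<in> {1..q}"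
      show "i \<le> m i - p" using large[OF i] by simp
      show "m i - p \<le> q" using mm[of i] i by auto
    qed
    moreover have "\<forall>i\<in>{1..q}. m i = m i - p + p" using large by fastforce
    moreover have "m i = n" if i: "i \<in> {q<..n}" for i
    proof -
      \<comment> \<open>At \<open>i = q\<close> the inequality \<open>p + i \<le> m i\<close>
        already reads \<open>n \<le> m q\<close>, and monotonicity carries it to all later
        indices.\<close>
      have "p + q \<le> m q" using large[of q] pq by simp
      also have "m q \<le> m i" using mono[of q i] i pq n by auto
      finally show ?thesis using mm[of i] i n by auto
    qed
    ultimately show ?L by blast
  qed
  moreover have "?L \<Longrightarrow> ?W"
  proof -
    assume ?L
    then obtain l where "shifted p q m l" unfolding shifted_def n by blast
    then show ?W using Hess_shifted[OF pq ab m] n by metis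
  qed
  moreover have "?W \<Longrightarrow> ?I"
  proof -
    assume ?W
    then obtain w where w: "w permutes {1..q}"
      and H: "Hess n (x_pq p q a b) m = zariski_flags n closure_of gamma_orbit p q a b w" by blast
    have "irreducible_in (zariski_flags n) (zariski_flags n closure_of gamma_orbit p q a b w)"
      unfolding gamma_orbit_eq[OF w pq(2) ab] n
      by (rule irreducible_closure_clan_orbit)
        (use gamma_orbit_ne[OF w pq(2) ab] gamma_orbit_eq[OF w pq(2) ab] clanD(1)[OF gclan_clan[OF w pq(2)]] in auto)
    then show ?I unfolding H .
  qed
  moreover have inj: "inj_on (gamma_orbit p q a b) {w. w permutes {1..q} \<and> avoids_231 q w}"
    using gamma_orbit_inj[OF pq ab] .
  moreover have "real (card (gamma_orbit p q a b ` {w. w permutes {1..q} \<and> avoids_231 q w}))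
           = 1 / (real q + 1) * real ((2 * q) choose q)"
    using card_image[OF inj] card_avoids_231[OF pq(1)] by simp
  ultimately show ?thesis by blast
qed

end
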